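(* Let $K\in\{1,-1\}$. Let $F:\mathcal M_K\to\mathbb R$ be a (twice differentiable) $L$-smooth and g-convex function with a global minimizer $x_g^\ast$, let $x_0\in\mathcal M_K$ be an initial point, let $R_g\ge d(x_0,x_g^\ast)$ and let $R>0$. Algorithm 1 (written out in the context) computes a point $x_T\in\mathcal B_R:=\exp_{x_0}(\bar B(0,R))$ satisfying $$F(x_T)-\min_{x\in\mathcal B_R}F(x)\le\varepsilon$$ using $\widetilde O\big(\sqrt{L(R_g+1)/\varepsilon}\big)$ queries to the gradient oracle.
   Context: $\mathcal M_K$ denotes any manifold that is a subset of an $n$-dimensional complete simply connected Riemannian manifold of constant sectional curvature $K$ (hyperbolic space if $K=-1$, the unit sphere if $K=1$), with the inherited metric, such that $\exp_{x_0}(\bar B(0,R_g))\subset\mathcal M_K$ and $\mathcal B_R\subset\mathcal M_K$, where $\bar B(0,r)\subset T_{x_0}\mathcal M_K$ is the closed ball of radius $r$. If $K=1$ one assumes $R<\pi/2$ and $R_g<\pi/2$. $d$ is the Riemannian distance. $F$ is $L$-smooth if $F(y)\le F(x)+\langle\nabla F(x),\exp_x^{-1}(y)\rangle+\frac L2d(x,y)^2$, and g-convex if $F(y)\ge F(x)+\langle\nabla F(x),\exp_x^{-1}(y)\rangle$, for all $x,y$. $\widetilde O(\cdot)$ omits logarithmic factors and treats $R\sqrt{|K|}$ as $O(1)$. Geodesic map: $h$ is the gnomonic projection ($K=1$) or the Beltrami–Klein projection ($K=-1$) into $\mathbb R^n$ with $h(x_0)=0$; writing $\tilde x=h(x)$,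 it satisfies $C_K(d(x,y))=\frac{1+K\langle\tilde x,\tilde y\rangle}{\sqrt{1+K\|\tilde x\|^2}\sqrt{1+K\|\tilde y\|^2}}$ with $C_1=\cos$, $C_{-1}=\cosh$. Put $\mathcal X=h(\mathcal B_R)$ (a closed Euclidean ball centered at $0$), $f=F\circ h^{-1}:\mathcal X\to\mathbb R$, and let $\Pi_{\mathcal X}$ be the Euclidean projection onto $\mathcal X$. Constants: $\gamma_n=\cosh^{-2}(R)$, $\gamma_p=\cosh^{-3}(R)$ if $K=-1$; $\gamma_n=\cos^3(R)$, $\gamma_p=\cos^2(R)$ if $K=1$; $\tilde L=O(L(R_g+1))$ is a Lipschitz constant of $\nabla f$ on $\mathcal X$. The number of iterations is $T=\lceil\sqrt{4\tilde L\|\tilde x_0-\tilde x^\ast\|^2/(\gamma_n^2\gamma_p\varepsilon)}\,\rceil$, where $x^\ast\in\arg\min_{\mathcal B_R}F$. Algorithm 1. Set $\tilde x_0=\tilde z_0=0$, $A_0=0$. For $i=0,\dots,T-1$: $a_{i+1}=(i+1)\gamma_n^2\gamma_p/(2\tilde L)$; $A_{i+1}=A_i+a_{i+1}$; choose $\lambda$ by the binary line search below; $\tilde\chi_i=(1-\lambda)\tilde x_i+\lambda\Pi_{\mathcal X}(\tilde z_i)$; $\tilde\zeta_i=\tilde z_i-\frac{a_{i+1}}{\gamma_n}\nabla f(\tilde\chi_i)$; $\tilde x_{i+1}=(1-\lambda)\tilde x_i+\lambda\Pi_{\mathcal X}(\tilde\zeta_i)$; $\tilde z_{i+1}=\tilde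 z_i-\frac{a_{i+1}}{\gamma_n}\nabla f(\tilde x_{i+1})$. Return $x_T=h^{-1}(\tilde x_T)$. Binary line search. For $i=0$, $\lambda=1$. For $i\ge1$ let $\hat\varepsilon_i=\frac{A_T\varepsilon}{2(T-1)A_i}$ with $A_T=T(T+1)\gamma_n^2\gamma_p/(4\tilde L)$; for $\lambda=\frac{a_{i+1}/\gamma_n}{A_i\hat\gamma+a_{i+1}/\gamma_n}$ with $\hat\gamma\in[\gamma_p,1/\gamma_n]$ put $\hat\Gamma_i(\lambda)=\hat\gamma$, let $\tilde x_{i+1}^\lambda$ be the point $\tilde x_{i+1}$ obtained with that $\lambda$, and let $\mathcal G_i(\lambda)=-\hat\Gamma_i(\lambda)\langle\nabla f(\tilde x_{i+1}^\lambda),\tilde x_{i+1}^\lambda-\tilde x_i\rangle+f(\tilde x_{i+1}^\lambda)-f(\tilde x_i)$. If the $\lambda$ corresponding to $\hat\gamma=1/\gamma_n$, or else to $\hat\gamma=\gamma_p$, satisfies $\mathcal G_i(\lambda)\le\hat\varepsilon_i$, use it. Otherwise bisect the interval between these two values, testing the midpoint and always keeping the half at whose endpoints $\langle\nabla f(\tilde x_{i+1}^\lambda),\tilde x_{i+1}^\lambda-\tilde x_i\rangle$ has opposite signs, until a midpoint $\lambda$ with $\mathcal G_i(\lambda)\le\hat\varepsilon_i$ is found. *)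

theory Defs
  imports "HOL-Analysis.Analysis" "HOL-Library.While_Combinator" "HOL-Library.Monad_Syntax"
begin

text \<open>
  Model spaces of constant curvature. A finite-dimensional subspace \<open>V\<close> of a real inner product
  space \<open>'a\<close> plays the role of \<open>\<real>\<^sup>n\<close>, with \<open>n = dim V\<close>, and the complete simply connected
  \<open>n\<close>-manifold of curvature \<open>K \<in> {1, -1}\<close> is the unit sphere or the upper sheet of the
  hyperboloid in \<open>\<real> \<times> V\<close>. The subspace is a set, not a type, so that constants can be
  quantified before the dimension: taking \<open>'a\<close> infinite-dimensional, they serve every \<open>n\<close>.
\<close>

definition form :: "real \<Rightarrow> real \<times> 'a::real_inner \<Rightarrow> real \<times> 'a \<Rightarrow> real" where
  "form K x y = K * (fst x * fst y) + snd x \<bullet> snd y"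

definition model :: "real \<Rightarrow> 'a::real_inner set \<Rightarrow> (real \<times> 'a) set" where
  "model K V = {x. snd x \<in> V \<and> form K x x = K \<and> (K = - 1 \<longrightarrow> fst x > 0)}"

definition tangent :: "real \<Rightarrow> 'a::real_inner set \<Rightarrow> real \<times> 'a \<Rightarrow> (real \<times> 'a) set" where
  "tangent K V x = {v. snd v \<in> V \<and> form K x v = 0}"

text \<open>The Riemannian metric is the restriction of \<^const>\<open>form\<close> to the tangent spaces.\<close>

definition rnorm :: "real \<Rightarrow> real \<times> 'a::real_inner \<Rightarrow> real" where
  "rnorm K v = sqrt (form K v v)"

definition cosK :: "real \<Rightarrow> real \<Rightarrow> real" where
  "cosK K t = (if K = 1 then cos t else cosh t)"

definition sinK :: "real \<Rightarrow> real \<Rightarrow> real" where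
  "sinK K t = (if K = 1 then sin t else sinh t)"

text \<open>The Riemannian distance: \<open>cosK K (rdist K x y) = K * form K x y\<close>.\<close>

definition rdist :: "real \<Rightarrow> real \<times> 'a::real_inner \<Rightarrow> real \<times> 'a \<Rightarrow> real" where
  "rdist K x y = (if K = 1 then arccos (form K x y) else arcosh (- form K x y))"

definition rexp :: "real \<Rightarrow> real \<times> 'a::real_inner \<Rightarrow> real \<times> 'a \<Rightarrow> real \<times> 'a" where
  "rexp K x v = cosK K (rnorm K v) *\<^sub>R x + (sinK K (rnorm K v) / rnorm K v) *\<^sub>R v"

definition exp_ball :: "real \<Rightarrow> 'a::real_inner set \<Rightarrow> real \<times> 'a \<Rightarrow> real \<Rightarrow> (real \<times> 'a) set" where
  "exp_ball K V x r = rexp K x ` {v \<in> tangent K V x. rnorm K v \<le> r}"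

text \<open>
  The exponential map is inverted on the domain where it is injective; on the sphere its image
  omits only the antipodal point of the base point.
\<close>

definition inj_dom :: "real \<Rightarrow> 'a::real_inner set \<Rightarrow> real \<times> 'a \<Rightarrow> (real \<times> 'a) set" where
  "inj_dom K V x = {v \<in> tangent K V x. K = 1 \<longrightarrow> rnorm K v < pi}"

definition rlog :: "real \<Rightarrow> 'a::real_inner set \<Rightarrow> real \<times> 'a \<Rightarrow> real \<times> 'a \<Rightarrow> real \<times> 'a" where
  "rlog K V x = inv_into (inj_dom K V x) (rexp K x)"

text \<open>
  For a function on a relatively open \<open>M \<subseteq> model K V\<close>, the derivative within \<open>M\<close> only sees the
  tangent directions to first order, hence the Riemannian gradient is the unique tangent vector
  representing it.
\<close>

definition rgrad ::
  "real \<Rightarrow> 'a::real_inner set \<Rightarrow> (real \<times> 'a) set \<Rightarrow> (real \<times> 'a \<Rightarrow> real) \<Rightarrow> real \<times> 'a \<Rightarrow> real \<times> 'a"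
where
  "rgrad K V M F x =
     (THE G. G \<in> tangent K V x \<and> (F has_derivative form K G) (at x within M))"

definition twice_differentiable ::
  "real \<Rightarrow> 'a::real_inner set \<Rightarrow> (real \<times> 'a) set \<Rightarrow> (real \<times> 'a \<Rightarrow> real) \<Rightarrow> bool" where
  "twice_differentiable K V M F \<longleftrightarrow> F differentiable_on M \<and> rgrad K V M F differentiable_on M"

definition L_smooth ::
  "real \<Rightarrow> 'a::real_inner set \<Rightarrow> (real \<times> 'a) set \<Rightarrow> real \<Rightarrow> (real \<times> 'a \<Rightarrow> real) \<Rightarrow> bool" where
  "L_smooth K V M L F \<longleftrightarrow>
     (\<forall>x\<in>M. \<forall>y\<in>M. y \<in> rexp K x ` inj_dom K V x \<longrightarrow>
        F y \<le> F x + form K (rgrad K V M F x) (rlog K V x y) + L / 2 * (rdist K x y)\<^sup>2)"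

definition g_convex ::
  "real \<Rightarrow> 'a::real_inner set \<Rightarrow> (real \<times> 'a) set \<Rightarrow> (real \<times> 'a \<Rightarrow> real) \<Rightarrow> bool" where
  "g_convex K V M F \<longleftrightarrow>
     (\<forall>x\<in>M. \<forall>y\<in>M. y \<in> rexp K x ` inj_dom K V x \<longrightarrow>
        F y \<ge> F x + form K (rgrad K V M F x) (rlog K V x y))"

text \<open>
  The gnomonic (\<open>K = 1\<close>) or Beltrami--Klein (\<open>K = -1\<close>) projection centred at \<open>x0\<close>: central
  projection from the origin onto the affine hyperplane \<open>x0 + tangent K V x0\<close>, followed by an
  identification \<open>\<phi>\<close> of the tangent space at \<open>x0\<close> with the Euclidean space \<open>V\<close>.
\<close>

definition tangent_frame ::
  "real \<Rightarrow> 'a::real_inner set \<Rightarrow> real \<times> 'a \<Rightarrow> (real \<times> 'a \<Rightarrow> 'a) \<Rightarrow> bool" where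
  "tangent_frame K V x0 \<phi> \<longleftrightarrow>
     linear \<phi> \<and> \<phi> ` tangent K V x0 = V \<and> (\<forall>v\<in>tangent K V x0. norm (\<phi> v) = rnorm K v)"

definition geodesic_map ::
  "real \<Rightarrow> real \<times> 'a::real_inner \<Rightarrow> (real \<times> 'a \<Rightarrow> 'a) \<Rightarrow> real \<times> 'a \<Rightarrow> 'a" where
  "geodesic_map K x0 \<phi> x = \<phi> ((1 / (K * form K x0 x)) *\<^sub>R x - x0)"

definition gamma_n :: "real \<Rightarrow> real \<Rightarrow> real" where
  "gamma_n K R = (if K = 1 then cos R ^ 3 else 1 / cosh R ^ 2)"

definition gamma_p :: "real \<Rightarrow> real \<Rightarrow> real" where
  "gamma_p K R = (if K = 1 then cos R ^ 2 else 1 / cosh R ^ 3)"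

definition grad_on :: "'a::real_inner set \<Rightarrow> 'a set \<Rightarrow> ('a \<Rightarrow> real) \<Rightarrow> 'a \<Rightarrow> 'a" where
  "grad_on V X f x = (THE g. g \<in> V \<and> (f has_derivative (\<lambda>w. g \<bullet> w)) (at x within X))"

definition proj_onto :: "'a::real_inner set \<Rightarrow> 'a \<Rightarrow> 'a" where
  "proj_onto X z = (SOME p. p \<in> X \<and> (\<forall>y\<in>X. dist z p \<le> dist z y))"

text \<open>
  The accelerated method, for an objective \<open>f\<close> on \<open>X\<close> with gradient \<open>gf\<close>. Lists of type
  \<open>'a list\<close> record the points at which \<open>gf\<close> is queried.
\<close>

locale accelerated_method =
  fixes f :: "'a::real_inner \<Rightarrow> real" and gf :: "'a \<Rightarrow> 'a" and X :: "'a set"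
    and \<gamma>n \<gamma>p Lt \<epsilon> :: real and T :: nat
begin

definition a :: "nat \<Rightarrow> real" where
  "a i = real i * \<gamma>n\<^sup>2 * \<gamma>p / (2 * Lt)"

definition A :: "nat \<Rightarrow> real" where
  "A i = (\<Sum>j=1..i. a j)"

text \<open>In the following, \<open>x\<close> and \<open>z\<close> are the iterates at the beginning of iteration \<open>i\<close>.\<close>

definition chi :: "'a \<Rightarrow> 'a \<Rightarrow> real \<Rightarrow> 'a" where
  "chi x z t = (1 - t) *\<^sub>R x + t *\<^sub>R proj_onto X z"

definition zeta :: "nat \<Rightarrow> 'a \<Rightarrow> 'a \<Rightarrow> real \<Rightarrow> 'a" where
  "zeta i x z t = z - (a (i + 1) / \<gamma>n) *\<^sub>R gf (chi x z t)"

definition x_next :: "nat \<Rightarrow> 'a \<Rightarrow> 'a \<Rightarrow> real \<Rightarrow> 'a" where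
  "x_next i x z t = (1 - t) *\<^sub>R x + t *\<^sub>R proj_onto X (zeta i x z t)"

definition z_next :: "nat \<Rightarrow> 'a \<Rightarrow> 'a \<Rightarrow> real \<Rightarrow> 'a" where
  "z_next i x z t = z - (a (i + 1) / \<gamma>n) *\<^sub>R gf (x_next i x z t)"

definition lam :: "nat \<Rightarrow> real \<Rightarrow> real" where
  "lam i \<gamma> = (a (i + 1) / \<gamma>n) / (A i * \<gamma> + a (i + 1) / \<gamma>n)"

definition Gamma_hat :: "nat \<Rightarrow> real \<Rightarrow> real" where
  "Gamma_hat i = inv_into {\<gamma>p..1 / \<gamma>n} (lam i)"

definition eps_hat :: "nat \<Rightarrow> real" where
  "eps_hat i = A T * \<epsilon> / (2 * (real T - 1) * A i)"

definition slope :: "nat \<Rightarrow> 'a \<Rightarrow> 'a \<Rightarrow> real \<Rightarrow> real" where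
  "slope i x z t = gf (x_next i x z t) \<bullet> (x_next i x z t - x)"

definition G :: "nat \<Rightarrow> 'a \<Rightarrow> 'a \<Rightarrow> real \<Rightarrow> real" where
  "G i x z t = - Gamma_hat i t * slope i x z t + f (x_next i x z t) - f x"

text \<open>
  Evaluating \<^const>\<open>slope\<close> and \<^const>\<open>G\<close> at a trial value \<open>t\<close> takes the gradients at these two
  points. The values at the ends of a bisection interval come from earlier trials.
\<close>

definition trial :: "nat \<Rightarrow> 'a \<Rightarrow> 'a \<Rightarrow> real \<Rightarrow> 'a list" where
  "trial i x z t = [chi x z t, x_next i x z t]"

text \<open>
  The state of the bisection is \<open>(lo, hi, qs)\<close>; the loop guard is the trial of the midpoint.
  The result is \<^const>\<open>None\<close> iff the bisection does not terminate.
\<close>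

definition bisect :: "nat \<Rightarrow> 'a \<Rightarrow> 'a \<Rightarrow> real \<Rightarrow> real \<Rightarrow> (real \<times> 'a list) option" where
  "bisect i x z l r = do {
     (lo, hi, qs) \<leftarrow> while_option
       (\<lambda>(lo, hi, qs). \<not> G i x z ((lo + hi) / 2) \<le> eps_hat i)
       (\<lambda>(lo, hi, qs).
          let mid = (lo + hi) / 2; qs' = qs @ trial i x z mid
          in if slope i x z lo * slope i x z mid < 0 then (lo, mid, qs') else (mid, hi, qs'))
       (l, r, []);
     Some ((lo + hi) / 2, qs @ trial i x z ((lo + hi) / 2)) }"

definition line_search :: "nat \<Rightarrow> 'a \<Rightarrow> 'a \<Rightarrow> (real \<times> 'a list) option" where
  "line_search i x z =
     (if i = 0 then Some (1, [])
      else let l = lam i (1 / \<gamma>n); r = lam i \<gamma>p in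
        if G i x z l \<le> eps_hat i then Some (l, trial i x z l)
        else if G i x z r \<le> eps_hat i then Some (r, trial i x z l @ trial i x z r)
        else do {
          (t, qs) \<leftarrow> bisect i x z l r;
          Some (t, trial i x z l @ trial i x z r @ qs) })"

text \<open>
  \<open>run i\<close> is the state \<open>(x, z, qs)\<close> after \<open>i\<close> iterations. The two gradients used by the updates
  are counted as queries of their own, although the line search may have computed them already.
\<close>

primrec run :: "nat \<Rightarrow> ('a \<times> 'a \<times> 'a list) option" where
  "run 0 = Some (0, 0, [])"
| "run (Suc i) = do {
     (x, z, qs) \<leftarrow> run i;
     (t, qs') \<leftarrow> line_search i x z;
     Some (x_next i x z t, z_next i x z t, qs @ qs' @ [chi x z t, x_next i x z t]) }"

end

definition num_iterations :: "real \<Rightarrow> real \<Rightarrow> real \<Rightarrow> real \<Rightarrow> 'a::real_inner \<Rightarrow> nat" where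
  "num_iterations \<gamma>n \<gamma>p Lt \<epsilon> \<Delta> = nat \<lceil>sqrt (4 * Lt * (norm \<Delta>)\<^sup>2 / (\<gamma>n\<^sup>2 * \<gamma>p * \<epsilon>))\<rceil>"

end

theory Submission
  imports Defs
begin

text \<open>
  Pulled back to the chart, \<open>F\<close> becomes a function \<open>f\<close> on a Euclidean ball. Geodesics are straight
  there, and \<open>exp\<^bsub>H x\<^esub>\<^bsup>-1\<^esup>(H y) = \<kappa> dH\<^sub>x(y - x)\<close> where \<open>H\<close> is the inverse chart and
  \<open>\<kappa> = (r / sin\<^sub>K r) * (n x / n y)\<close> with \<open>n x = sqrt (1 + K |x|\<^sup>2)\<close>, \<open>r = d (H x) (H y)\<close>. Since
  \<open>\<gamma>\<^sub>p \<le> \<kappa> \<le> 1 / \<gamma>\<^sub>n\<close>, g-convexity turns into convexity with a tilted slope. Since moreover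
  \<open>\<kappa> - 1\<close> is \<open>O(|y - x|)\<close> and \<open>\<nabla>f\<close> is \<open>O(L (R\<^sub>g + 1))\<close>, \<open>f\<close> is approximated to second order by its
  linearisation with constant \<open>O(L (R\<^sub>g + 1))\<close>, which makes \<open>\<nabla>f\<close> Lipschitz. The bound on \<open>\<nabla>f\<close> starts from
  \<open>|\<nabla>F(x\<^sub>0)| \<le> L R\<^sub>g\<close>, obtained by a gradient step of length \<open>R\<^sub>g\<close>.

  A duality gap is monotone along the method up to the errors admitted by the line search. If the
  line search fails at both ends of its interval, tilted convexity forces opposite signs of the slope
  there; at a zero of the slope in between the test value is at most \<open>0\<close>, and it is Lipschitz in the
  step \<open>\<lambda>\<close>, so logarithmically many bisections suffice.
\<close>

section \<open>The accelerated method for tilted convex functions\<close>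

text \<open>All constants must be uniform in the dimension and in \<open>0 < R \<le> Rmax\<close>.
  The first demand puts the argument into finite-dimensional subspaces of an arbitrary inner product
  space, where gradients come from orthogonal expansions and nearest points from explicit formulas.
  The second lets the radius \<rho> of the Euclidean ball be arbitrarily small: dividing an
  oscillation of \<open>f\<close> by \<rho> bounds the gradient uniformly only if that oscillation
  is itself proportional to \<rho>. Everything else is measured by one number \<omega> bounding
  \<open>cosK K R\<close> and its reciprocal; its powers are not optimised.

  The obstacle in the method is that \<kappa> is only known to lie in an interval, so a minorant
  must take the end of the interval that the sign of the slope permits. Towards the minimizer this
  sign is known. Towards the previous iterate it is not, and the tilt \<gamma> that is wanted there
  also determines the step and hence the point at which the slope is taken. The line search resolves
  this coupling: it finds a \<gamma> for which the tilted inequality at the resulting point holds up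
  to a small error.\<close>

lemma closest_point_variational:
  fixes z p y :: "'a::real_inner"
  assumes "convex S" "p \<in> S" "y \<in> S" "\<forall>y\<in>S. dist z p \<le> dist z y"
  shows "(z - p) \<bullet> (y - p) \<le> 0"
proof -
  \<comment> \<open>The segment is compact and still has \<open>p\<close> as a nearest point, so the
    characterisation for closed convex sets applies to it in place of \<open>S\<close>.\<close>
  have "closed_segment p y \<subseteq> S"
    using assms closed_segment_subset by blast
  then show ?thesis
    using any_closest_point_dot[of "closed_segment p y" p y z] assms
    by (auto simp: compact_imp_closed)
qed

text \<open>The tilt \<kappa> may depend on both points. The bounds \<open>D\<close> and
  \<open>Gm\<close> influence only the number of bisections, not the accuracy reached.\<close>

locale tilted_accelerated_method = accelerated_method f gf X \<gamma>n \<gamma>p Lt \<epsilon> T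
  for f :: "'a::real_inner \<Rightarrow> real" and gf X \<gamma>n \<gamma>p Lt \<epsilon> T +
  fixes V :: "'a set" and D Gm :: real
  assumes subspace_V: "subspace V"
    and X_subset: "X \<subseteq> V" and convex_X: "convex X" and zero_in_X: "0 \<in> X"
    and nearest: "z \<in> V \<Longrightarrow> \<exists>p\<in>X. \<forall>y\<in>X. dist z p \<le> dist z y"
    and gf_in_V: "x \<in> X \<Longrightarrow> gf x \<in> V"
    and gf_lipschitz: "Lt-lipschitz_on X gf"
    and gamma_n: "0 < \<gamma>n" "\<gamma>n \<le> 1" and gamma_p: "0 < \<gamma>p" "\<gamma>p \<le> 1"
    and Lt_pos: "0 < Lt" and eps_pos: "0 < \<epsilon>"
    and tilted: "x \<in> X \<Longrightarrow> y \<in> X \<Longrightarrow>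
        \<exists>\<kappa>. \<gamma>p \<le> \<kappa> \<and> \<kappa> \<le> 1 / \<gamma>n \<and> f x + \<kappa> * (gf x \<bullet> (y - x)) \<le> f y"
    and diam: "x \<in> X \<Longrightarrow> y \<in> X \<Longrightarrow> norm (x - y) \<le> D"
    and gf_bound: "x \<in> X \<Longrightarrow> norm (gf x) \<le> Gm"
begin

section \<open>Projection onto the feasible set and tilted minorants\<close>

abbreviation P :: "'a \<Rightarrow> 'a" where "P \<equiv> proj_onto X"

lemma proj:
  assumes "z \<in> V"
  shows proj_mem: "P z \<in> X" and proj_variational: "y \<in> X \<Longrightarrow> (z - P z) \<bullet> (y - P z) \<le> 0"
proof -
  have *: "P z \<in> X \<and> (\<forall>y\<in>X. dist z (P z) \<le> dist z y)"
    unfolding proj_onto_def by (rule someI_ex) (use nearest[OF assms] in blast)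
  then show "P z \<in> X" by simp
  show "(z - P z) \<bullet> (y - P z) \<le> 0" if "y \<in> X"
    using closest_point_variational[OF convex_X _ that] * by blast
qed

lemma proj_nonexpansive:
  assumes "z \<in> V" "z' \<in> V"
  shows "norm (P z - P z') \<le> norm (z - z')"
proof -
  have "(z - P z) \<bullet> (P z' - P z) \<le> 0" "(z' - P z') \<bullet> (P z - P z') \<le> 0"
    using assms proj_variational proj_mem by auto
  then have "(P z - P z') \<bullet> (P z - P z') \<le> (z - z') \<bullet> (P z - P z')"
    by (simp add: algebra_simps inner_commute)
  also have "\<dots> \<le> norm (z - z') * norm (P z - P z')"
    by (rule norm_cauchy_schwarz)
  finally show ?thesis
    by (cases "norm (P z - P z') = 0") (simp_all add: dot_square_norm power2_eq_square)
qed

lemma gf_dist: "x \<in> X \<Longrightarrow> y \<in> X \<Longrightarrow> norm (gf x - gf y) \<le> Lt * norm (x - y)"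
  using lipschitz_onD[OF gf_lipschitz, of x y] by (simp add: dist_norm)

lemma D_nonneg: "0 \<le> D" and Gm_nonneg: "0 \<le> Gm"
  using diam[OF zero_in_X zero_in_X] order_trans[OF norm_ge_zero gf_bound[OF zero_in_X]] by auto

lemma inv_gamma_n: "1 \<le> 1 / \<gamma>n" "\<gamma>p \<le> 1 / \<gamma>n"
  using gamma_n gamma_p by (simp_all add: field_simps mult_le_one)

lemma tilted_nonneg:
  assumes "x \<in> X" "y \<in> X" "0 \<le> gf x \<bullet> (y - x)"
  shows "f x + \<gamma>p * (gf x \<bullet> (y - x)) \<le> f y"
  using tilted[OF assms(1,2)] assms(3)
  by (meson add_left_mono mult_right_mono order_trans)

lemma tilted_nonpos:
  assumes "x \<in> X" "y \<in> X" "gf x \<bullet> (y - x) \<le> 0"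
  shows "f x + 1 / \<gamma>n * (gf x \<bullet> (y - x)) \<le> f y"
  using tilted[OF assms(1,2)] assms(3)
  by (meson add_left_mono mult_right_mono_neg order_trans)

lemma f_diff_le:
  assumes "x \<in> X" "y \<in> X"
  shows "f x - f y \<le> 1 / \<gamma>n * Gm * norm (x - y)"
proof -
  obtain \<kappa> where \<kappa>: "\<gamma>p \<le> \<kappa>" "\<kappa> \<le> 1 / \<gamma>n" "f x + \<kappa> * (gf x \<bullet> (y - x)) \<le> f y"
    using tilted[OF assms] by blast
  have "f x - f y \<le> \<kappa> * (gf x \<bullet> (x - y))"
    using \<kappa>(3) by (simp add: inner_diff_right algebra_simps)
  also have "\<dots> \<le> \<kappa> * (norm (gf x) * norm (x - y))"
    using \<kappa>(1) gamma_p by (intro mult_left_mono norm_cauchy_schwarz) auto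
  also have "\<dots> \<le> 1 / \<gamma>n * (Gm * norm (x - y))"
    using \<kappa> gamma_p gf_bound[OF assms(1)] Gm_nonneg gamma_n
    by (intro mult_mono mult_right_mono) auto
  finally show ?thesis by simp
qed

text \<open>A positive slope towards \<open>xs\<close> would give \<open>f xs > f x\<close> by the
  minorant with tilt \<gamma>p. So the slope is nonpositive and the tilt
  \<open>1 / \<gamma>n\<close> is admissible. This factor is the reason why the dual step is
  \<open>a (i + 1) / \<gamma>n\<close> while the weight is \<open>a (i + 1)\<close>.\<close>

lemma minimizer_lower_bound:
  assumes "x \<in> X" "xs \<in> X" "\<forall>y\<in>X. f xs \<le> f y"
  shows "f x + 1 / \<gamma>n * (gf x \<bullet> (xs - x)) \<le> f xs"
proof (cases "gf x \<bullet> (xs - x) \<le> 0")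
  case False
  then have "0 < \<gamma>p * (gf x \<bullet> (xs - x))" using gamma_p by simp
  with tilted_nonneg[OF assms(1,2)] False assms show ?thesis by fastforce
qed (use tilted_nonpos assms in auto)

section \<open>Weights, steps and tilts\<close>

definition \<alpha> :: "nat \<Rightarrow> real" where "\<alpha> i = a (i + 1) / \<gamma>n"

lemma \<alpha>_eq: "\<alpha> i = (real i + 1) * \<gamma>n * \<gamma>p / (2 * Lt)"
  using gamma_n Lt_pos by (simp add: \<alpha>_def a_def divide_simps power2_eq_square)

lemma \<alpha>_pos: "0 < \<alpha> i"
  unfolding \<alpha>_eq using gamma_n gamma_p Lt_pos by simp

lemma a_Suc: "a (Suc i) = \<gamma>n * \<alpha> i"
  using gamma_n by (simp add: \<alpha>_def)

lemma A_Suc: "A (Suc i) = A i + \<gamma>n * \<alpha> i"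
  by (simp add: A_def a_Suc)

lemma A_0 [simp]: "A 0 = 0" by (simp add: A_def)

lemma A_eq: "A i = real i * (real i + 1) * \<gamma>n\<^sup>2 * \<gamma>p / (4 * Lt)"
proof (induction i)
  case (Suc i)
  have "\<gamma>n * \<alpha> i = 2 * (real i + 1) * \<gamma>n\<^sup>2 * \<gamma>p / (4 * Lt)"
    using Lt_pos by (simp add: \<alpha>_eq divide_simps power2_eq_square)
  then show ?case
    by (simp add: A_Suc Suc add_divide_distrib[symmetric]) (simp add: algebra_simps)
qed simp

lemma A_nonneg: "0 \<le> A i" and A_pos: "0 < i \<Longrightarrow> 0 < A i"
  unfolding A_eq using gamma_n gamma_p Lt_pos by simp_all

lemma A_mono: "i \<le> j \<Longrightarrow> A i \<le> A j"
  unfolding A_eq using gamma_n gamma_p Lt_pos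
  by (intro divide_right_mono mult_right_mono mult_mono) auto

lemma lam_eq: "lam i \<gamma> = \<alpha> i / (A i * \<gamma> + \<alpha> i)"
  by (simp add: lam_def \<alpha>_def)

text \<open>The accumulated weight is zero at the start, so every tilt yields the step 1 that the
  method prescribes for its first iteration.\<close>

lemma lam_0: "lam 0 \<gamma> = 1"
  using \<alpha>_pos[of 0] by (simp add: lam_eq)

lemma lam_denom_pos: "0 \<le> \<gamma> \<Longrightarrow> 0 < A i * \<gamma> + \<alpha> i"
  using A_nonneg[of i] \<alpha>_pos[of i] by (simp add: add_nonneg_pos)

lemma lam_bounds: "0 \<le> \<gamma> \<Longrightarrow> 0 \<le> lam i \<gamma>" "0 \<le> \<gamma> \<Longrightarrow> lam i \<gamma> \<le> 1"
  using A_nonneg[of i] \<alpha>_pos[of i] lam_denom_pos[of \<gamma> i] by (simp_all add: lam_eq)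

text \<open>This inequality explains the size of \<open>a\<close>. It amounts to \<open>\<alpha> i *
  Lt * \<alpha> i \<le> A i * \<gamma> + \<alpha> i\<close>, and \<gamma>p is the worst tilt. Over
  the denominator \<open>4 * Lt\<close> the left side exceeds the quadratic term of
  \<open>A i * \<gamma>p\<close> by \<open>(i + 1) * (\<gamma>n * \<gamma>p)^2\<close>, which
  \<open>\<alpha> i\<close> covers because \<open>\<gamma>n * \<gamma>p \<le> 1\<close>.\<close>

lemma \<alpha>_Lt_lam_le: 
  assumes "\<gamma>p \<le> \<gamma>"
  shows "\<alpha> i * Lt * lam i \<gamma> \<le> 1"
proof -
  have "\<gamma>n * \<gamma>p \<le> 1" using gamma_n gamma_p by (simp add: mult_le_one)
  then have "(real i + 1) * (\<gamma>n * \<gamma>p) * (\<gamma>n * \<gamma>p) \<le> (real i + 1) * 2 * (\<gamma>n * \<gamma>p)"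
    using gamma_n gamma_p by (intro mult_right_mono mult_left_mono) auto
  then have "((real i + 1) * (real i + 1) * \<gamma>n\<^sup>2 * \<gamma>p\<^sup>2) / (4 * Lt) \<le>
      (real i * (real i + 1) * \<gamma>n\<^sup>2 * \<gamma>p\<^sup>2 + 2 * (real i + 1) * \<gamma>n * \<gamma>p) / (4 * Lt)"
    using Lt_pos by (intro divide_right_mono) (auto simp: algebra_simps power2_eq_square)
  also have "\<dots> = A i * \<gamma>p + \<alpha> i"
    unfolding \<alpha>_eq A_eq using Lt_pos
    by (simp add: divide_simps power2_eq_square)
  finally have "\<alpha> i * Lt * \<alpha> i \<le> A i * \<gamma>p + \<alpha> i"
    unfolding \<alpha>_eq using Lt_pos by (simp add: power2_eq_square mult_ac)
  also have "\<dots> \<le> A i * \<gamma> + \<alpha> i"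
    using A_nonneg assms by (simp add: mult_left_mono)
  finally show ?thesis
    using lam_denom_pos[of \<gamma> i] assms gamma_p by (simp add: lam_eq field_simps)
qed

lemma lam_antimono:
  assumes "0 \<le> \<gamma>" "\<gamma> \<le> \<gamma>'"
  shows "lam i \<gamma>' \<le> lam i \<gamma>"
  unfolding lam_eq using assms A_nonneg \<alpha>_pos[of i] lam_denom_pos[of \<gamma> i]
  by (intro divide_left_mono mult_pos_pos lam_denom_pos add_right_mono mult_left_mono) auto

text \<open>For positive \<open>i\<close> the weight \<open>A i\<close> is positive and
  \<open>lam i\<close> is injective; at \<open>i = 0\<close> it is constant and cannot be
  inverted.\<close>

lemma Gamma_hat_lam:
  assumes "0 < i" "\<gamma> \<in> {\<gamma>p..1 / \<gamma>n}"
  shows "Gamma_hat i (lam i \<gamma>) = \<gamma>"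
  unfolding Gamma_hat_def
proof (rule inv_into_f_f)
  show "inj_on (lam i) {\<gamma>p..1 / \<gamma>n}"
  proof (rule inj_onI)
    fix u v assume u: "u \<in> {\<gamma>p..1 / \<gamma>n}" and v: "v \<in> {\<gamma>p..1 / \<gamma>n}" and eq: "lam i u = lam i v"
    have "0 < A i * u + \<alpha> i" "0 < A i * v + \<alpha> i"
      using u v gamma_p by (auto intro!: lam_denom_pos)
    then show "u = v"
      using eq \<alpha>_pos[of i] A_pos[OF assms(1)] by (auto simp: lam_eq frac_eq_eq)
  qed
qed (use assms in auto)

text \<open>Bisection moves the step \<open>t\<close>, whereas the convergence estimate is phrased
  in the tilt; this translates a midpoint back into a tilt.\<close>

lemma lam_surj:
  assumes "0 < i" "lam i (1 / \<gamma>n) \<le> t" "t \<le> lam i \<gamma>p"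
  obtains \<gamma> where "\<gamma> \<in> {\<gamma>p..1 / \<gamma>n}" "lam i \<gamma> = t"
proof -
  have "continuous_on {\<gamma>p..1 / \<gamma>n} (lam i)"
    unfolding lam_eq using gamma_p lam_denom_pos[of _ i]
    by (intro continuous_intros) (metis atLeastAtMost_iff less_eq_real_def order_less_le_trans less_irrefl)
  then have "\<exists>\<gamma>. \<gamma>p \<le> \<gamma> \<and> \<gamma> \<le> 1 / \<gamma>n \<and> lam i \<gamma> = t"
    using assms inv_gamma_n by (intro IVT2') auto
  then show ?thesis using that by auto
qed

section \<open>Estimates for a single iteration\<close>

context
  fixes x z :: 'a
  assumes x: "x \<in> X" and z: "z \<in> V"
begin

lemma chi_mem: "0 \<le> t \<Longrightarrow> t \<le> 1 \<Longrightarrow> chi x z t \<in> X"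
  unfolding chi_def using convexD[OF convex_X x proj_mem[OF z], of "1 - t" t] by simp

lemma zeta_mem: "0 \<le> t \<Longrightarrow> t \<le> 1 \<Longrightarrow> zeta i x z t \<in> V"
  unfolding zeta_def using chi_mem gf_in_V z subspace_V
  by (auto intro!: subspace_diff subspace_mul)

lemma x_next_mem: "0 \<le> t \<Longrightarrow> t \<le> 1 \<Longrightarrow> x_next i x z t \<in> X"
  unfolding x_next_def using convexD[OF convex_X x proj_mem[OF zeta_mem], of t "1 - t" t] by simp

lemma z_next_mem: "0 \<le> t \<Longrightarrow> t \<le> 1 \<Longrightarrow> z_next i x z t \<in> V"
  unfolding z_next_def using x_next_mem gf_in_V z subspace_V
  by (auto intro!: subspace_diff subspace_mul)

text \<open>
  The extragradient step: \<open>v = P (zeta)\<close> is computed with the gradient at \<^const>\<open>chi\<close> instead of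
  \<^const>\<open>x_next\<close>, and the resulting error is absorbed by the two squared distances because
  \<open>x_next - chi = t (v - P z)\<close> and \<open>\<alpha> Lt t \<le> 1\<close>.
\<close>

lemma extragradient:
  fixes i t
  assumes t: "0 \<le> t" "t \<le> 1" "\<alpha> i * Lt * t \<le> 1"
  defines "v \<equiv> P (zeta i x z t)" and "w \<equiv> P z" and "w' \<equiv> P (z_next i x z t)"
    and "g' \<equiv> gf (x_next i x z t)"
  shows "\<alpha> i * (g' \<bullet> (v - w')) + z \<bullet> (w' - w) \<le> (norm w')\<^sup>2 / 2 - (norm w)\<^sup>2 / 2"
proof -
  define g where "g = gf (chi x z t)"
  have v: "v \<in> X" and w: "w \<in> X" and w': "w' \<in> X"
    using proj_mem zeta_mem z_next_mem z t by (auto simp: v_def w_def w'_def)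
  have "(zeta i x z t - v) \<bullet> (w' - v) \<le> 0"
    unfolding v_def using zeta_mem w' t by (intro proj_variational) auto
  then have 1: "\<alpha> i * (g \<bullet> (v - w')) \<le> (v - z) \<bullet> (w' - v)"
    by (simp add: zeta_def \<alpha>_def g_def algebra_simps)
  have 2: "(z - w) \<bullet> (v - w) \<le> 0"
    unfolding w_def using z v by (intro proj_variational) auto
  have "x_next i x z t - chi x z t = t *\<^sub>R (v - w)"
    by (simp add: x_next_def chi_def v_def w_def algebra_simps)
  then have "norm (g' - g) \<le> Lt * (t * norm (v - w))"
    using gf_dist[OF x_next_mem chi_mem, of t t i] t by (simp add: g'_def g_def)
  then have "(g' - g) \<bullet> (v - w') \<le> Lt * (t * norm (v - w)) * norm (v - w')"
    by (meson mult_right_mono norm_cauchy_schwarz norm_ge_zero order_trans)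
  then have "\<alpha> i * ((g' - g) \<bullet> (v - w')) \<le> \<alpha> i * (Lt * (t * norm (v - w)) * norm (v - w'))"
    using \<alpha>_pos[of i] by (intro mult_left_mono) auto
  also have "\<dots> = (\<alpha> i * Lt * t) * (norm (v - w) * norm (v - w'))" by simp
  also have "\<dots> \<le> 1 * (norm (v - w) * norm (v - w'))"
    using t by (intro mult_right_mono) auto
  also have "\<dots> \<le> ((norm (v - w))\<^sup>2 + (norm (v - w'))\<^sup>2) / 2"
    using sum_squares_bound[of "norm (v - w)" "norm (v - w')"] by simp
  finally have 3: "2 * (\<alpha> i * ((g' - g) \<bullet> (v - w'))) \<le> (v - w) \<bullet> (v - w) + (v - w') \<bullet> (v - w')"
    by (simp add: dot_square_norm)
  have "\<alpha> i * (g' \<bullet> (v - w')) = \<alpha> i * ((g' - g) \<bullet> (v - w')) + \<alpha> i * (g \<bullet> (v - w'))"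
    by (simp add: algebra_simps)
  with 1 3 have "2 * (\<alpha> i * (g' \<bullet> (v - w'))) \<le>
      (v - w) \<bullet> (v - w) + (v - w') \<bullet> (v - w') + 2 * ((v - z) \<bullet> (w' - v))"
    by linarith
  with 2 show ?thesis
    by (simp add: power2_norm_eq_inner algebra_simps inner_commute)
qed

lemma chi_dist: "norm (chi x z t - chi x z t') \<le> \<bar>t - t'\<bar> * D"
proof -
  have "chi x z t - chi x z t' = (t - t') *\<^sub>R (P z - x)"
    by (simp add: chi_def algebra_simps)
  then show ?thesis
    using diam[OF proj_mem[OF z] x] by (simp add: mult_left_mono)
qed

text \<open>The step enters twice: as the weight of the convex combination, and through the gradient
  at \<open>chi\<close> inside the projection. The second effect carries the factor
  \<open>\<alpha> i * Lt\<close>, which is at most \<open>T\<close> because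
  \<open>i < T\<close>.\<close>

lemma x_next_dist:
  assumes "i < T" "t \<in> {0..1}" "t' \<in> {0..1}"
  shows "norm (x_next i x z t - x_next i x z t') \<le> D * (1 + T) * \<bar>t - t'\<bar>"
proof -
  let ?p = "P (zeta i x z t)" and ?p' = "P (zeta i x z t')"
  have "\<gamma>n * \<gamma>p \<le> 1" using gamma_n gamma_p by (simp add: mult_le_one)
  have "\<alpha> i * Lt = (real i + 1) * (\<gamma>n * \<gamma>p) / 2"
    unfolding \<alpha>_eq using Lt_pos by (simp add: field_simps)
  also have "\<dots> \<le> (real i + 1) * 1 / 2"
    using \<open>\<gamma>n * \<gamma>p \<le> 1\<close> by (intro divide_right_mono mult_left_mono) auto
  also have "\<dots> \<le> T" using assms(1) by simp
  finally have \<alpha>: "\<alpha> i * Lt \<le> T" .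
  have "norm (?p - ?p') \<le> norm (zeta i x z t - zeta i x z t')"
    using assms by (intro proj_nonexpansive zeta_mem) auto
  also have "\<dots> = \<alpha> i * norm (gf (chi x z t') - gf (chi x z t))"
  proof -
    have "zeta i x z t - zeta i x z t' = \<alpha> i *\<^sub>R (gf (chi x z t') - gf (chi x z t))"
      by (simp add: zeta_def \<alpha>_def scaleR_diff_right)
    then show ?thesis using \<alpha>_pos[of i] by simp
  qed
  also have "\<dots> \<le> \<alpha> i * (Lt * norm (chi x z t' - chi x z t))"
    using assms \<alpha>_pos[of i] by (intro mult_left_mono gf_dist chi_mem) auto
  also have "\<dots> \<le> \<alpha> i * (Lt * (\<bar>t' - t\<bar> * D))"
    using chi_dist \<alpha>_pos[of i] Lt_pos by (intro mult_left_mono) auto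
  also have "\<dots> = (\<alpha> i * Lt) * (\<bar>t - t'\<bar> * D)" by (simp add: abs_minus_commute)
  also have "\<dots> \<le> T * (\<bar>t - t'\<bar> * D)"
    using \<alpha> D_nonneg by (intro mult_right_mono) auto
  finally have 1: "norm (?p - ?p') \<le> T * (\<bar>t - t'\<bar> * D)" .
  have "x_next i x z t - x_next i x z t' = (t - t') *\<^sub>R (?p - x) + t' *\<^sub>R (?p - ?p')"
    by (simp add: x_next_def algebra_simps)
  then have "norm (x_next i x z t - x_next i x z t') \<le> \<bar>t - t'\<bar> * norm (?p - x) + \<bar>t'\<bar> * norm (?p - ?p')"
    by (metis norm_scaleR norm_triangle_ineq)
  also have "\<dots> \<le> \<bar>t - t'\<bar> * D + 1 * (T * (\<bar>t - t'\<bar> * D))"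
    using assms x 1 zeta_mem proj_mem
    by (intro add_mono mult_mono diam) auto
  finally show ?thesis by (simp add: algebra_simps)
qed

lemma slope_dist:
  assumes "i < T" "t \<in> {0..1}" "t' \<in> {0..1}"
  shows "\<bar>slope i x z t - slope i x z t'\<bar> \<le> (Lt * D + Gm) * (D * (1 + T) * \<bar>t - t'\<bar>)"
proof -
  let ?y = "x_next i x z t" and ?y' = "x_next i x z t'"
  have y: "?y \<in> X" "?y' \<in> X" using assms x_next_mem by auto
  have "slope i x z t - slope i x z t' = (gf ?y - gf ?y') \<bullet> (?y - x) + gf ?y' \<bullet> (?y - ?y')"
    by (simp add: slope_def algebra_simps)
  then have "\<bar>slope i x z t - slope i x z t'\<bar> \<le>
      norm (gf ?y - gf ?y') * norm (?y - x) + norm (gf ?y') * norm (?y - ?y')"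
    using Cauchy_Schwarz_ineq2[of "gf ?y - gf ?y'" "?y - x"] Cauchy_Schwarz_ineq2[of "gf ?y'" "?y - ?y'"]
    by linarith
  also have "\<dots> \<le> Lt * norm (?y - ?y') * D + Gm * norm (?y - ?y')"
    using y x Lt_pos Gm_nonneg by (intro add_mono mult_mono gf_dist diam gf_bound) auto
  also have "\<dots> = (Lt * D + Gm) * norm (?y - ?y')" by (simp add: algebra_simps)
  also have "\<dots> \<le> (Lt * D + Gm) * (D * (1 + T) * \<bar>t - t'\<bar>)"
    using Lt_pos D_nonneg Gm_nonneg assms by (intro mult_left_mono x_next_dist) auto
  finally show ?thesis .
qed

end

section \<open>Correctness and cost of the binary line search\<close>

lemma eps_hat_pos: "0 < i \<Longrightarrow> i < T \<Longrightarrow> 0 < eps_hat i"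
  unfolding eps_hat_def using A_pos eps_pos by (auto intro!: divide_pos_pos mult_pos_pos)

text \<open>A tolerance free of \<open>i\<close>, so that one number of bisections serves all
  iterations.\<close>

lemma eps_hat_ge:
  assumes "0 < i" "i < T"
  shows "\<epsilon> / (2 * T) \<le> eps_hat i"
proof -
  have "(real T - 1) * A i \<le> T * A T"
    using assms A_mono[of i T] A_nonneg by (intro mult_mono) auto
  then have "\<epsilon> * ((real T - 1) * A i) \<le> \<epsilon> * (T * A T)"
    using eps_pos by (intro mult_left_mono) auto
  then show ?thesis
    using assms A_pos eps_pos
    by (simp add: eps_hat_def field_simps)
qed

text \<open>With a nonnegative slope at this end, \<open>tilted_nonpos\<close> from the new point
  back to \<open>x\<close> has exactly the tilt \<open>1 / \<gamma>n\<close> used by the test, so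
  the test value would be at most 0. The other end, in \<open>slope_right\<close>, is the mirror
  image with \<gamma>p.\<close>

lemma slope_left:
  assumes "x \<in> X" "z \<in> V" "0 < i" "0 < e" "e < G i x z (lam i (1 / \<gamma>n))"
  shows "slope i x z (lam i (1 / \<gamma>n)) < 0"
proof (rule ccontr)
  let ?y = "x_next i x z (lam i (1 / \<gamma>n))"
  assume neg: "\<not> ?thesis"
  have y: "?y \<in> X"
    using assms gamma_n by (intro x_next_mem lam_bounds) auto
  have "gf ?y \<bullet> (x - ?y) \<le> 0"
    using neg by (simp add: slope_def algebra_simps)
  from tilted_nonpos[OF y assms(1) this] assms show False
    using gamma_n inv_gamma_n
    by (simp add: G_def Gamma_hat_lam slope_def inner_diff_right diff_divide_distrib)
qed

lemma slope_right:
  assumes "x \<in> X" "z \<in> V" "0 < i" "0 < e" "e < G i x z (lam i \<gamma>p)"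
  shows "0 < slope i x z (lam i \<gamma>p)"
proof (rule ccontr)
  let ?y = "x_next i x z (lam i \<gamma>p)"
  assume neg: "\<not> ?thesis"
  have y: "?y \<in> X"
    using assms gamma_p by (intro x_next_mem lam_bounds) auto
  have "0 \<le> gf ?y \<bullet> (x - ?y)"
    using neg by (simp add: slope_def algebra_simps)
  from tilted_nonneg[OF y assms(1) this] assms show False
    using inv_gamma_n
    by (simp add: G_def Gamma_hat_lam slope_def inner_diff_right right_diff_distrib)
qed

text \<open>One \<open>Gm\<close> comes from the variation of the slope, the other from that of
  \<open>f\<close>; \<open>D * (1 + T)\<close> is the Lipschitz constant of \<open>x_next\<close> in
  the step.\<close>

definition G_lip :: real where
  "G_lip = (Lt * D + 2 * Gm) * (D * (1 + T)) / \<gamma>n"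

text \<open>The slope has a zero \<open>s\<close> between the ends, and there the new point is no
  worse than \<open>x\<close>. So the test value at \<open>t\<close> is controlled by comparison
  with \<open>s\<close>. As the slope vanishes at \<open>s\<close>, \<open>Gamma_hat\<close> enters
  only through its value at \<open>t\<close>, which is at most \<open>1 / \<gamma>n\<close>.\<close>

lemma G_le:
  assumes "x \<in> X" "z \<in> V" "0 < i" "i < T"
    and lohi: "lam i (1 / \<gamma>n) \<le> lo" "lo \<le> hi" "hi \<le> lam i \<gamma>p"
    and slopes: "slope i x z lo \<le> 0" "0 \<le> slope i x z hi"
    and t: "t \<in> {lo..hi}"
  shows "G i x z t \<le> G_lip * (hi - lo)"
proof -
  have unit: "s \<in> {0..1}" if "s \<in> {lo..hi}" for s
    using that lohi lam_bounds[of "1 / \<gamma>n" i] lam_bounds[of \<gamma>p i] gamma_p gamma_n by auto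
  have "((Lt * D + Gm) * (D * (1 + T)))-lipschitz_on {lo..hi} (slope i x z)"
    using assms unit Lt_pos D_nonneg Gm_nonneg slope_dist[OF assms(1,2,4)]
    by (intro lipschitz_onI) (auto simp: dist_real_def mult.assoc)
  then have "continuous_on {lo..hi} (slope i x z)"
    by (rule lipschitz_on_continuous_on)
  then obtain s where s: "s \<in> {lo..hi}" "slope i x z s = 0"
    using IVT'[of "slope i x z" lo 0 hi] slopes lohi by auto
  let ?y = "x_next i x z t" and ?y' = "x_next i x z s"
  have y: "?y \<in> X" "?y' \<in> X"
    using assms unit[OF t] unit[OF s(1)] by (auto intro: x_next_mem)
  have "0 \<le> gf ?y' \<bullet> (x - ?y')"
    using s by (simp add: slope_def algebra_simps)
  from tilted_nonneg[OF y(2) assms(1) this] have "f ?y' \<le> f x"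
    using s by (simp add: slope_def inner_diff_right right_diff_distrib)
  then have f1: "f ?y - f x \<le> 1 / \<gamma>n * Gm * norm (?y - ?y')"
    using f_diff_le[OF y] by linarith
  have "norm (?y - ?y') \<le> D * (1 + T) * \<bar>t - s\<bar>"
    using assms unit[OF t] unit[OF s(1)] by (intro x_next_dist) auto
  then have f2: "1 / \<gamma>n * Gm * norm (?y - ?y') \<le> 1 / \<gamma>n * Gm * (D * (1 + T) * \<bar>t - s\<bar>)"
    using gamma_n Gm_nonneg by (intro mult_left_mono) auto
  obtain \<gamma> where \<gamma>: "\<gamma> \<in> {\<gamma>p..1 / \<gamma>n}" "lam i \<gamma> = t"
    using lam_surj[of i t] assms by auto
  have "Gamma_hat i t = \<gamma>" using Gamma_hat_lam[OF assms(3) \<gamma>(1)] \<gamma>(2) by simp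
  have sd: "\<bar>slope i x z t - slope i x z s\<bar> \<le> (Lt * D + Gm) * (D * (1 + T) * \<bar>t - s\<bar>)"
    using assms unit[OF t] unit[OF s(1)] by (intro slope_dist) auto
  have "- Gamma_hat i t * slope i x z t \<le> \<gamma> * \<bar>slope i x z t - slope i x z s\<bar>"
  proof -
    have "\<gamma> * - slope i x z t \<le> \<gamma> * \<bar>slope i x z t - slope i x z s\<bar>"
      using s \<gamma> gamma_p by (intro mult_left_mono) auto
    then show ?thesis using \<open>Gamma_hat i t = \<gamma>\<close> by simp
  qed
  also have "\<dots> \<le> 1 / \<gamma>n * ((Lt * D + Gm) * (D * (1 + T) * \<bar>t - s\<bar>))"
    using sd \<gamma> gamma_n by (intro mult_mono) auto
  finally have "G i x z t \<le> 1 / \<gamma>n * ((Lt * D + Gm) * (D * (1 + T) * \<bar>t - s\<bar>)) + (f ?y - f x)"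
    unfolding G_def by linarith
  with f1 f2 have "G i x z t \<le> 1 / \<gamma>n * ((Lt * D + Gm) * (D * (1 + T) * \<bar>t - s\<bar>)) +
      1 / \<gamma>n * Gm * (D * (1 + T) * \<bar>t - s\<bar>)"
    by linarith
  also have "\<dots> = G_lip * \<bar>t - s\<bar>"
    by (simp add: G_lip_def algebra_simps add_divide_distrib)
  also have "\<dots> \<le> G_lip * (hi - lo)"
    using t s Lt_pos D_nonneg Gm_nonneg gamma_n
    by (intro mult_left_mono) (auto simp: G_lip_def)
  finally show ?thesis .
qed

text \<open>The loop of \<open>bisect\<close> from an arbitrary state, so that an induction can vary
  the interval and the recorded queries.\<close>

definition bisect_loop :: "nat \<Rightarrow> 'a \<Rightarrow> 'a \<Rightarrow> real \<times> real \<times> 'a list \<Rightarrow> (real \<times> real \<times> 'a list) option" where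
  "bisect_loop i x z = while_option
     (\<lambda>(lo, hi, qs). \<not> G i x z ((lo + hi) / 2) \<le> eps_hat i)
     (\<lambda>(lo, hi, qs).
        let mid = (lo + hi) / 2; qs' = qs @ trial i x z mid
        in if slope i x z lo * slope i x z mid < 0 then (lo, mid, qs') else (mid, hi, qs'))"

lemma bisect_eq:
  "bisect_loop i x z (l, r, []) = Some (lo, hi, qs) \<Longrightarrow>
   bisect i x z l r = Some ((lo + hi) / 2, qs @ trial i x z ((lo + hi) / 2))"
  by (simp add: bisect_def bisect_loop_def)

lemma bisect_loop_stop:
  "G i x z ((lo + hi) / 2) \<le> eps_hat i \<Longrightarrow> bisect_loop i x z (lo, hi, qs) = Some (lo, hi, qs)"
  unfolding bisect_loop_def by (subst while_option_unfold) simp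

lemma bisect_loop_step:
  assumes "\<not> G i x z ((lo + hi) / 2) \<le> eps_hat i"
  shows "bisect_loop i x z (lo, hi, qs) = bisect_loop i x z
     (let mid = (lo + hi) / 2; qs' = qs @ trial i x z mid
      in if slope i x z lo * slope i x z mid < 0 then (lo, mid, qs') else (mid, hi, qs'))"
  unfolding bisect_loop_def using assms by (subst while_option_unfold) simp

text \<open>Induction on the number \<open>N\<close> of halvings still allowed. At
  \<open>N = 0\<close> the interval is so short that \<open>G_le\<close> makes the midpoint pass;
  every rejected midpoint halves the interval and records two queries.\<close>

lemma bisect_loop_terminates:
  assumes "x \<in> X" "z \<in> V" "0 < i" "i < T"
    and "lam i (1 / \<gamma>n) \<le> lo" "lo \<le> hi" "hi \<le> lam i \<gamma>p"
    and "slope i x z lo < 0" "0 < slope i x z hi"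
    and "G_lip * (hi - lo) \<le> eps_hat i * 2 ^ N"
  shows "\<exists>lo' hi' qs'. bisect_loop i x z (lo, hi, qs) = Some (lo', hi', qs') \<and>
     lo \<le> lo' \<and> lo' \<le> hi' \<and> hi' \<le> hi \<and> G i x z ((lo' + hi') / 2) \<le> eps_hat i \<and>
     length qs' \<le> length qs + 2 * N"
  using assms(5-)
proof (induction N arbitrary: lo hi qs)
  case 0
  then have "G i x z ((lo + hi) / 2) \<le> G_lip * (hi - lo)"
    by (intro G_le[OF assms(1-4)]) auto
  with 0 show ?case by (simp add: bisect_loop_stop)
next
  case (Suc N)
  let ?mid = "(lo + hi) / 2" and ?qs = "qs @ trial i x z ((lo + hi) / 2)"
  show ?case
  proof (cases "G i x z ?mid \<le> eps_hat i")
    case True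
    with Suc.prems show ?thesis by (simp add: bisect_loop_stop)
  next
    case False
    have "0 \<le> lo" "hi \<le> 1"
      using Suc.prems lam_bounds[of "1 / \<gamma>n" i] lam_bounds[of \<gamma>p i] gamma_p gamma_n by auto
    then have y: "x_next i x z ?mid \<in> X"
      using Suc.prems assms by (intro x_next_mem) auto
    have mid: "lo \<le> ?mid" "?mid \<le> hi" "lam i (1 / \<gamma>n) \<le> ?mid" "?mid \<le> lam i \<gamma>p"
      using Suc.prems by auto
    have half: "G_lip * (?mid - lo) \<le> eps_hat i * 2 ^ N" "G_lip * (hi - ?mid) \<le> eps_hat i * 2 ^ N"
      using Suc.prems(6) by (simp_all add: field_simps)
    \<comment> \<open>A zero slope at the midpoint would make the test value at most 0, contrary to
      its rejection. Hence the signs at the ends stay strict, and the strict product test selects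
      the right half.\<close>
    have nz: "slope i x z ?mid \<noteq> 0"
    proof
      assume 0: "slope i x z ?mid = 0"
      then have "f (x_next i x z ?mid) \<le> f x"
        using tilted_nonneg[OF y \<open>x \<in> X\<close>] by (simp add: slope_def inner_diff_right right_diff_distrib)
      with 0 False eps_hat_pos[OF \<open>0 < i\<close> \<open>i < T\<close>] show False by (simp add: G_def)
    qed
    show ?thesis
    proof (cases "0 < slope i x z ?mid")
      case True
      then have "slope i x z lo * slope i x z ?mid < 0"
        using Suc.prems(4) by (simp add: mult_neg_pos)
      then have step: "bisect_loop i x z (lo, hi, qs) = bisect_loop i x z (lo, ?mid, ?qs)"
        unfolding bisect_loop_step[OF False] by (simp add: Let_def)
      from Suc.IH[OF Suc.prems(1) mid(1,4) Suc.prems(4) True half(1), of ?qs] mid(2)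
      show ?thesis unfolding step by (force simp: trial_def)
    next
      case neg: False
      with nz have neg: "slope i x z ?mid < 0" by simp
      then have "\<not> slope i x z lo * slope i x z ?mid < 0"
        using Suc.prems(4) by (simp add: mult_less_0_iff)
      then have step: "bisect_loop i x z (lo, hi, qs) = bisect_loop i x z (?mid, hi, ?qs)"
        unfolding bisect_loop_step[OF False] by (simp add: Let_def)
      from Suc.IH[OF mid(3,2) Suc.prems(3) neg Suc.prems(5) half(2), of ?qs] mid(1)
      show ?thesis unfolding step by (force simp: trial_def)
    qed
  qed
qed

text \<open>Two queries are recorded for each end, for each of at most \<open>N\<close> rejected
  midpoints and for the accepted one, hence \<open>2 * N + 6\<close>. The starting interval has
  length at most 1, so the hypothesis on \<open>N\<close> suffices by
  \<open>eps_hat_ge\<close>.\<close>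

lemma line_search_succeeds:
  assumes "x \<in> X" "z \<in> V" "i < T" and N: "G_lip * (2 * T / \<epsilon>) \<le> 2 ^ N"
  shows "\<exists>\<gamma> qs. line_search i x z = Some (lam i \<gamma>, qs) \<and> \<gamma>p \<le> \<gamma> \<and> \<gamma> \<le> 1 / \<gamma>n \<and>
      length qs \<le> 2 * N + 6 \<and>
      (0 < i \<longrightarrow> f (x_next i x z (lam i \<gamma>)) - f x - \<gamma> * slope i x z (lam i \<gamma>) \<le> eps_hat i)"
proof (cases "i = 0")
  case True
  with inv_gamma_n show ?thesis by (auto simp: line_search_def lam_0 intro!: exI[of _ \<gamma>p])
next
  case False
  then have i: "0 < i" by simp
  let ?l = "lam i (1 / \<gamma>n)" and ?r = "lam i \<gamma>p"
  have lr: "?l \<le> ?r"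
    using gamma_p inv_gamma_n by (intro lam_antimono) auto
  have found: "f (x_next i x z (lam i \<gamma>)) - f x - \<gamma> * slope i x z (lam i \<gamma>) \<le> eps_hat i"
    if "\<gamma>p \<le> \<gamma>" "\<gamma> \<le> 1 / \<gamma>n" "G i x z (lam i \<gamma>) \<le> eps_hat i" for \<gamma>
    using that i by (simp add: G_def Gamma_hat_lam)
  consider "G i x z ?l \<le> eps_hat i" | "\<not> G i x z ?l \<le> eps_hat i" "G i x z ?r \<le> eps_hat i"
    | "eps_hat i < G i x z ?l" "eps_hat i < G i x z ?r" by linarith
  then show ?thesis
  proof cases
    case 1
    with False found[of "1 / \<gamma>n"] inv_gamma_n show ?thesis
      by (intro exI[of _ "1 / \<gamma>n"]) (simp add: line_search_def Let_def trial_def)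
  next
    case 2
    with False found[of \<gamma>p] inv_gamma_n show ?thesis
      by (intro exI[of _ \<gamma>p]) (simp add: line_search_def Let_def trial_def)
  next
    case 3
    have eps: "0 < eps_hat i" using eps_hat_pos i assms by simp
    have unit: "0 \<le> ?l" "?r \<le> 1"
      using lam_bounds gamma_p gamma_n by simp_all
    have Gl: "0 \<le> G_lip"
      using Lt_pos D_nonneg Gm_nonneg gamma_n by (simp add: G_lip_def)
    have "G_lip * (?r - ?l) \<le> G_lip * 1"
      using unit Gl by (intro mult_left_mono) auto
    also have "\<dots> = \<epsilon> / (2 * T) * (G_lip * (2 * T / \<epsilon>))"
      using assms(3) eps_pos by simp
    also have "\<dots> \<le> eps_hat i * 2 ^ N"
      using assms(3) eps_pos eps_hat_ge[OF i assms(3)] Gl eps N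
      by (intro mult_mono) auto
    finally have "G_lip * (?r - ?l) \<le> eps_hat i * 2 ^ N" .
    then obtain lo hi qs where *: "bisect_loop i x z (?l, ?r, []) = Some (lo, hi, qs)"
        "?l \<le> lo" "lo \<le> hi" "hi \<le> ?r" "G i x z ((lo + hi) / 2) \<le> eps_hat i" "length qs \<le> 2 * N"
      using bisect_loop_terminates[OF assms(1,2) i assms(3) order_refl lr order_refl
          slope_left[OF assms(1,2) i eps 3(1)] slope_right[OF assms(1,2) i eps 3(2)], of N "[]"]
      by auto
    obtain \<gamma> where \<gamma>: "\<gamma> \<in> {\<gamma>p..1 / \<gamma>n}" "lam i \<gamma> = (lo + hi) / 2"
      using lam_surj[OF i, of "(lo + hi) / 2"] * by auto
    have "line_search i x z = Some (lam i \<gamma>, trial i x z ?l @ trial i x z ?r @ qs @ trial i x z (lam i \<gamma>))"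
      using 3 i by (simp add: line_search_def Let_def bisect_eq[OF *(1)] \<gamma>(2))
    moreover have "length (trial i x z ?l @ trial i x z ?r @ qs @ trial i x z (lam i \<gamma>)) \<le> 2 * N + 6"
      using *(6) by (simp add: trial_def)
    moreover have "G i x z (lam i \<gamma>) \<le> eps_hat i" using *(5) unfolding \<gamma>(2) .
    ultimately show ?thesis
      using \<gamma>(1) found[of \<gamma>] by (meson atLeastAtMost_iff)
  qed
qed

section \<open>The duality gap\<close>

text \<open>
  The number \<open>s\<close> is \<open>\<Sum>j. a j * f (x j) - a j / \<gamma>n * (gf (x j) \<bullet> x j)\<close>; the first inequality is the
  lower estimate of \<open>f xs\<close> by the accumulated tilted minorants, the second bounds the duality gap.
\<close>

definition gap_invariant :: "'a \<Rightarrow> nat \<Rightarrow> 'a \<Rightarrow> 'a \<Rightarrow> bool" where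
  "gap_invariant xs i x z \<longleftrightarrow> x \<in> X \<and> z \<in> V \<and>
     (\<exists>s. s - z \<bullet> xs \<le> A i * f xs \<and>
       A i * f x - s + z \<bullet> P z - (norm (P z))\<^sup>2 / 2 \<le> (\<Sum>j=1..<i. A j * eps_hat j))"

lemma gap_invariant_0:
  "gap_invariant xs 0 0 0"
  unfolding gap_invariant_def using zero_in_X X_subset by (auto intro!: exI[of _ 0])

text \<open>The step \<open>lam i \<gamma>\<close> is made for the identity \<open>comb\<close>: it
  turns the slope term \<open>A i * \<gamma> * (g' \<bullet> (x - x'))\<close> of the line search
  into \<open>\<alpha> i * (g' \<bullet> (x' - v))\<close>. Together with
  \<open>extragradient\<close>, which controls \<open>g' \<bullet> (v - w')\<close>, the
  intermediate point \<open>v\<close> cancels, and only the line search error is added to the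
  gap.\<close>

lemma gap_invariant_step:
  assumes inv: "gap_invariant xs i x z" and \<gamma>: "\<gamma>p \<le> \<gamma>" "\<gamma> \<le> 1 / \<gamma>n"
    and xs: "xs \<in> X" "\<forall>y\<in>X. f xs \<le> f y"
    and G: "0 < i \<longrightarrow> f (x_next i x z (lam i \<gamma>)) - f x - \<gamma> * slope i x z (lam i \<gamma>) \<le> eps_hat i"
  shows "gap_invariant xs (Suc i) (x_next i x z (lam i \<gamma>)) (z_next i x z (lam i \<gamma>))"
proof -
  define t where "t = lam i \<gamma>"
  define x' where "x' = x_next i x z t"
  define z' where "z' = z_next i x z t"
  define v where "v = P (zeta i x z t)"
  define w where "w = P z"
  define w' where "w' = P z'"
  define g' where "g' = gf x'"
  obtain s where x: "x \<in> X" and z: "z \<in> V" and s: "s - z \<bullet> xs \<le> A i * f xs"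
    "A i * f x - s + z \<bullet> w - (norm w)\<^sup>2 / 2 \<le> (\<Sum>j=1..<i. A j * eps_hat j)"
    using inv by (auto simp: gap_invariant_def w_def)
  have t: "0 \<le> t" "t \<le> 1" "\<alpha> i * Lt * t \<le> 1"
    using \<gamma> gamma_p lam_bounds[of \<gamma> i] \<alpha>_Lt_lam_le[OF \<gamma>(1), of i] by (simp_all add: t_def)
  have x': "x' \<in> X" and z': "z' \<in> V"
    using x_next_mem z_next_mem x z t by (simp_all add: x'_def z'_def)
  have z'_eq: "z' = z - \<alpha> i *\<^sub>R g'"
    by (simp add: z'_def z_next_def \<alpha>_def g'_def x'_def)
  define s' where "s' = s + \<gamma>n * \<alpha> i * f x' - \<alpha> i * (g' \<bullet> x')"
  have "\<gamma>n * \<alpha> i * (f x' + 1 / \<gamma>n * (g' \<bullet> (xs - x'))) \<le> \<gamma>n * \<alpha> i * f xs"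
    using minimizer_lower_bound[OF x' xs] gamma_n \<alpha>_pos[of i]
    by (intro mult_left_mono) (auto simp: g'_def)
  then have "\<gamma>n * \<alpha> i * f x' + \<alpha> i * (g' \<bullet> xs) - \<alpha> i * (g' \<bullet> x') \<le> \<gamma>n * \<alpha> i * f xs"
    using gamma_n by (simp add: algebra_simps)
  then have 1: "s' - z' \<bullet> xs \<le> A (Suc i) * f xs"
    using s(1) by (simp add: s'_def z'_eq A_Suc algebra_simps)
  have denom: "t * (A i * \<gamma> + \<alpha> i) = \<alpha> i"
    using lam_denom_pos[of \<gamma> i] \<gamma> gamma_p by (simp add: t_def lam_eq)
  have "x' - x = t *\<^sub>R (v - x)"
    by (simp add: x'_def x_next_def v_def algebra_simps)
  then have "(A i * \<gamma> + \<alpha> i) *\<^sub>R (x' - x) = \<alpha> i *\<^sub>R (v - x)"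
    using denom by (simp add: mult.commute)
  then have comb: "\<alpha> i *\<^sub>R (x' - v) = (A i * \<gamma>) *\<^sub>R (x - x')"
    by (simp add: algebra_simps)
  have "\<alpha> i * (g' \<bullet> x') - \<alpha> i * (g' \<bullet> v) = g' \<bullet> (\<alpha> i *\<^sub>R (x' - v))"
    by (simp add: algebra_simps)
  also have "\<dots> = - (A i * (\<gamma> * (g' \<bullet> (x' - x))))"
    unfolding comb by (simp add: algebra_simps)
  finally have 2: "\<alpha> i * (g' \<bullet> x') - \<alpha> i * (g' \<bullet> v) = - (A i * (\<gamma> * (g' \<bullet> (x' - x))))" .
  have 3: "\<alpha> i * (g' \<bullet> (v - w')) + z \<bullet> (w' - w) \<le> (norm w')\<^sup>2 / 2 - (norm w)\<^sup>2 / 2"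
    using extragradient[OF x z t] unfolding v_def w_def w'_def g'_def x'_def z'_def .
  \<comment> \<open>In iteration 0 no test has been passed, but then the weight \<open>A 0\<close>
    is zero.\<close>
  have "A i * (f x' - f x - \<gamma> * (g' \<bullet> (x' - x))) \<le> (if i = 0 then 0 else A i * eps_hat i)"
    using G A_nonneg by (auto simp: x'_def t_def slope_def g'_def intro!: mult_left_mono)
  then have 4: "A i * f x' - A i * f x - A i * (\<gamma> * (g' \<bullet> (x' - x))) \<le> (if i = 0 then 0 else A i * eps_hat i)"
    by (simp add: algebra_simps)
  have "A (Suc i) * f x' - s' + z' \<bullet> w' - (norm w')\<^sup>2 / 2 =
      A i * f x' + \<alpha> i * (g' \<bullet> x') - s + z \<bullet> w' - \<alpha> i * (g' \<bullet> w') - (norm w')\<^sup>2 / 2"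
    by (simp add: s'_def z'_eq A_Suc algebra_simps)
  also have "\<dots> \<le> (\<Sum>j=1..<i. A j * eps_hat j) + (if i = 0 then 0 else A i * eps_hat i)"
    using 2 3 4 s(2) by (simp add: inner_diff_right right_diff_distrib)
  also have "\<dots> = (\<Sum>j=1..<Suc i. A j * eps_hat j)" by simp
  finally show ?thesis
    using 1 x' z' unfolding gap_invariant_def x'_def z'_def t_def w'_def by blast
qed

text \<open>The 8 consists of the 6 of the line search and the two gradients recorded for the update
  itself.\<close>

lemma run_succeeds:
  assumes xs: "xs \<in> X" "\<forall>y\<in>X. f xs \<le> f y" and N: "G_lip * (2 * T / \<epsilon>) \<le> 2 ^ N"
  shows "i \<le> T \<Longrightarrow> \<exists>x z qs. run i = Some (x, z, qs) \<and> gap_invariant xs i x z \<and>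
    length qs \<le> i * (2 * N + 8)"
proof (induction i)
  case 0
  show ?case by (simp add: gap_invariant_0)
next
  case (Suc i)
  then obtain x z qs where IH: "run i = Some (x, z, qs)" "gap_invariant xs i x z"
    "length qs \<le> i * (2 * N + 8)" by auto
  then have "x \<in> X" "z \<in> V" by (auto simp: gap_invariant_def)
  then obtain \<gamma> qs' where *: "line_search i x z = Some (lam i \<gamma>, qs')" "\<gamma>p \<le> \<gamma>" "\<gamma> \<le> 1 / \<gamma>n"
    "length qs' \<le> 2 * N + 6"
    "0 < i \<longrightarrow> f (x_next i x z (lam i \<gamma>)) - f x - \<gamma> * slope i x z (lam i \<gamma>) \<le> eps_hat i"
    using line_search_succeeds[of x z i N] N Suc.prems by auto
  show ?case
    using IH * gap_invariant_step[OF IH(2) *(2,3) xs *(5)] by simp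
qed

text \<open>Both halves of the final error are at most \<open>A T * \<epsilon> / 2\<close>. The
  tolerances contribute \<open>T - 1\<close> equal shares, and the initial distance contributes
  \<open>(norm xs)^2 / 2\<close>, for which \<open>num_iterations\<close> is chosen.\<close>

lemma accelerated_convergence:
  assumes xs: "xs \<in> X" "\<forall>y\<in>X. f xs \<le> f y" and N: "G_lip * (2 * T / \<epsilon>) \<le> 2 ^ N"
    and T: "T = num_iterations \<gamma>n \<gamma>p Lt \<epsilon> xs"
  shows "\<exists>x z qs. run T = Some (x, z, qs) \<and> x \<in> X \<and> f x - f xs \<le> \<epsilon> \<and>
    length qs \<le> T * (2 * N + 8)"
proof -
  obtain x z qs where run: "run T = Some (x, z, qs)" "gap_invariant xs T x z"
    "length qs \<le> T * (2 * N + 8)" using run_succeeds[OF xs N, of T] by auto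
  then obtain s where x: "x \<in> X" and z: "z \<in> V" and s: "s - z \<bullet> xs \<le> A T * f xs"
    "A T * f x - s + z \<bullet> P z - (norm (P z))\<^sup>2 / 2 \<le> (\<Sum>j=1..<T. A j * eps_hat j)"
    by (auto simp: gap_invariant_def)
  let ?q = "4 * Lt * (norm xs)\<^sup>2 / (\<gamma>n\<^sup>2 * \<gamma>p * \<epsilon>)"
  have q: "0 \<le> ?q" using Lt_pos gamma_n gamma_p eps_pos by simp
  have "sqrt ?q \<le> T"
    unfolding T num_iterations_def by (rule of_nat_ceiling)
  then have "?q \<le> (real T)\<^sup>2"
    using q by (metis real_sqrt_ge_zero real_sqrt_pow2 power_mono)
  also have "\<dots> \<le> real T * (real T + 1)" by (simp add: power2_eq_square algebra_simps)
  finally have "?q \<le> real T * (real T + 1)" .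
  then have AT: "(norm xs)\<^sup>2 \<le> A T * \<epsilon>"
    unfolding A_eq using Lt_pos gamma_n gamma_p eps_pos by (simp add: field_simps)
  have "f x - f xs \<le> \<epsilon>"
  proof (cases "T = 0")
    \<comment> \<open>Zero iterations are prescribed only if \<open>xs\<close> is the starting
      point.\<close>
    case True
    then have "run T = run 0" by (rule arg_cong)
    with run have "x = 0" by simp
    moreover have "A T = 0" using True by (simp add: A_eq)
    with AT have "xs = 0" by simp
    ultimately show ?thesis using eps_pos by simp
  next
    case False
    have "(\<Sum>j=1..<T. A j * eps_hat j) = (\<Sum>j=1..<T. A T * \<epsilon> / (2 * (real T - 1)))"
    proof (intro sum.cong refl)
      fix j assume "j \<in> {1..<T}"
      then have "A j \<noteq> 0" using A_pos[of j] by auto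
      then show "A j * eps_hat j = A T * \<epsilon> / (2 * (real T - 1))" by (simp add: eps_hat_def)
    qed
    also have "\<dots> \<le> A T * \<epsilon> / 2"
      using False A_nonneg[of T] eps_pos by (cases "T = 1") (simp_all add: of_nat_diff divide_simps, simp add: algebra_simps)
    finally have sum: "(\<Sum>j=1..<T. A j * eps_hat j) \<le> A T * \<epsilon> / 2" .
    \<comment> \<open>Up to a constant, \<open>(norm y)^2 / 2 - z \<bullet> y\<close> is half the
      squared distance of \<open>y\<close> to \<open>z\<close>, so \<open>P z\<close> minimizes it
      over \<open>X\<close>; comparison with \<open>xs\<close> closes the gap.\<close>
    have "0 \<le> 2 * ((z - P z) \<bullet> (P z - xs)) + (P z - xs) \<bullet> (P z - xs)"
      using proj_variational[OF z xs(1)] inner_ge_zero[of "P z - xs"]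
      by (simp add: inner_diff_right)
    then have "(norm (P z))\<^sup>2 / 2 - z \<bullet> P z \<le> (norm xs)\<^sup>2 / 2 - z \<bullet> xs"
      by (simp add: power2_norm_eq_inner algebra_simps inner_commute)
    then have "A T * f x \<le> A T * f xs + A T * \<epsilon>"
      using s sum AT by linarith
    then show ?thesis
      using A_pos[of T] False by (simp add: flip: distrib_left)
  qed
  with run x show ?thesis by blast
qed

end

section \<open>Derivatives and gradients on a ball in a subspace\<close>

text \<open>The orthogonal set is not normalised and may contain 0; such an element contributes the
  zero vector to the sum whatever its coefficient.\<close>

lemma orthogonal_expansion:
  fixes B :: "'a::real_inner set"
  assumes "finite B"
  obtains C where "finite C" "C \<subseteq> span B"
    "\<And>w. w \<in> span B \<Longrightarrow> (\<Sum>e\<in>C. (w \<bullet> e / (e \<bullet> e)) *\<^sub>R e) = w"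
proof -
  obtain C where C: "finite C" "span C = span B" "pairwise orthogonal C"
    using basis_orthogonal[OF assms] by blast
  have "(\<Sum>e\<in>C. (w \<bullet> e / (e \<bullet> e)) *\<^sub>R e) = w" if "w \<in> span B" for w
  proof -
    have "w \<in> span C" using that C(2) by simp
    then obtain u where u: "w = (\<Sum>v\<in>C. u v *\<^sub>R v)"
      unfolding span_finite[OF C(1)] by (rule rangeE)
    have "w \<bullet> e = u e * (e \<bullet> e)" if "e \<in> C" for e
    proof -
      have "w \<bullet> e = (\<Sum>v\<in>C. if v = e then u e * (e \<bullet> e) else 0)"
        unfolding u inner_sum_left using C(3) that
        by (intro sum.cong) (auto simp: pairwise_def orthogonal_def)
      then show ?thesis using C(1) that by simp
    qed
    then have "(\<Sum>e\<in>C. (w \<bullet> e / (e \<bullet> e)) *\<^sub>R e) = (\<Sum>e\<in>C. u e *\<^sub>R e)"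
      by (intro sum.cong) auto
    then show ?thesis using u by simp
  qed
  moreover have "C \<subseteq> span B" using C(2) span_superset by blast
  ultimately show ?thesis using that C(1) by blast
qed

text \<open>The surrounding space may be infinite-dimensional and incomplete, so a functional is
  represented only on a finitely generated subspace.\<close>

lemma riesz_finite_span:
  fixes D :: "'a::real_inner \<Rightarrow> real"
  assumes "finite B" "linear D"
  obtains g where "g \<in> span B" "\<And>w. w \<in> span B \<Longrightarrow> D w = g \<bullet> w"
proof -
  obtain C where C: "finite C" "C \<subseteq> span B"
    "\<And>w. w \<in> span B \<Longrightarrow> (\<Sum>e\<in>C. (w \<bullet> e / (e \<bullet> e)) *\<^sub>R e) = w"
    using orthogonal_expansion[OF assms(1)] by metis
  define g where "g = (\<Sum>e\<in>C. (D e / (e \<bullet> e)) *\<^sub>R e)"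
  have "g \<in> span B"
    unfolding g_def using C by (auto intro!: span_sum span_scale)
  moreover have "D w = g \<bullet> w" if "w \<in> span B" for w
  proof -
    have "D w = D (\<Sum>e\<in>C. (w \<bullet> e / (e \<bullet> e)) *\<^sub>R e)" using C(3)[OF that] by simp
    also have "\<dots> = (\<Sum>e\<in>C. (w \<bullet> e / (e \<bullet> e)) * D e)"
      using assms(2) by (simp add: linear_sum linear_scale)
    also have "\<dots> = g \<bullet> w"
      unfolding g_def inner_sum_left by (intro sum.cong) (auto simp: inner_commute)
    finally show ?thesis .
  qed
  ultimately show ?thesis using that by blast
qed

text \<open>A derivative within \<open>S\<close> only sees displacements inside \<open>S\<close>.
  This allows replacing it by a functional that is tangential to a curved \<open>S\<close>, or that
  differs from it off the span of a flat \<open>S\<close>.\<close>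

lemma has_derivative_quadratic_change:
  fixes f :: "'a::real_normed_vector \<Rightarrow> real"
  assumes f: "(f has_derivative D) (at x within S)" and D': "bounded_linear D'"
    and le: "\<And>y. y \<in> S \<Longrightarrow> \<bar>D (y - x) - D' (y - x)\<bar> \<le> C * (norm (y - x))\<^sup>2"
  shows "(f has_derivative D') (at x within S)"
proof -
  have "((\<lambda>y. C * norm (y - x)) \<longlongrightarrow> C * norm (x - x)) (at x within S)"
    by (intro tendsto_intros)
  then have lim: "((\<lambda>y. C * norm (y - x)) \<longlongrightarrow> 0) (at x within S)" by simp
  have "((\<lambda>y. (1 / norm (y - x)) *\<^sub>R (D (y - x) - D' (y - x))) \<longlongrightarrow> 0) (at x within S)"
  proof (rule Lim_null_comparison[OF _ lim])
    show "\<forall>\<^sub>F y in at x within S. norm ((1 / norm (y - x)) *\<^sub>R (D (y - x) - D' (y - x))) \<le> C * norm (y - x)"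
      unfolding eventually_at_filter
      using le by (intro always_eventually) (auto simp: field_simps power2_eq_square)
  qed
  with f have "((\<lambda>y. (1 / norm (y - x)) *\<^sub>R (f y - (f x + D (y - x))) +
      (1 / norm (y - x)) *\<^sub>R (D (y - x) - D' (y - x))) \<longlongrightarrow> 0 + 0) (at x within S)"
    unfolding has_derivative_within by (intro tendsto_add) auto
  moreover have "(1 / norm (y - x)) *\<^sub>R (f y - (f x + D (y - x))) + (1 / norm (y - x)) *\<^sub>R (D (y - x) - D' (y - x)) =
      (1 / norm (y - x)) *\<^sub>R (f y - (f x + D' (y - x)))" for y
    unfolding scaleR_add_right[symmetric] by simp
  ultimately show ?thesis
    unfolding has_derivative_within using D' by simp
qed

section \<open>Gradients on a Euclidean ball\<close>

locale subspace_ball =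
  fixes V :: "'a::real_inner set" and \<rho> :: real and X :: "'a set"
  assumes subspace_V: "subspace V" and radius_pos: "0 < \<rho>"
    and X_eq: "X = {w \<in> V. norm w \<le> \<rho>}"
begin

lemma zero_mem: "0 \<in> X"
  using subspace_V radius_pos by (simp add: X_eq subspace_0)

lemma convex: "convex X"
proof -
  have "X = V \<inter> cball 0 \<rho>" by (auto simp: X_eq)
  then show ?thesis using subspace_V by (simp add: convex_Int subspace_imp_convex)
qed

lemma diam_le: "x \<in> X \<Longrightarrow> y \<in> X \<Longrightarrow> norm (x - y) \<le> 2 * \<rho>"
  using norm_triangle_ineq4[of x y] by (simp add: X_eq)

lemma nearest_point:
  assumes "z \<in> V"
  shows "\<exists>p\<in>X. \<forall>y\<in>X. dist z p \<le> dist z y"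
proof (cases "norm z \<le> \<rho>")
  case True
  then show ?thesis using assms by (intro bexI[of _ z]) (auto simp: X_eq)
next
  case False
  then have "z \<noteq> 0" using radius_pos by auto
  define p where "p = (\<rho> / norm z) *\<^sub>R z"
  have "p \<in> X"
    using False assms radius_pos subspace_V by (simp add: X_eq p_def subspace_scale)
  moreover have "dist z p \<le> dist z y" if "y \<in> X" for y
  proof -
    have "z - p = (1 - \<rho> / norm z) *\<^sub>R z" by (simp add: p_def algebra_simps)
    then have "dist z p = \<bar>1 - \<rho> / norm z\<bar> * norm z" by (simp add: dist_norm)
    also have "\<dots> = norm z - \<rho>" using False radius_pos \<open>z \<noteq> 0\<close> by (simp add: field_simps abs_if)
    also have "\<dots> \<le> norm z - norm y" using that by (simp add: X_eq)
    also have "\<dots> \<le> dist z y" unfolding dist_norm by (rule norm_triangle_ineq2)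
    finally show ?thesis .
  qed
  ultimately show ?thesis by blast
qed

text \<open>Testing with the two points of norm \<rho> in the directions of \<open>g\<close> and
  \<open>- g\<close> and subtracting cancels \<open>x\<close>, which may therefore lie anywhere in
  \<open>V\<close>. A \<beta> proportional to \<rho> yields a bound free of \<rho>.\<close>

lemma norm_le_of_inner_bound:
  assumes g: "g \<in> V" and x: "x \<in> V" and le: "\<And>y. y \<in> X \<Longrightarrow> \<bar>g \<bullet> (y - x)\<bar> \<le> \<beta>"
  shows "\<rho> * norm g \<le> \<beta>"
proof (cases "g = 0")
  case True
  then show ?thesis using le[OF zero_mem] by simp
next
  case False
  define u where "u = (\<rho> / norm g) *\<^sub>R g"
  have "u \<in> X" "- u \<in> X"
    using False g radius_pos subspace_V by (simp_all add: X_eq u_def subspace_scale subspace_neg)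
  from le[OF this(1)] le[OF this(2)] have "\<bar>g \<bullet> (u - x) - g \<bullet> (- u - x)\<bar> \<le> 2 * \<beta>" by linarith
  moreover have "g \<bullet> (u - x) - g \<bullet> (- u - x) = 2 * (g \<bullet> u)" by (simp add: algebra_simps)
  moreover have "g \<bullet> u = \<rho> * norm g"
    using False by (simp add: u_def dot_square_norm power2_eq_square)
  ultimately show ?thesis by linarith
qed

text \<open>At a boundary point only one-sided derivatives along segments into \<open>X\<close> are
  at hand. They determine \<open>g \<bullet> (y - x)\<close> for all \<open>y\<close> in
  \<open>X\<close>, and these numbers determine a vector of \<open>V\<close> by
  \<open>norm_le_of_inner_bound\<close>.\<close>

lemma grad_on_eqI:
  assumes x: "x \<in> X" and g: "g \<in> V" and f: "(f has_derivative (\<lambda>w. g \<bullet> w)) (at x within X)"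
  shows "grad_on V X f x = g"
  unfolding grad_on_def
proof (rule the_equality)
  fix g' assume g': "g' \<in> V \<and> (f has_derivative (\<lambda>w. g' \<bullet> w)) (at x within X)"
  have "(g' - g) \<bullet> (y - x) = 0" if y: "y \<in> X" for y
  proof -
    define c where "c t = x + t *\<^sub>R (y - x)" for t
    have cX: "c ` {0..1} \<subseteq> X"
    proof clarify
      fix t :: real assume "t \<in> {0..1}"
      then have "(1 - t) *\<^sub>R x + t *\<^sub>R y \<in> X" using convexD_alt[OF convex x y] by auto
      then show "c t \<in> X" by (simp add: c_def algebra_simps)
    qed
    have c: "(c has_derivative (\<lambda>t. t *\<^sub>R (y - x))) (at 0 within {0..1})"
      unfolding c_def by (auto intro!: derivative_eq_intros)
    have "((\<lambda>t. f (c t)) has_vector_derivative h \<bullet> (y - x)) (at 0 within {0..1})"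
      if "(f has_derivative (\<lambda>w. h \<bullet> w)) (at x within X)" for h
    proof -
      have "(f has_derivative (\<lambda>w. h \<bullet> w)) (at (c 0) within c ` {0..1})"
        using that has_derivative_subset[OF _ cX] by (simp add: c_def)
      from has_derivative_in_compose[OF c this] show ?thesis
        by (simp add: has_vector_derivative_def mult.commute)
    qed
    from this[OF f] this[OF conjunct2[OF g']] have "h \<bullet> (y - x) = g' \<bullet> (y - x)" if "h = g" for h
      using vector_derivative_unique_within_closed_interval[of 0 1 0] that by auto
    then show ?thesis by (simp add: inner_diff_left)
  qed
  then have "\<rho> * norm (g' - g) \<le> 0"
    using g g' x subspace_V by (intro norm_le_of_inner_bound[of _ x]) (auto simp: X_eq subspace_diff)
  then show "g' = g" using radius_pos by (simp add: mult_le_0_iff)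
qed (use g f in simp)

text \<open>Step from \<open>y\<close> by \<open>d\<close> in the direction of
  \<open>g y - g x\<close>. Comparing the linearisations between the three points isolates
  \<open>d * norm (g y - g x)\<close>, with errors for distances at most \<open>3 * d\<close>,
  \<open>d\<close> and \<open>2 * d\<close>, hence 14 = 9 + 1 + 4.\<close>

lemma gradient_diff_near:
  assumes g: "\<And>x. x \<in> X \<Longrightarrow> g x \<in> V"
    and quad: "\<And>x y. x \<in> X \<Longrightarrow> y \<in> X \<Longrightarrow> \<bar>f y - f x - g x \<bullet> (y - x)\<bar> \<le> \<Lambda> * (norm (y - x))\<^sup>2"
    and x: "x \<in> X" and y: "y \<in> X" and ball: "\<And>z. z \<in> V \<Longrightarrow> norm (z - y) \<le> d \<Longrightarrow> z \<in> X"
    and d: "0 < d" "norm (y - x) \<le> 2 * d" and \<Lambda>: "0 \<le> \<Lambda>"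
  shows "norm (g y - g x) \<le> 14 * \<Lambda> * d"
proof (cases "g y = g x")
  case True
  then show ?thesis using \<Lambda> d by simp
next
  case False
  define v where "v = g y - g x"
  define z where "z = y + (d / norm v) *\<^sub>R v"
  have v: "v \<noteq> 0" "v \<in> V" using False g x y subspace_V by (auto simp: v_def subspace_diff)
  have zy: "norm (z - y) = d" using v d by (simp add: z_def)
  have "z \<in> V"
    using v y subspace_V by (auto simp: z_def X_eq intro!: subspace_add subspace_scale)
  with ball zy have z: "z \<in> X" by simp
  have zx: "norm (z - x) \<le> 3 * d"
    using norm_triangle_ineq[of "z - y" "y - x"] zy d by simp
  have sq: "(norm (z - y))\<^sup>2 \<le> d\<^sup>2" "(norm (z - x))\<^sup>2 \<le> (3 * d)\<^sup>2" "(norm (y - x))\<^sup>2 \<le> (2 * d)\<^sup>2"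
    using zy zx d by (simp_all only: power_mono norm_ge_zero order_refl)
  have "v \<bullet> (z - y) = d * norm v"
    using v by (simp add: z_def dot_square_norm power2_eq_square)
  moreover have "v \<bullet> (z - y) = (f z - f x - g x \<bullet> (z - x)) - (f z - f y - g y \<bullet> (z - y)) - (f y - f x - g x \<bullet> (y - x))"
    by (simp add: v_def algebra_simps)
  ultimately have "d * norm v \<le> \<Lambda> * (norm (z - x))\<^sup>2 + \<Lambda> * (norm (z - y))\<^sup>2 + \<Lambda> * (norm (y - x))\<^sup>2"
    using quad[OF x z] quad[OF y z] quad[OF x y] by linarith
  also have "\<dots> \<le> \<Lambda> * (3 * d)\<^sup>2 + \<Lambda> * d\<^sup>2 + \<Lambda> * (2 * d)\<^sup>2"
    using sq \<Lambda> by (intro add_mono mult_left_mono) auto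
  also have "\<dots> = d * (14 * \<Lambda> * d)" by (simp add: power2_eq_square)
  finally show ?thesis using d by (simp add: v_def)
qed

text \<open>
  Moving \<open>y\<close> towards the centre by \<open>d = norm (x - y)\<close> gives a point \<open>y'\<close> around which the ball of
  radius \<open>d\<close> lies in \<open>X\<close>; so no continuity of the gradient at the boundary is needed.
\<close>

lemma gradient_lipschitz:
  assumes g: "\<And>x. x \<in> X \<Longrightarrow> g x \<in> V"
    and quad: "\<And>x y. x \<in> X \<Longrightarrow> y \<in> X \<Longrightarrow> \<bar>f y - f x - g x \<bullet> (y - x)\<bar> \<le> \<Lambda> * (norm (y - x))\<^sup>2"
    and \<Lambda>: "0 \<le> \<Lambda>"
  shows "(56 * \<Lambda>)-lipschitz_on X g"
proof -
  have near: "norm (g x - g y) \<le> 28 * \<Lambda> * norm (x - y)"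
    if x: "x \<in> X" and y: "y \<in> X" and le: "norm (x - y) \<le> \<rho>" for x y
  proof (cases "x = y")
    case False
    define d where "d = norm (x - y)"
    define y' where "y' = (1 - d / \<rho>) *\<^sub>R y"
    have d: "0 < d" "d \<le> \<rho>" using False le by (auto simp: d_def)
    have frac: "0 \<le> 1 - d / \<rho>" "0 \<le> d / \<rho>" using d radius_pos by (auto simp: field_simps)
    have ny: "norm y \<le> \<rho>" and yV: "y \<in> V" using y by (auto simp: X_eq)
    have "norm y' \<le> (1 - d / \<rho>) * \<rho>"
      using frac ny by (simp add: y'_def mult_left_mono)
    then have y'd: "norm y' \<le> \<rho> - d" using radius_pos by (simp add: algebra_simps)
    then have y': "y' \<in> X" using d yV subspace_V by (simp add: X_eq y'_def subspace_scale)
    have ball: "z \<in> X" if "z \<in> V" "norm (z - y') \<le> d" for z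
      using that y'd norm_triangle_ineq[of "z - y'" y'] by (simp add: X_eq)
    have "y' - y = - ((d / \<rho>) *\<^sub>R y)" by (simp add: y'_def algebra_simps)
    then have "norm (y' - y) = d / \<rho> * norm y"
      using abs_of_nonneg[OF frac(2)] by (simp only: norm_minus_cancel norm_scaleR)
    also have "\<dots> \<le> d / \<rho> * \<rho>" using ny frac by (intro mult_left_mono)
    finally have y'y: "norm (y' - y) \<le> d" using radius_pos by simp
    have y'x: "norm (y' - x) \<le> 2 * d"
      using norm_triangle_ineq[of "y' - y" "y - x"] y'y by (simp add: d_def norm_minus_commute)
    have "norm (g y' - g x) \<le> 14 * \<Lambda> * d"
      using gradient_diff_near[OF g quad x y' ball d(1) y'x \<Lambda>] by blast
    moreover have "norm (g y' - g y) \<le> 14 * \<Lambda> * d"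
      using gradient_diff_near[OF g quad y y' ball d(1) _ \<Lambda>] y'y d by auto
    ultimately show ?thesis
      using norm_triangle_ineq4[of "g y' - g y" "g y' - g x"] by (simp add: d_def)
  qed simp
  show ?thesis
  proof (rule lipschitz_onI)
    fix x y assume x: "x \<in> X" and y: "y \<in> X"
    show "dist (g x) (g y) \<le> 56 * \<Lambda> * dist x y"
    proof (cases "norm (x - y) \<le> \<rho>")
      case True
      from near[OF x y this] show ?thesis
        using \<Lambda> mult_nonneg_nonneg[OF \<Lambda> norm_ge_zero[of "x - y"]] unfolding dist_norm by linarith
    next
      \<comment> \<open>Distant points are joined through the centre; each leg is at most \<rho> and
        so shorter than \<open>norm (x - y)\<close>, which doubles the constant 28.\<close>
      case False
      have n: "norm (x - 0) \<le> \<rho>" "norm (0 - y) \<le> \<rho>" using x y by (auto simp: X_eq)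
      have "norm (g x - g y) \<le> norm (g x - g 0) + norm (g 0 - g y)"
        using norm_triangle_ineq[of "g x - g 0" "g 0 - g y"] by simp
      also have "\<dots> \<le> 28 * \<Lambda> * norm (x - 0) + 28 * \<Lambda> * norm (0 - y)"
        using near[OF x zero_mem n(1)] near[OF zero_mem y n(2)] by linarith
      also have "\<dots> \<le> 28 * \<Lambda> * norm (x - y) + 28 * \<Lambda> * norm (x - y)"
        using \<Lambda> n False by (intro add_mono mult_left_mono) auto
      finally show ?thesis by (simp add: dist_norm)
    qed
  qed (use \<Lambda> in simp)
qed

end

section \<open>Model spaces\<close>

lemma mult_cos_le_sin:
  fixes s :: real
  assumes "0 \<le> s" "s \<le> pi"
  shows "s * cos s \<le> sin s"
proof -
  have "sin 0 - 0 * cos 0 \<le> sin s - s * cos s"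
  proof (rule DERIV_nonneg_imp_nondecreasing[OF assms(1)])
    fix t assume "0 \<le> t" "t \<le> s"
    then have "0 \<le> t * sin t" using assms by (intro mult_nonneg_nonneg sin_ge_zero) auto
    moreover have "((\<lambda>s. sin s - s * cos s) has_real_derivative t * sin t) (at t)"
      by (auto intro!: derivative_eq_intros)
    ultimately show "\<exists>y. ((\<lambda>s. sin s - s * cos s) has_real_derivative y) (at t) \<and> 0 \<le> y" by blast
  qed
  then show ?thesis by simp
qed

lemma sinh_le_mult_cosh:
  fixes s :: real
  assumes "0 \<le> s"
  shows "sinh s \<le> s * cosh s"
proof -
  have "0 * cosh 0 - sinh 0 \<le> s * cosh s - sinh s"
  proof (rule DERIV_nonneg_imp_nondecreasing[OF assms])
    fix t assume "0 \<le> t" "t \<le> s"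
    then have "0 \<le> t * sinh t" by simp
    moreover have "((\<lambda>s. s * cosh s - sinh s) has_real_derivative t * sinh t) (at t)"
      by (auto intro!: derivative_eq_intros)
    ultimately show "\<exists>y. ((\<lambda>s. s * cosh s - sinh s) has_real_derivative y) (at t) \<and> 0 \<le> y" by blast
  qed
  then show ?thesis by simp
qed

lemma le_sinh:
  fixes s :: real
  assumes "0 \<le> s"
  shows "s \<le> sinh s"
proof -
  have "sinh 0 - 0 \<le> sinh s - s"
  proof (rule DERIV_nonneg_imp_nondecreasing[OF assms])
    fix t :: real
    have "((\<lambda>s. sinh s - s) has_real_derivative cosh t - 1) (at t)"
      by (auto intro!: derivative_eq_intros)
    moreover have "0 \<le> cosh t - 1" using cosh_real_ge_1[of t] by simp
    ultimately show "\<exists>y. ((\<lambda>s. sinh s - s) has_real_derivative y) (at t) \<and> 0 \<le> y" by blast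
  qed
  then show ?thesis by simp
qed

lemma one_minus_cos_le:
  fixes r :: real
  assumes "0 \<le> r"
  shows "1 - r \<le> cos r"
proof -
  have "cos r = 1 - 2 * (sin (r / 2))\<^sup>2" using cos_double_sin[of "r / 2"] by simp
  moreover have "(sin (r / 2))\<^sup>2 \<le> \<bar>sin (r / 2)\<bar>"
    using power_decreasing[of 1 2 "\<bar>sin (r / 2)\<bar>"] by simp
  moreover have "\<bar>sin (r / 2)\<bar> \<le> r / 2" using abs_sin_x_le_abs_x[of "r / 2"] assms by simp
  ultimately show ?thesis by simp
qed

section \<open>The ambient bilinear form\<close>

lemma form_add [simp]:
  "form K (x + y) z = form K x z + form K y z" "form K x (y + z) = form K x y + form K x z"
  and form_diff [simp]:
  "form K (x - y) z = form K x z - form K y z" "form K x (y - z) = form K x y - form K x z"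
  and form_scaleR [simp]:
  "form K (c *\<^sub>R x) z = c * form K x z" "form K x (c *\<^sub>R z) = c * form K x z"
  and form_minus [simp]: "form K (- x) z = - form K x z" "form K x (- z) = - form K x z"
  and form_zero [simp]: "form K 0 z = 0" "form K x 0 = 0"
  by (simp_all add: form_def algebra_simps)

lemma form_commute: "form K x y = form K y x"
  by (simp add: form_def inner_commute)

lemma bounded_linear_form: "bounded_linear (form K G)"
proof -
  have "form K G = (\<lambda>w. (K * fst G) * fst w + snd G \<bullet> snd w)"
    by (auto simp: form_def)
  moreover have "bounded_linear (\<lambda>w::real \<times> 'a. (K * fst G) * fst w + snd G \<bullet> snd w)"
    by (intro bounded_linear_add bounded_linear_const_mult bounded_linear_fst
        bounded_linear_inner_right_comp bounded_linear_snd)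
  ultimately show ?thesis by simp
qed

lemma abs_form_le:
  assumes "\<bar>K\<bar> = 1"
  shows "\<bar>form K w w\<bar> \<le> (norm w)\<^sup>2"
proof -
  have "(norm w)\<^sup>2 = (fst w)\<^sup>2 + (norm (snd w))\<^sup>2"
    by (cases w) (simp add: norm_Pair)
  moreover have "form K w w = K * (fst w)\<^sup>2 + (norm (snd w))\<^sup>2"
    by (simp add: form_def power2_norm_eq_inner power2_eq_square[of "fst w"])
  moreover have "\<bar>K * (fst w)\<^sup>2\<bar> = (fst w)\<^sup>2" using assms by (simp add: abs_mult)
  moreover have "0 \<le> (norm (snd w))\<^sup>2" by simp
  ultimately show ?thesis by linarith
qed

section \<open>Distance, exponential map and logarithm\<close>

locale model_space =
  fixes K :: real and V :: "'a::real_inner set"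
  assumes K_cases: "K = 1 \<or> K = - 1" and subspace_V: "subspace V"
begin

lemma K_mult_K [simp]: "K * K = 1" "K * (K * c) = c" and abs_K: "\<bar>K\<bar> = 1"
  using K_cases by auto

lemma subspace_tangent: "subspace (tangent K V x)"
  using subspace_V
  by (auto simp: subspace_def tangent_def)

lemma form_self_model: "x \<in> model K V \<Longrightarrow> form K x x = K"
  by (simp add: model_def)

text \<open>Cauchy-Schwarz for the \<open>V\<close>-components, combined with tangency. It shows
  that tangent vectors of the hyperboloid are spacelike, that is, that the indefinite form is an
  inner product on each tangent space.\<close>

lemma tangent_fst_bound:
  assumes "K = - 1" "x \<in> model K V" "v \<in> tangent K V x"
  shows "(fst v)\<^sup>2 \<le> ((fst x)\<^sup>2 - 1) * form K v v"
proof -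
  let ?p = "snd x" and ?q = "snd v"
  have eqs: "fst x * fst v = ?p \<bullet> ?q" "?p \<bullet> ?p = (fst x)\<^sup>2 - 1" "form K v v = ?q \<bullet> ?q - (fst v)\<^sup>2"
    using assms by (auto simp: model_def tangent_def form_def power2_eq_square)
  have "(?p \<bullet> ?q)\<^sup>2 \<le> (?p \<bullet> ?p) * (?q \<bullet> ?q)" by (rule Cauchy_Schwarz_ineq)
  then have "(fst x * fst v)\<^sup>2 \<le> ((fst x)\<^sup>2 - 1) * (form K v v + (fst v)\<^sup>2)"
    using eqs by simp
  then show ?thesis by (simp add: power_mult_distrib algebra_simps)
qed

lemma form_tangent_nonneg:
  assumes "x \<in> model K V" "v \<in> tangent K V x"
  shows "0 \<le> form K v v"
proof (cases "K = 1")
  case False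
  then have K: "K = - 1" using K_cases by simp
  show ?thesis
  proof (rule ccontr)
    assume neg: "\<not> ?thesis"
    have "snd x \<bullet> snd x = (fst x)\<^sup>2 - 1"
      using assms K by (simp add: model_def form_def power2_eq_square)
    then have "0 \<le> (fst x)\<^sup>2 - 1" using inner_ge_zero[of "snd x"] by linarith
    then have "((fst x)\<^sup>2 - 1) * form K v v \<le> 0"
      using neg by (simp add: mult_nonneg_nonpos)
    with tangent_fst_bound[OF K assms] have "(fst v)\<^sup>2 \<le> 0" by linarith
    then have "form K v v = snd v \<bullet> snd v" by (simp add: form_def)
    with neg show False by simp
  qed
qed (simp add: form_def)

lemma form_tangent_eq_0:
  assumes "x \<in> model K V" "v \<in> tangent K V x" "form K v v = 0"
  shows "v = 0"
proof (cases "K = 1")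
  case True
  then have "fst v * fst v + snd v \<bullet> snd v = 0" using assms by (simp add: form_def)
  then have "fst v * fst v = 0 \<and> snd v \<bullet> snd v = 0"
    by (subst (asm) add_nonneg_eq_0_iff) auto
  then show ?thesis by (simp add: prod_eq_iff)
next
  case False
  then have "K = - 1" using K_cases by simp
  from tangent_fst_bound[OF this assms(1,2)] assms(3) have "fst v = 0" by simp
  with assms(3) have "snd v = 0" by (simp add: form_def)
  with \<open>fst v = 0\<close> show ?thesis by (simp add: prod_eq_iff)
qed

lemma rnorm_power2: "x \<in> model K V \<Longrightarrow> v \<in> tangent K V x \<Longrightarrow> (rnorm K v)\<^sup>2 = form K v v"
  by (simp add: rnorm_def form_tangent_nonneg)

lemma rnorm_nonneg: "x \<in> model K V \<Longrightarrow> v \<in> tangent K V x \<Longrightarrow> 0 \<le> rnorm K v"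
  by (simp add: rnorm_def form_tangent_nonneg)

lemma model_fst_sq:
  assumes "K = - 1" "x \<in> model K V"
  shows "1 \<le> fst x" "(norm (snd x))\<^sup>2 = (fst x)\<^sup>2 - 1"
proof -
  show eq: "(norm (snd x))\<^sup>2 = (fst x)\<^sup>2 - 1"
    using assms by (simp add: model_def form_def power2_norm_eq_inner power2_eq_square[of "fst x"])
  have "0 \<le> (norm (snd x))\<^sup>2" by simp
  then have "1\<^sup>2 \<le> (fst x)\<^sup>2" using eq by simp
  moreover have "0 < fst x" using assms by (simp add: model_def)
  ultimately show "1 \<le> fst x" using power2_le_imp_le[of 1 "fst x"] by simp
qed

text \<open>These bounds put the arguments of \<open>arccos\<close> and \<open>arcosh\<close> into
  their domains. The second is the reversed Cauchy-Schwarz inequality; with \<open>a\<close> and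
  \<open>b\<close> the first coordinates it reduces to \<open>(a - b)^2 \<ge> 0\<close>.\<close>

lemma model_form_bounds:
  assumes x: "x \<in> model K V" and y: "y \<in> model K V"
  shows "K = 1 \<Longrightarrow> \<bar>form K x y\<bar> \<le> 1" "K = - 1 \<Longrightarrow> form K x y \<le> - 1"
proof -
  assume K: "K = 1"
  have form: "form K a b = a \<bullet> b" for a b :: "real \<times> 'a"
    using K by (simp add: form_def inner_prod_def)
  have "x \<bullet> x = 1" "y \<bullet> y = 1"
    using form_self_model[OF x] form_self_model[OF y] unfolding form by (simp_all add: K)
  then have "norm x = 1" "norm y = 1" by (simp_all add: norm_eq_sqrt_inner)
  then show "\<bar>form K x y\<bar> \<le> 1" unfolding form using Cauchy_Schwarz_ineq2[of x y] by simp
next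
  assume K: "K = - 1"
  let ?a = "fst x" and ?b = "fst y"
  note ax = model_fst_sq[OF K x] and bys = model_fst_sq[OF K y]
  have ab: "1 \<le> ?a * ?b" using mult_mono[of 1 ?a 1 ?b] ax bys by simp
  have "(norm (snd x) * norm (snd y))\<^sup>2 = (?a\<^sup>2 - 1) * (?b\<^sup>2 - 1)"
    using ax bys by (simp add: power_mult_distrib)
  also have "\<dots> \<le> (?a * ?b - 1)\<^sup>2"
    using zero_le_power2[of "?a - ?b"] by (simp add: power2_eq_square algebra_simps)
  finally have "norm (snd x) * norm (snd y) \<le> ?a * ?b - 1"
    by (rule power2_le_imp_le) (use ab in simp)
  moreover have "snd x \<bullet> snd y \<le> norm (snd x) * norm (snd y)" by (rule norm_cauchy_schwarz)
  ultimately show "form K x y \<le> - 1" using K by (simp add: form_def)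
qed

lemma cosK_0 [simp]: "cosK K 0 = 1" and sinK_0 [simp]: "sinK K 0 = 0"
  by (simp_all add: cosK_def sinK_def)

lemma sinK_power2: "(sinK K r)\<^sup>2 = K * (1 - (cosK K r)\<^sup>2)"
  using K_cases sin_squared_eq[of r] cosh_square_eq[of r]
  by (auto simp: sinK_def cosK_def)

lemma sinK_pos: "0 < r \<Longrightarrow> (K = 1 \<Longrightarrow> r < pi) \<Longrightarrow> 0 < sinK K r"
  using K_cases sin_gt_zero by (auto simp: sinK_def)

lemma cosK_rdist:
  assumes "x \<in> model K V" "y \<in> model K V"
  shows "cosK K (rdist K x y) = K * form K x y"
  using K_cases model_form_bounds[OF assms]
  by (auto simp: cosK_def rdist_def cos_arccos_abs)

lemma rdist_nonneg:
  assumes "x \<in> model K V" "y \<in> model K V"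
  shows "0 \<le> rdist K x y"
  using K_cases model_form_bounds[OF assms]
  by (auto simp: rdist_def abs_le_iff intro!: arccos_lbound)

lemma rdist_less_pi:
  assumes "x \<in> model K V" "y \<in> model K V" "K = 1" "form K x y \<noteq> - 1"
  shows "rdist K x y < pi"
proof -
  have "rdist K x y \<le> pi"
    using model_form_bounds[OF assms(1,2)] assms(3) by (auto simp: rdist_def abs_le_iff intro!: arccos_ubound)
  moreover have "rdist K x y \<noteq> pi"
    using cosK_rdist[OF assms(1,2)] assms(3,4) by (auto simp: cosK_def)
  ultimately show ?thesis by simp
qed

lemma rdist_commute: "rdist K x y = rdist K y x"
  by (simp add: rdist_def form_commute)

lemma rdist_eqI:
  assumes "K * form K x y = cosK K r" "0 \<le> r" "K = 1 \<Longrightarrow> r \<le> pi"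
  shows "rdist K x y = r"
  using K_cases assms by (auto simp: rdist_def cosK_def arccos_cos arcosh_cosh_real)

lemma rnorm_scaleR: "rnorm K (c *\<^sub>R v) = \<bar>c\<bar> * rnorm K v"
proof -
  have "form K (c *\<^sub>R v) (c *\<^sub>R v) = c\<^sup>2 * form K v v" by (simp add: power2_eq_square)
  then show ?thesis by (simp only: rnorm_def real_sqrt_mult real_sqrt_abs)
qed

lemma rexp_zero [simp]: "rexp K x 0 = x"
  by (simp add: rexp_def rnorm_def)

lemma form_rexp:
  assumes "x \<in> model K V" "v \<in> tangent K V x"
  shows "K * form K x (rexp K x v) = cosK K (rnorm K v)"
  using assms by (simp add: rexp_def form_self_model tangent_def algebra_simps)

lemma rdist_rexp:
  assumes "x \<in> model K V" "v \<in> tangent K V x" "K = 1 \<Longrightarrow> rnorm K v \<le> pi"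
  shows "rdist K x (rexp K x v) = rnorm K v"
  using assms form_rexp rnorm_nonneg by (intro rdist_eqI) auto

text \<open>Both preimages have the distance to the common image as norm, so their components along
  \<open>x\<close> agree, and the positive factor \<open>sinK K r\<close> can be cancelled in the
  rest.\<close>

lemma inj_on_rexp:
  assumes x: "x \<in> model K V"
  shows "inj_on (rexp K x) (inj_dom K V x)"
proof (rule inj_onI)
  fix v w assume v: "v \<in> inj_dom K V x" and w: "w \<in> inj_dom K V x" and eq: "rexp K x v = rexp K x w"
  define r where "r = rnorm K v"
  have vt: "v \<in> tangent K V x" "w \<in> tangent K V x" using v w by (auto simp: inj_dom_def)
  have "rdist K x (rexp K x v) = rnorm K v" "rdist K x (rexp K x w) = rnorm K w"
    using v w x by (auto intro!: rdist_rexp simp: inj_dom_def)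
  then have r: "rnorm K w = r" using eq by (simp add: r_def)
  show "v = w"
  proof (cases "r = 0")
    case True
    then have "form K v v = 0" "form K w w = 0"
      using rnorm_power2[OF x vt(1)] rnorm_power2[OF x vt(2)] r r_def by simp_all
    then show ?thesis using form_tangent_eq_0[OF x vt(1)] form_tangent_eq_0[OF x vt(2)] by simp
  next
    case False
    then have "0 < r" using rnorm_nonneg[OF x vt(1)] by (simp add: r_def)
    then have "0 < sinK K r" using v by (intro sinK_pos) (auto simp: inj_dom_def r_def)
    then show ?thesis using eq r False by (simp add: rexp_def r_def[symmetric])
  qed
qed

lemma rlog_eqI:
  assumes "x \<in> model K V" "v \<in> inj_dom K V x"
  shows "rlog K V x (rexp K x v) = v"
  unfolding rlog_def using assms inj_on_rexp by (simp add: inv_into_f_f)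

text \<open>The component of \<open>y\<close> tangential at \<open>x\<close> has length
  \<open>sinK K r\<close>; rescaling it to length \<open>r\<close> gives the logarithm. For
  \<open>r = 0\<close> the quotient is \<open>0 / 0 = 0\<close>, and \<open>y = x\<close> since the
  tangential component has zero form.\<close>

lemma rexp_log:
  assumes x: "x \<in> model K V" and y: "y \<in> model K V" and anti: "K = 1 \<Longrightarrow> form K x y \<noteq> - 1"
  defines "r \<equiv> rdist K x y"
  defines "v \<equiv> (r / sinK K r) *\<^sub>R (y - (K * form K x y) *\<^sub>R x)"
  shows "v \<in> inj_dom K V x" "rnorm K v = r" "rexp K x v = y"
proof -
  let ?c = "K * form K x y"
  let ?u = "y - ?c *\<^sub>R x"
  have c: "cosK K r = ?c" unfolding r_def by (rule cosK_rdist[OF x y])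
  have u: "?u \<in> tangent K V x"
    using x y subspace_V
    by (auto simp: tangent_def model_def algebra_simps intro!: subspace_diff subspace_scale)
  have "form K ?u ?u = K - K * ?c\<^sup>2"
    using form_self_model[OF x] form_self_model[OF y]
    by (simp add: form_commute[of K y x] power2_eq_square algebra_simps)
  then have uu: "form K ?u ?u = (sinK K r)\<^sup>2" unfolding sinK_power2 c by (simp add: algebra_simps)
  have r0: "0 \<le> r" unfolding r_def by (rule rdist_nonneg[OF x y])
  have rpi: "K = 1 \<Longrightarrow> r < pi" unfolding r_def using anti rdist_less_pi[OF x y] by simp
  show nv: "rnorm K v = r"
  proof (cases "r = 0")
    case False
    then have "0 < sinK K r" using r0 rpi by (intro sinK_pos) auto
    then show ?thesis using uu r0 by (simp only: v_def rnorm_scaleR) (simp add: rnorm_def)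
  qed (simp add: v_def rnorm_def)
  have "v \<in> tangent K V x" unfolding v_def using u subspace_tangent by (rule subspace_scale[rotated])
  then show "v \<in> inj_dom K V x" using nv rpi by (auto simp: inj_dom_def)
  show "rexp K x v = y"
  proof (cases "r = 0")
    case True
    with c uu have "?c = 1" "form K ?u ?u = 0" by simp_all
    then have "y - x = 0" using form_tangent_eq_0[OF x u] by simp
    then show ?thesis using True by (simp add: v_def)
  next
    case False
    then have "0 < sinK K r" using r0 rpi by (intro sinK_pos) auto
    then show ?thesis using False nv c by (simp add: rexp_def) (simp add: v_def)
  qed
qed

lemma exp_ball_eq:
  assumes x: "x \<in> model K V" and sub: "exp_ball K V x R \<subseteq> model K V" and R: "K = 1 \<Longrightarrow> R < pi"
  shows "exp_ball K V x R = {y \<in> model K V. rdist K x y \<le> R}"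
proof (intro equalityI subsetI)
  fix y assume y: "y \<in> exp_ball K V x R"
  then obtain v where v: "v \<in> tangent K V x" "rnorm K v \<le> R" "y = rexp K x v"
    by (auto simp: exp_ball_def)
  moreover have "rdist K x y = rnorm K v"
    unfolding v(3) using v R by (intro rdist_rexp x) auto
  ultimately show "y \<in> {y \<in> model K V. rdist K x y \<le> R}" using sub y by auto
next
  fix y assume y: "y \<in> {y \<in> model K V. rdist K x y \<le> R}"
  have "form K x y \<noteq> - 1" if "K = 1"
  proof
    assume "form K x y = - 1"
    then have "rdist K x y = pi" using that by (simp add: rdist_def)
    then show False using y R that by simp
  qed
  note log = rexp_log[OF x _ this]
  let ?v = "(rdist K x y / sinK K (rdist K x y)) *\<^sub>R (y - (K * form K x y) *\<^sub>R x)"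
  have "?v \<in> {v \<in> tangent K V x. rnorm K v \<le> R}" "rexp K x ?v = y"
    using log y by (auto simp: inj_dom_def)
  then show "y \<in> exp_ball K V x R" unfolding exp_ball_def by (rule rev_image_eqI[OF _ sym])
qed

section \<open>Riemannian gradients\<close>

text \<open>Central projection of the affine tangent hyperplane onto the model. On the hyperboloid,
  \<open>form K v v < 1\<close> together with \<open>tangent_fst_bound\<close> keeps
  \<open>x + v\<close> in the forward cone.\<close>

lemma normalize_mem:
  assumes x: "x \<in> model K V" and v: "v \<in> tangent K V x" and pos: "0 < 1 + K * form K v v"
  shows "(1 / sqrt (1 + K * form K v v)) *\<^sub>R (x + v) \<in> model K V"
proof -
  let ?n = "sqrt (1 + K * form K v v)"
  have n: "0 < ?n" "?n * ?n = 1 + K * form K v v" using pos by simp_all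
  have "form K (x + v) (x + v) = K + form K v v"
    using x v by (simp add: form_self_model tangent_def form_commute[of K v x])
  also have "\<dots> = K * (?n * ?n)" unfolding n by (simp add: algebra_simps)
  finally have "form K ((1 / ?n) *\<^sub>R (x + v)) ((1 / ?n) *\<^sub>R (x + v)) = K"
    using n(1) by (simp only: form_scaleR) simp
  moreover have "snd ((1 / ?n) *\<^sub>R (x + v)) \<in> V"
    using x v subspace_V by (simp add: model_def tangent_def subspace_scale subspace_add)
  moreover have "0 < fst ((1 / ?n) *\<^sub>R (x + v))" if K: "K = - 1"
  proof -
    have x1: "1 \<le> fst x" by (rule model_fst_sq[OF K x])
    have "(fst v)\<^sup>2 \<le> ((fst x)\<^sup>2 - 1) * form K v v" by (rule tangent_fst_bound[OF K x v])
    also have "\<dots> \<le> ((fst x)\<^sup>2 - 1) * 1"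
      using pos K x1 by (intro mult_left_mono) auto
    finally have "\<bar>fst v\<bar>\<^sup>2 < (fst x)\<^sup>2" by simp
    then have "\<bar>fst v\<bar> < fst x" by (rule power2_less_imp_less) (use x1 in simp)
    then show ?thesis using n by simp
  qed
  ultimately show ?thesis by (simp add: model_def)
qed

text \<open>The central projection of a tangent line, hence a reparametrised geodesic. Unlike
  \<open>rexp\<close> it has no quotient that is singular at 0, so its derivative there is
  immediate.\<close>

definition curve :: "real \<times> 'a \<Rightarrow> real \<times> 'a \<Rightarrow> real \<Rightarrow> real \<times> 'a" where
  "curve x v t = (1 / sqrt (1 + K * form K (t *\<^sub>R v) (t *\<^sub>R v))) *\<^sub>R (x + t *\<^sub>R v)"

lemma curve_0 [simp]: "curve x v 0 = x"
  by (simp add: curve_def)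

lemma curve_has_derivative: "(curve x v has_derivative (\<lambda>t. t *\<^sub>R v)) (at 0)"
  unfolding curve_def form_scaleR
  by (auto intro!: derivative_eq_intros)

end

section \<open>Existence, uniqueness and size of the gradient\<close>

locale model_function = model_space K V
  for K :: real and V :: "'a::real_inner set" +
  fixes B M :: "_ set" and F :: "real \<times> 'a \<Rightarrow> real"
  assumes finite_B: "finite B" and V_span: "V = span B"
    and open_M: "openin (top_of_set (model K V)) M"
    and F_diff: "F differentiable_on M"
begin

lemma M_subset: "M \<subseteq> model K V"
  using open_M by (rule openin_imp_subset)

lemma curve_in_M:
  assumes x: "x \<in> M" and v: "v \<in> tangent K V x"
  obtains \<delta> where "0 < \<delta>" "curve x v ` ball 0 \<delta> \<subseteq> M"
proof -
  obtain U where U: "open U" "M = model K V \<inter> U"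
    using open_M by (auto simp: openin_open)
  have "continuous (at 0) (curve x v)"
    using curve_has_derivative by (rule has_derivative_continuous)
  then have "(curve x v \<longlongrightarrow> x) (at 0)" by (simp add: continuous_at)
  then have "\<forall>\<^sub>F t in at 0. curve x v t \<in> U"
    using U x by (auto simp: tendsto_def)
  moreover have "((\<lambda>t::real. 1 + K * form K (t *\<^sub>R v) (t *\<^sub>R v)) \<longlongrightarrow> 1 + K * form K (0 *\<^sub>R v) (0 *\<^sub>R v)) (at 0)"
    unfolding form_scaleR by (intro tendsto_intros)
  then have "\<forall>\<^sub>F t in at (0::real). 0 < 1 + K * form K (t *\<^sub>R v) (t *\<^sub>R v)"
    by (rule order_tendstoD) simp
  ultimately have "\<forall>\<^sub>F t in at 0. curve x v t \<in> M"
  proof eventually_elim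
    case (elim t)
    have "t *\<^sub>R v \<in> tangent K V x" using v subspace_tangent by (simp add: subspace_scale)
    then have "curve x v t \<in> model K V"
      unfolding curve_def using x M_subset elim(2) by (intro normalize_mem) auto
    then show ?case using elim(1) U by simp
  qed
  then obtain \<delta> where \<delta>: "0 < \<delta>" "\<And>t. t \<noteq> 0 \<Longrightarrow> dist t 0 < \<delta> \<Longrightarrow> curve x v t \<in> M"
    by (auto simp: eventually_at)
  have "curve x v ` ball 0 \<delta> \<subseteq> M"
  proof (rule image_subsetI)
    fix t assume "t \<in> ball (0::real) \<delta>"
    then show "curve x v t \<in> M" using \<delta>(2)[of t] x by (cases "t = 0") auto
  qed
  with \<delta>(1) show ?thesis by (rule that)
qed

text \<open>\<open>F\<close> is differentiable only within \<open>M\<close>, but the curve stays in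
  \<open>M\<close> near 0; so its pullback has an ordinary derivative, and unique derivatives on the
  line become available.\<close>

lemma derivative_along_curve:
  assumes x: "x \<in> M" and v: "v \<in> tangent K V x"
    and F: "(F has_derivative form K G) (at x within M)"
  shows "((\<lambda>t. F (curve x v t)) has_real_derivative form K G v) (at 0)"
proof -
  obtain \<delta> where \<delta>: "0 < \<delta>" "curve x v ` ball 0 \<delta> \<subseteq> M" using curve_in_M[OF x v] .
  have "(curve x v has_derivative (\<lambda>t. t *\<^sub>R v)) (at 0 within ball 0 \<delta>)"
    using curve_has_derivative by (rule has_derivative_at_withinI)
  moreover have "(F has_derivative form K G) (at (curve x v 0) within curve x v ` ball 0 \<delta>)"
    using F has_derivative_subset[OF _ \<delta>(2)] by simp
  ultimately have "((\<lambda>t. F (curve x v t)) has_derivative (\<lambda>t. form K G (t *\<^sub>R v))) (at 0 within ball 0 \<delta>)"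
    by (rule has_derivative_in_compose)
  moreover have "at 0 within ball 0 \<delta> = at (0::real)"
    using \<delta>(1) by (intro at_within_open) auto
  ultimately show ?thesis
    by (simp add: has_field_derivative_def mult_commute_abs)
qed

text \<open>Precompose the ambient derivative with the projection \<open>P\<close> along
  \<open>x\<close> onto the tangent space. The change is a multiple of
  \<open>form K x (y - x)\<close>, which is quadratic for \<open>y\<close> on the model because
  \<open>2 * form K x (y - x) = - form K (y - x) (y - x)\<close>.\<close>

lemma rgrad_exists:
  assumes x: "x \<in> M"
  shows "\<exists>G. G \<in> tangent K V x \<and> (F has_derivative form K G) (at x within M)"
proof -
  obtain D where D: "(F has_derivative D) (at x within M)"
    using F_diff x by (auto simp: differentiable_on_def differentiable_def)
  then interpret D: bounded_linear D by (rule has_derivative_bounded_linear)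
  have xm: "x \<in> model K V" using x M_subset by blast
  define P where "P w = w - (K * form K x w) *\<^sub>R x" for w
  have "linear (\<lambda>w. D (P (0, w)))"
  proof (rule linearI)
    fix b1 b2 :: 'a and c :: real
    have "(0, b1 + b2) = (0, b1) + (0::real, b2)" "(0, c *\<^sub>R b1) = c *\<^sub>R (0::real, b1)" by simp_all
    then show "D (P (0, b1 + b2)) = D (P (0, b1)) + D (P (0, b2))" "D (P (0, c *\<^sub>R b1)) = c *\<^sub>R D (P (0, b1))"
      unfolding P_def by (simp_all only: form_add form_scaleR D.add D.diff D.scaleR) (simp_all add: algebra_simps)
  qed
  then obtain g where g: "g \<in> V" "\<And>w. w \<in> V \<Longrightarrow> D (P (0, w)) = g \<bullet> w"
    using riesz_finite_span[OF finite_B] V_span by metis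
  \<comment> \<open>The factor \<open>K\<close> cancels the one that \<open>form\<close> puts on
    first coordinates, as \<open>K * K = 1\<close>.\<close>
  define G where "G = (K * D (P (1, 0)), g)"
  have G: "form K G w = D (P w)" if "snd w \<in> V" for w
  proof -
    have w: "w = fst w *\<^sub>R (1, 0) + (0, snd w)" by (simp add: prod_eq_iff)
    have "D (P w) = fst w * D (P (1, 0)) + D (P (0, snd w))"
      by (subst w) (simp only: P_def form_add form_scaleR D.add D.diff D.scaleR, simp add: algebra_simps)
    also have "\<dots> = form K G w" using g that by (simp add: form_def G_def)
    finally show ?thesis by simp
  qed
  have "snd x \<in> V" using xm by (simp add: model_def)
  then have "form K x G = D (P x)" using G form_commute by metis
  also have "P x = 0" using form_self_model[OF xm] by (simp add: P_def)
  finally have "G \<in> tangent K V x" using g(1) by (simp add: tangent_def G_def)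
  moreover have "(F has_derivative form K G) (at x within M)"
  proof (rule has_derivative_quadratic_change[OF D bounded_linear_form])
    fix y assume "y \<in> M"
    then have ym: "y \<in> model K V" using M_subset by blast
    then have "snd (y - x) \<in> V" using xm subspace_V by (simp add: model_def subspace_diff)
    then have "D (y - x) - form K G (y - x) = K * form K x (y - x) * D x"
      unfolding G P_def by (simp only: G P_def D.diff D.scaleR) (simp add: P_def D.diff D.scaleR algebra_simps)
    moreover have "2 * form K x (y - x) = - form K (y - x) (y - x)"
      using form_self_model[OF xm] form_self_model[OF ym] by (simp add: form_commute[of K y x])
    then have "\<bar>form K x (y - x)\<bar> \<le> (norm (y - x))\<^sup>2"
      using abs_form_le[OF abs_K, of "y - x"] by linarith
    then have "\<bar>form K x (y - x)\<bar> * \<bar>D x\<bar> \<le> (norm (y - x))\<^sup>2 * \<bar>D x\<bar>" by (rule mult_right_mono) simp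
    ultimately show "\<bar>D (y - x) - form K G (y - x)\<bar> \<le> \<bar>D x\<bar> * (norm (y - x))\<^sup>2"
      using abs_K by (simp only: abs_mult) (simp add: mult.commute)
  qed
  ultimately show ?thesis by blast
qed

abbreviation "grad \<equiv> rgrad K V M F"

lemma rgrad:
  assumes x: "x \<in> M"
  shows "grad x \<in> tangent K V x" "(F has_derivative form K (grad x)) (at x within M)"
proof -
  have unique: "G' = G"
    if G: "G \<in> tangent K V x \<and> (F has_derivative form K G) (at x within M)"
      and G': "G' \<in> tangent K V x \<and> (F has_derivative form K G') (at x within M)" for G G'
  proof -
    \<comment> \<open>The curve in the direction of the difference itself forces that difference to
      have zero form.\<close>
    have v: "G - G' \<in> tangent K V x" using G G' subspace_tangent by (simp add: subspace_diff)
    have "form K G (G - G') = form K G' (G - G')"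
      using derivative_along_curve[OF x v] G G' DERIV_unique by blast
    then have "form K (G - G') (G - G') = 0" by (simp only: form_diff)
    then show ?thesis using form_tangent_eq_0[OF _ v] x M_subset by auto
  qed
  have "\<exists>!G. G \<in> tangent K V x \<and> (F has_derivative form K G) (at x within M)"
    using rgrad_exists[OF x] unique by blast
  from theI'[OF this] show "grad x \<in> tangent K V x" "(F has_derivative form K (grad x)) (at x within M)"
    unfolding rgrad_def by simp_all
qed

lemma rgrad_minimizer:
  assumes x: "x \<in> M" and min: "\<forall>y\<in>M. F x \<le> F y"
  shows "grad x = 0"
proof -
  obtain \<delta> where \<delta>: "0 < \<delta>" "curve x (grad x) ` ball 0 \<delta> \<subseteq> M"
    using curve_in_M[OF x rgrad(1)[OF x]] .
  have "form K (grad x) (grad x) = 0"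
  proof (rule DERIV_local_min[OF derivative_along_curve[OF x rgrad(1)[OF x] rgrad(2)[OF x]] \<delta>(1)])
    show "\<forall>y. \<bar>0 - y\<bar> < \<delta> \<longrightarrow> F (curve x (grad x) 0) \<le> F (curve x (grad x) y)"
    proof (intro allI impI)
      fix y :: real assume "\<bar>0 - y\<bar> < \<delta>"
      then have "y \<in> ball 0 \<delta>" by (simp add: dist_real_def)
      then have "curve x (grad x) y \<in> M" using \<delta>(2) by blast
      then show "F (curve x (grad x) 0) \<le> F (curve x (grad x) y)" using min by simp
    qed
  qed
  then show ?thesis using form_tangent_eq_0[OF _ rgrad(1)[OF x]] x M_subset by blast
qed

text \<open>The length \<open>Rg\<close> keeps the gradient step inside the ball known to lie in
  \<open>M\<close>. It lowers \<open>F\<close> by at least \<open>Rg * n - L / 2 * Rg^2\<close>,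
  while smoothness at \<open>xg\<close>, where the gradient vanishes, leaves only
  \<open>L / 2 * Rg^2\<close> above the minimum.\<close>

lemma rgrad_bound:
  assumes x0: "x0 \<in> M" and xg: "xg \<in> M" and min: "\<forall>y\<in>M. F xg \<le> F y"
    and Rg: "rdist K x0 xg \<le> Rg" "K = 1 \<Longrightarrow> Rg < pi / 2"
    and ball: "exp_ball K V x0 Rg \<subseteq> M" and smooth: "L_smooth K V M L F" and L: "0 < L"
  shows "rnorm K (grad x0) \<le> L * Rg"
proof -
  have x0m: "x0 \<in> model K V" and xgm: "xg \<in> model K V" using x0 xg M_subset by auto
  note gt = rgrad(1)[OF x0]
  have d0: "0 \<le> rdist K x0 xg" by (rule rdist_nonneg[OF x0m xgm])
  have anti: "form K x0 xg \<noteq> - 1" if "K = 1"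
  proof -
    have "0 < cos (rdist K x0 xg)" using d0 Rg that by (intro cos_gt_zero_pi) auto
    then show ?thesis using cosK_rdist[OF x0m xgm] that by (auto simp: cosK_def)
  qed
  show ?thesis
  proof (cases "Rg = 0")
    case True
    with d0 Rg have "rdist K x0 xg = 0" by simp
    then have "xg = x0" using rexp_log(3)[OF x0m xgm anti] by simp
    then show ?thesis using rgrad_minimizer[OF xg min] True by (simp add: rnorm_def)
  next
    case False
    then have Rg0: "0 < Rg" using d0 Rg by simp
    show ?thesis
    proof (cases "rnorm K (grad x0) = 0")
      case True
      then show ?thesis using Rg0 L by simp
    next
      case nz: False
      define n where "n = rnorm K (grad x0)"
      define v where "v = (- (Rg / n)) *\<^sub>R grad x0"
      have n: "0 < n" using nz rnorm_nonneg[OF x0m gt] by (simp add: n_def)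
      have vt: "v \<in> tangent K V x0" unfolding v_def by (rule subspace_scale[OF subspace_tangent gt])
      have nv: "rnorm K v = Rg"
        unfolding v_def rnorm_scaleR n_def[symmetric] using n Rg0 by simp
      have "Rg < pi" if "K = 1" using Rg(2)[OF that] pi_gt_zero by linarith
      then have vd: "v \<in> inj_dom K V x0" using vt nv by (auto simp: inj_dom_def)
      have y: "rexp K x0 v \<in> M" using ball vt nv by (auto simp: exp_ball_def)
      have "rdist K x0 (rexp K x0 v) = Rg"
        using rdist_rexp[OF x0m vt] vd nv by (auto simp: inj_dom_def)
      then have "F (rexp K x0 v) \<le> F x0 + form K (grad x0) v + L / 2 * Rg\<^sup>2"
        using smooth x0 y vd rlog_eqI[OF x0m vd] unfolding L_smooth_def by force
      moreover have "form K (grad x0) v = - (Rg * n)"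
        using rnorm_power2[OF x0m gt] n by (simp add: v_def n_def[symmetric] power2_eq_square field_simps)
      moreover have "F xg \<le> F (rexp K x0 v)" using min y by simp
      moreover have "F x0 \<le> F xg + L / 2 * (rdist K xg x0)\<^sup>2"
      proof -
        have "x0 \<in> rexp K xg ` inj_dom K V xg"
          using rexp_log[OF xgm x0m] anti by (metis form_commute image_eqI)
        then have "F x0 \<le> F xg + form K (grad xg) (rlog K V xg x0) + L / 2 * (rdist K xg x0)\<^sup>2"
          using smooth xg x0 unfolding L_smooth_def by blast
        then show ?thesis by (simp add: rgrad_minimizer[OF xg min])
      qed
      moreover have "L / 2 * (rdist K xg x0)\<^sup>2 \<le> L / 2 * Rg\<^sup>2"
        using Rg d0 L by (intro mult_left_mono power_mono) (auto simp: rdist_commute)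
      ultimately have "Rg * n \<le> L * Rg\<^sup>2" by linarith
      also have "\<dots> = Rg * (L * Rg)" by (simp add: power2_eq_square)
      finally show ?thesis using Rg0 by (simp add: n_def)
    qed
  qed
qed

end

section \<open>The geodesic chart\<close>

text \<open>Choosing preimages of an orthogonal set extends the inverse of the frame to a bounded
  linear map on the whole space, so that it can be differentiated; polarisation gives the inner
  products.\<close>

lemma (in model_space) tangent_frame_inverse:
  assumes "finite B" "V = span B" and x0: "x0 \<in> model K V" and frame: "tangent_frame K V x0 \<phi>"
  obtains \<psi> where "bounded_linear \<psi>" "\<And>w. w \<in> V \<Longrightarrow> \<psi> w \<in> tangent K V x0"
    "\<And>w. w \<in> V \<Longrightarrow> \<phi> (\<psi> w) = w" "\<And>v. v \<in> tangent K V x0 \<Longrightarrow> \<psi> (\<phi> v) = v"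
    "\<And>u v. u \<in> V \<Longrightarrow> v \<in> V \<Longrightarrow> form K (\<psi> u) (\<psi> v) = u \<bullet> v"
proof -
  have lin: "linear \<phi>" and img: "\<phi> ` tangent K V x0 = V"
    and iso: "\<And>v. v \<in> tangent K V x0 \<Longrightarrow> norm (\<phi> v) = rnorm K v"
    using frame by (auto simp: tangent_frame_def)
  obtain C where C: "finite C" "C \<subseteq> V"
    "\<And>w. w \<in> V \<Longrightarrow> (\<Sum>e\<in>C. (w \<bullet> e / (e \<bullet> e)) *\<^sub>R e) = w"
    using orthogonal_expansion[OF assms(1)] assms(2) by metis
  have "\<forall>e\<in>C. \<exists>v\<in>tangent K V x0. \<phi> v = e"
  proof
    fix e assume "e \<in> C"
    then have "e \<in> \<phi> ` tangent K V x0" using C(2) img by auto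
    then show "\<exists>v\<in>tangent K V x0. \<phi> v = e" by blast
  qed
  then obtain s where s: "\<And>e. e \<in> C \<Longrightarrow> s e \<in> tangent K V x0" "\<And>e. e \<in> C \<Longrightarrow> \<phi> (s e) = e"
    by metis
  define \<psi> where "\<psi> w = (\<Sum>e\<in>C. (w \<bullet> e / (e \<bullet> e)) *\<^sub>R s e)" for w
  have bl: "bounded_linear \<psi>"
    unfolding \<psi>_def divide_inverse
    by (intro bounded_linear_sum bounded_linear_scaleR_const bounded_linear_mult_const bounded_linear_inner_left)
  interpret \<psi>: bounded_linear \<psi> by (rule bl)
  have t: "\<psi> w \<in> tangent K V x0" for w
    unfolding \<psi>_def using s(1) subspace_tangent by (intro subspace_sum subspace_scale) auto
  have inv: "\<phi> (\<psi> w) = w" if "w \<in> V" for w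
  proof -
    have "\<phi> (\<psi> w) = (\<Sum>e\<in>C. (w \<bullet> e / (e \<bullet> e)) *\<^sub>R e)"
      unfolding \<psi>_def using lin s(2) by (simp add: linear_sum linear_scale)
    then show ?thesis using C(3)[OF that] by simp
  qed
  have norm: "form K (\<psi> w) (\<psi> w) = w \<bullet> w" if "w \<in> V" for w
    using rnorm_power2[OF x0 t] iso[OF t] inv[OF that] by (metis power2_norm_eq_inner)
  show ?thesis
  proof (rule that[OF bl t inv])
    fix v assume v: "v \<in> tangent K V x0"
    let ?d = "\<psi> (\<phi> v) - v"
    have d: "?d \<in> tangent K V x0" using v t subspace_tangent by (simp add: subspace_diff)
    have "\<phi> ?d = 0" using inv[of "\<phi> v"] v img lin by (auto simp: linear_diff)
    then have "rnorm K ?d = 0" using iso[OF d] by simp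
    then have "form K ?d ?d = 0" using rnorm_power2[OF x0 d] by simp
    then show "\<psi> (\<phi> v) = v" using form_tangent_eq_0[OF x0 d] by simp
  next
    fix u v assume u: "u \<in> V" and v: "v \<in> V"
    then have "u + v \<in> V" using subspace_V by (simp add: subspace_add)
    from norm[OF this] norm[OF u] norm[OF v] show "form K (\<psi> u) (\<psi> v) = u \<bullet> v"
      by (simp add: \<psi>.add form_commute[of K "\<psi> v" "\<psi> u"] inner_commute[of v u] algebra_simps)
  qed
qed

text \<open>With \<open>C = cos R\<close> the last hypothesis reads
  \<open>cos (2 * R) \<le> cos r\<close>, hence \<open>cos (r / 2) \<ge> C\<close>. The half angle
  then gives \<open>r * C^2 \<le> sin r\<close>. \<open>sinh_over_bounds\<close> is the hyperbolic
  counterpart.\<close>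

lemma sin_over_bounds:
  fixes r C :: real
  assumes "0 < r" "r < pi" "0 < C" "2 * C\<^sup>2 - 1 \<le> cos r"
  shows "1 \<le> r / sin r" "r / sin r \<le> 1 / C\<^sup>2" "\<bar>r / sin r - 1\<bar> \<le> 1 / C\<^sup>2 * r"
proof -
  have s: "0 < sin r" using assms sin_gt_zero by simp
  show ge: "1 \<le> r / sin r" using s assms sin_x_le_x[of r] by simp
  have "r / 2 * cos (r / 2) \<le> sin (r / 2)" using assms by (intro mult_cos_le_sin) auto
  moreover have c0: "0 \<le> cos (r / 2)" using assms by (intro cos_ge_zero) auto
  ultimately have "r / 2 * cos (r / 2) * cos (r / 2) \<le> sin (r / 2) * cos (r / 2)"
    by (intro mult_right_mono)
  then have "r * (cos (r / 2))\<^sup>2 \<le> sin r"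
    using sin_double[of "r / 2"] by (simp add: power2_eq_square)
  moreover have "r * C\<^sup>2 \<le> r * (cos (r / 2))\<^sup>2"
    using assms cos_double_cos[of "r / 2"] by (intro mult_left_mono) auto
  ultimately have "r * C\<^sup>2 \<le> sin r" by linarith
  then show le: "r / sin r \<le> 1 / C\<^sup>2" using s assms by (simp add: field_simps)
  have "r * cos r \<le> sin r" using assms by (intro mult_cos_le_sin) auto
  moreover have "r * (1 - r) \<le> r * cos r" using one_minus_cos_le[of r] assms by (intro mult_left_mono) auto
  ultimately have "r - sin r \<le> r * r" by (simp add: algebra_simps)
  from divide_right_mono[OF this, of "sin r"] have "r / sin r - 1 \<le> r / sin r * r"
    using s by (simp add: diff_divide_distrib)
  also have "\<dots> \<le> 1 / C\<^sup>2 * r" using le assms by (intro mult_right_mono) auto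
  finally show "\<bar>r / sin r - 1\<bar> \<le> 1 / C\<^sup>2 * r" using ge by simp
qed

lemma sinh_over_bounds:
  fixes r C :: real
  assumes "0 < r" "0 < C" "cosh r \<le> 2 * C\<^sup>2 - 1"
  shows "r / sinh r \<le> 1" "1 / C\<^sup>2 \<le> r / sinh r" "\<bar>r / sinh r - 1\<bar> \<le> r"
proof -
  have s: "0 < sinh r" using assms by simp
  show le: "r / sinh r \<le> 1" using s assms le_sinh[of r] by simp
  have "sinh r = 2 * sinh (r / 2) * cosh (r / 2)" using sinh_double[of "r / 2"] by simp
  moreover have "sinh (r / 2) * cosh (r / 2) \<le> r / 2 * cosh (r / 2) * cosh (r / 2)"
    using sinh_le_mult_cosh[of "r / 2"] assms by (intro mult_right_mono) auto
  then have "2 * sinh (r / 2) * cosh (r / 2) \<le> r * (cosh (r / 2))\<^sup>2"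
    unfolding power2_eq_square by linarith
  moreover have "(cosh (r / 2))\<^sup>2 \<le> C\<^sup>2" using cosh_double_cosh[of "r / 2"] assms by simp
  then have "r * (cosh (r / 2))\<^sup>2 \<le> r * C\<^sup>2" by (rule mult_left_mono) (use assms in simp)
  ultimately have "sinh r \<le> r * C\<^sup>2" by linarith
  then show "1 / C\<^sup>2 \<le> r / sinh r" using s assms by (simp add: field_simps)
  have "1 - r \<le> exp (- r)" using exp_ge_add_one_self[of "- r"] by simp
  also have "\<dots> \<le> 1 / cosh r"
  proof -
    have "cosh r \<le> exp r" using assms by (simp add: cosh_def)
    then show ?thesis by (simp add: exp_minus inverse_eq_divide frac_le)
  qed
  also have "\<dots> \<le> r / sinh r"
    using s assms sinh_le_mult_cosh[of r] by (simp add: field_simps)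
  finally show "\<bar>r / sinh r - 1\<bar> \<le> r" using le by simp
qed

text \<open>\<psi> is the inverse of the frame at \<open>x0\<close>. \<omega> is kept apart from
  \<open>R\<close> so that it can be chosen for the largest admissible radius.\<close>

locale model_chart = model_space K V
  for K :: real and V :: "'a::real_inner set" +
  fixes x0 :: "real \<times> 'a" and \<psi> :: "'a \<Rightarrow> real \<times> 'a" and R \<omega> :: real
  assumes x0_model: "x0 \<in> model K V"
    and bounded_linear_psi: "bounded_linear \<psi>"
    and psi_tangent: "w \<in> V \<Longrightarrow> \<psi> w \<in> tangent K V x0"
    and psi_form: "u \<in> V \<Longrightarrow> v \<in> V \<Longrightarrow> form K (\<psi> u) (\<psi> v) = u \<bullet> v"
    and psi_surj: "t \<in> tangent K V x0 \<Longrightarrow> \<exists>w\<in>V. \<psi> w = t"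
    and R_pos: "0 < R" and R_less: "K = 1 \<Longrightarrow> R < pi / 2"
    and omega: "cosK K R \<le> \<omega>" "1 / cosK K R \<le> \<omega>"
begin

text \<open>\<open>p\<close> parametrises the affine tangent hyperplane at \<open>x0\<close>, and
  \<open>H\<close> inverts the gnomonic or Beltrami-Klein projection. On the ball,
  \<open>1 / N w\<close> is \<open>cosK\<close> of the distance from \<open>x0\<close> to
  \<open>H w\<close>, and \<rho> is \<open>tan R\<close> or \<open>tanh R\<close>.\<close>

definition p :: "'a \<Rightarrow> real \<times> 'a" where "p w = x0 + \<psi> w"
definition N :: "'a \<Rightarrow> real" where "N w = sqrt (1 + K * (w \<bullet> w))"
definition H :: "'a \<Rightarrow> real \<times> 'a" where "H w = (1 / N w) *\<^sub>R p w"
definition dH :: "'a \<Rightarrow> 'a \<Rightarrow> real \<times> 'a" where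
  "dH x u = (1 / N x) *\<^sub>R \<psi> u - (K * (x \<bullet> u) / N x ^ 3) *\<^sub>R p x"
definition \<rho> :: real where "\<rho> = sinK K R / cosK K R"
definition X :: "'a set" where "X = {w \<in> V. norm w \<le> \<rho>}"

abbreviation C :: real where "C \<equiv> cosK K R"

lemma C_pos: "0 < C" and C_le_1: "K = 1 \<Longrightarrow> C \<le> 1" and C_ge_1: "K = - 1 \<Longrightarrow> 1 \<le> C"
  using K_cases R_pos R_less by (auto simp: cosK_def intro!: cos_gt_zero_pi cosh_real_ge_1)

lemma omega_ge_1: "1 \<le> \<omega>"
  using K_cases omega C_pos C_le_1 C_ge_1 by (auto simp: field_simps intro: order_trans)

lemma rho_pos: "0 < \<rho>"
proof -
  have "K = 1 \<Longrightarrow> R < pi" using R_less pi_gt_zero by linarith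
  then show ?thesis using sinK_pos[OF R_pos] C_pos by (simp add: \<rho>_def)
qed

lemma rho_sq: "1 + K * \<rho>\<^sup>2 = 1 / C\<^sup>2" "C\<^sup>2 * \<rho>\<^sup>2 = K * (1 - C\<^sup>2)"
proof -
  show "C\<^sup>2 * \<rho>\<^sup>2 = K * (1 - C\<^sup>2)"
    using C_pos sinK_power2[of R] by (simp add: \<rho>_def power_divide)
  then have "C\<^sup>2 + K * (C\<^sup>2 * \<rho>\<^sup>2) = 1" by simp
  then have "C\<^sup>2 * (1 + K * \<rho>\<^sup>2) = 1" by (simp add: algebra_simps)
  then show "1 + K * \<rho>\<^sup>2 = 1 / C\<^sup>2" using C_pos by (simp add: field_simps)
qed

lemma rho_le: "\<rho> \<le> \<omega>"
proof -
  have "sinK K R \<le> (if K = 1 then 1 else C)"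
    using K_cases sinh_le_cosh_real by (auto simp: sinK_def cosK_def)
  then have "\<rho> \<le> (if K = 1 then 1 else C) / C"
    unfolding \<rho>_def using C_pos by (intro divide_right_mono) auto
  also have "\<dots> \<le> \<omega>" using C_pos omega omega_ge_1 by auto
  finally show ?thesis .
qed

sublocale ball: subspace_ball V \<rho> X
  by unfold_locales (use subspace_V rho_pos in \<open>auto simp: X_def\<close>)

lemma X_V: "x \<in> X \<Longrightarrow> x \<in> V" by (simp add: X_def)

lemma inner_self_bounds: 
  assumes "x \<in> X" shows "0 \<le> x \<bullet> x" "x \<bullet> x \<le> \<rho>\<^sup>2"
  using assms power_mono[of "norm x" \<rho> 2] by (auto simp: X_def power2_norm_eq_inner)

lemma N_arg_bounds:
  assumes "x \<in> X"
  shows "K = 1 \<Longrightarrow> 1 \<le> 1 + K * (x \<bullet> x) \<and> 1 + K * (x \<bullet> x) \<le> (1 / C)\<^sup>2"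
    "K = - 1 \<Longrightarrow> (1 / C)\<^sup>2 \<le> 1 + K * (x \<bullet> x) \<and> 1 + K * (x \<bullet> x) \<le> 1"
  using inner_self_bounds[OF assms] rho_sq(1) by (auto simp: power_divide)

lemma N_arg_pos: "x \<in> X \<Longrightarrow> 0 < 1 + K * (x \<bullet> x)"
  using K_cases N_arg_bounds[of x] C_pos
  by (smt (verit) divide_pos_pos zero_less_power)

lemma N_pos: "x \<in> X \<Longrightarrow> 0 < N x" and N_sq: "x \<in> X \<Longrightarrow> (N x)\<^sup>2 = 1 + K * (x \<bullet> x)"
  by (simp_all add: N_def N_arg_pos less_imp_le)

lemma N_bounds_pos:
  assumes "K = 1" "x \<in> X"
  shows "1 \<le> N x \<and> N x \<le> 1 / C"
proof -
  have "sqrt 1 \<le> N x" "N x \<le> sqrt ((1 / C)\<^sup>2)"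
    unfolding N_def using N_arg_bounds(1)[OF assms(2,1)] by (simp_all only: real_sqrt_le_mono)
  then show ?thesis using C_pos by (simp only: real_sqrt_abs) simp
qed

lemma N_bounds_neg:
  assumes "K = - 1" "x \<in> X"
  shows "1 / C \<le> N x \<and> N x \<le> 1"
proof -
  have "sqrt ((1 / C)\<^sup>2) \<le> N x" "N x \<le> sqrt 1"
    unfolding N_def using N_arg_bounds(2)[OF assms(2,1)] by (simp_all only: real_sqrt_le_mono)
  then show ?thesis using C_pos by (simp only: real_sqrt_abs) simp
qed

lemma inv_omega_le: "1 / \<omega> \<le> 1 / C" "1 / \<omega> \<le> 1" "1 / C \<le> \<omega>" "1 \<le> \<omega>"
  using C_pos omega omega_ge_1 by (auto intro!: divide_left_mono)

lemma N_bounds: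
  assumes "x \<in> X"
  shows "1 / \<omega> \<le> N x" "N x \<le> \<omega>"
proof -
  have "1 / \<omega> \<le> N x \<and> N x \<le> \<omega>"
  proof (cases "K = 1")
    case True
    then show ?thesis using N_bounds_pos[OF _ assms] inv_omega_le by linarith
  next
    case False
    then have "K = - 1" using K_cases by simp
    then show ?thesis using N_bounds_neg[OF _ assms] inv_omega_le by linarith
  qed
  then show "1 / \<omega> \<le> N x" "N x \<le> \<omega>" by auto
qed

lemma N_ratio_le: "x \<in> X \<Longrightarrow> y \<in> X \<Longrightarrow> N x / N y \<le> (if K = 1 then 1 / C else C)"
  "x \<in> X \<Longrightarrow> y \<in> X \<Longrightarrow> (if K = 1 then C else 1 / C) \<le> N x / N y"
proof -
  assume x: "x \<in> X" and y: "y \<in> X"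
  have pos: "0 < N x" "0 < N y" using N_pos x y by auto
  show "N x / N y \<le> (if K = 1 then 1 / C else C)"
  proof (cases "K = 1")
    case True
    then have "N x / N y \<le> (1 / C) / 1"
      using N_bounds_pos[OF True x] N_bounds_pos[OF True y] C_pos by (intro frac_le) auto
    then show ?thesis using True by simp
  next
    case False
    then have K: "K = - 1" using K_cases by simp
    then have "N x / N y \<le> 1 / (1 / C)"
      using N_bounds_neg[OF K x] N_bounds_neg[OF K y] C_pos by (intro frac_le) auto
    then show ?thesis using False by simp
  qed
  show "(if K = 1 then C else 1 / C) \<le> N x / N y"
  proof (cases "K = 1")
    case True
    then have "1 / (1 / C) \<le> N x / N y"
      using N_bounds_pos[OF True x] N_bounds_pos[OF True y] C_pos pos by (intro frac_le) auto
    then show ?thesis using True by simp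
  next
    case False
    then have K: "K = - 1" using K_cases by simp
    then have "(1 / C) / 1 \<le> N x / N y"
      using N_bounds_neg[OF K x] N_bounds_neg[OF K y] C_pos pos by (intro frac_le) auto
    then show ?thesis using False by simp
  qed
qed

section \<open>Metric and distance in the chart\<close>

lemma form_psi_x0 [simp]: "w \<in> V \<Longrightarrow> form K x0 (\<psi> w) = 0" "w \<in> V \<Longrightarrow> form K (\<psi> w) x0 = 0"
  using psi_tangent[of w] form_commute[of K "\<psi> w" x0] by (auto simp: tangent_def)

lemma form_x0 [simp]: "form K x0 x0 = K"
  using form_self_model[OF x0_model] .

lemma form_p: "x \<in> V \<Longrightarrow> y \<in> V \<Longrightarrow> form K (p x) (p y) = K + x \<bullet> y"
  by (simp add: p_def psi_form)

lemma form_psi_p: "x \<in> V \<Longrightarrow> u \<in> V \<Longrightarrow> form K (p x) (\<psi> u) = x \<bullet> u" "x \<in> V \<Longrightarrow> u \<in> V \<Longrightarrow> form K (\<psi> u) (p x) = u \<bullet> x"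
  by (simp_all add: p_def psi_form)

lemma H_model: "x \<in> V \<Longrightarrow> 0 < 1 + K * (x \<bullet> x) \<Longrightarrow> H x \<in> model K V"
  using normalize_mem[OF x0_model psi_tangent, of x] by (simp add: H_def N_def p_def psi_form)

lemma H_mem: "x \<in> X \<Longrightarrow> H x \<in> model K V"
  using H_model N_arg_pos X_V by blast

lemma form_H: "x \<in> X \<Longrightarrow> y \<in> X \<Longrightarrow> K * form K (H x) (H y) = (1 + K * (x \<bullet> y)) / (N x * N y)"
  by (simp add: H_def form_p X_V algebra_simps add_divide_distrib)

lemma form_x0_H: "x \<in> V \<Longrightarrow> K * form K x0 (H x) = 1 / N x"
  by (simp add: H_def p_def)

lemma H_inj:
  assumes x: "x \<in> X" and y: "y \<in> X" and eq: "H x = H y"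
  shows "x = y"
proof -
  interpret \<psi>: bounded_linear \<psi> by (rule bounded_linear_psi)
  have "N x = N y"
    using form_x0_H[OF X_V[OF x]] form_x0_H[OF X_V[OF y]] eq by simp
  then have "p x = p y" using eq N_pos[OF x] by (simp add: H_def)
  then have "\<psi> (x - y) = 0" by (simp add: p_def \<psi>.diff)
  moreover have "x - y \<in> V" using x y X_V subspace_V by (simp add: subspace_diff)
  ultimately have "(x - y) \<bullet> (x - y) = 0" using psi_form[of "x - y" "x - y"] by simp
  then show ?thesis by simp
qed

lemma dH_has_derivative:
  assumes "x \<in> X"
  shows "(H has_derivative dH x) (at x within S)"
proof -
  have pos: "0 < 1 + K * (x \<bullet> x)" by (rule N_arg_pos[OF assms])
  have \<psi>: "(\<psi> has_derivative \<psi>) (at x within S)"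
    by (rule bounded_linear.has_derivative[OF bounded_linear_psi has_derivative_ident])
  have p: "(p has_derivative \<psi>) (at x within S)"
    unfolding p_def[abs_def] using \<psi> by (auto intro!: derivative_eq_intros)
  have N: "(N has_derivative (\<lambda>u. K * (x \<bullet> u) / N x)) (at x within S)"
    unfolding N_def[abs_def] using pos
    by (auto intro!: derivative_eq_intros simp: inner_commute field_simps)
  have "((\<lambda>w. inverse (N w)) has_derivative (\<lambda>u. - (inverse (N x) * (K * (x \<bullet> u) / N x) * inverse (N x)))) (at x within S)"
    by (rule Deriv.has_derivative_inverse[OF _ N]) (use N_pos[OF assms] in simp)
  from has_derivative_scaleR[OF this p]
  have "((\<lambda>w. inverse (N w) *\<^sub>R p w) has_derivative
      (\<lambda>u. inverse (N x) *\<^sub>R \<psi> u + (- (inverse (N x) * (K * (x \<bullet> u) / N x) * inverse (N x))) *\<^sub>R p x)) (at x within S)" .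
  moreover have "(\<lambda>w. inverse (N w) *\<^sub>R p w) = H" by (auto simp: H_def inverse_eq_divide)
  moreover have "(\<lambda>u. inverse (N x) *\<^sub>R \<psi> u + (- (inverse (N x) * (K * (x \<bullet> u) / N x) * inverse (N x))) *\<^sub>R p x) = dH x"
    by (auto simp: dH_def field_simps power3_eq_cube)
  ultimately show ?thesis by simp
qed

text \<open>The Riemannian metric in chart coordinates; for \<open>K = - 1\<close> it is the
  Beltrami-Klein metric.\<close>

lemma form_dH:
  assumes x: "x \<in> X" and u: "u \<in> V"
  shows "form K (dH x u) (dH x u) = (norm u)\<^sup>2 / (N x)\<^sup>2 - K * (x \<bullet> u)\<^sup>2 / N x ^ 4"
proof -
  have n: "0 < N x" by (rule N_pos[OF x])
  have pp: "form K (p x) (p x) = K * (N x)\<^sup>2" using form_p X_V[OF x] N_sq[OF x] by (simp add: algebra_simps)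
  have expand: "form K (\<alpha> *\<^sub>R \<psi> u - \<beta> *\<^sub>R p x) (\<alpha> *\<^sub>R \<psi> u - \<beta> *\<^sub>R p x) =
      \<alpha> * \<alpha> * (u \<bullet> u) - 2 * (\<beta> * (x \<bullet> u) * \<alpha>) + \<beta> * \<beta> * form K (p x) (p x)" for \<alpha> \<beta>
    using u X_V[OF x] by (simp add: psi_form form_psi_p inner_commute[of u x]) (simp add: algebra_simps)
  have "form K (dH x u) (dH x u) = 1 / N x * (1 / N x) * (u \<bullet> u) - 2 * ((K * (x \<bullet> u) / N x ^ 3) * (x \<bullet> u) * (1 / N x))
      + (K * (x \<bullet> u) / N x ^ 3) * (K * (x \<bullet> u) / N x ^ 3) * (K * (N x)\<^sup>2)"
    unfolding dH_def expand pp ..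
  also have "(K * (x \<bullet> u) / N x ^ 3) * (K * (x \<bullet> u) / N x ^ 3) * (K * (N x)\<^sup>2) = K * (x \<bullet> u)\<^sup>2 / N x ^ 4"
    using n K_cases by (auto simp: field_simps power2_eq_square eval_nat_numeral)
  also have "2 * ((K * (x \<bullet> u) / N x ^ 3) * (x \<bullet> u) * (1 / N x)) = 2 * (K * (x \<bullet> u)\<^sup>2 / N x ^ 4)"
    by (simp add: power2_eq_square eval_nat_numeral)
  finally show ?thesis by (simp add: power2_norm_eq_inner power2_eq_square[of "N x"])
qed

text \<open>Straight segments are mapped to geodesics: the logarithm is parallel to the derivative of the chart.\<close>

lemma tangential_part_H:
  assumes x: "x \<in> X" and y: "y \<in> X"
  shows "H y - (K * form K (H x) (H y)) *\<^sub>R H x = (N x / N y) *\<^sub>R dH x (y - x)"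
proof -
  interpret \<psi>: bounded_linear \<psi> by (rule bounded_linear_psi)
  have n: "0 < N x" "0 < N y" using N_pos x y by auto
  have py: "p y = p x + \<psi> (y - x)" by (simp add: p_def \<psi>.diff)
  have "1 - (1 + K * (x \<bullet> y)) / (N x)\<^sup>2 = - (K * (x \<bullet> (y - x))) / (N x)\<^sup>2"
  proof -
    have "(N x)\<^sup>2 - (1 + K * (x \<bullet> y)) = - (K * (x \<bullet> (y - x)))"
      unfolding N_sq[OF x] by (simp add: inner_diff_right algebra_simps)
    moreover have "1 - (1 + K * (x \<bullet> y)) / (N x)\<^sup>2 = ((N x)\<^sup>2 - (1 + K * (x \<bullet> y))) / (N x)\<^sup>2"
      using n by (simp add: diff_divide_distrib)
    ultimately show ?thesis by simp
  qed
  moreover have "1 / N y - (1 + K * (x \<bullet> y)) / (N x * N y) * (1 / N x) = 1 / N y * (1 - (1 + K * (x \<bullet> y)) / (N x)\<^sup>2)"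
    using n by (simp add: field_simps power2_eq_square)
  ultimately have coef: "1 / N y - (1 + K * (x \<bullet> y)) / (N x * N y) * (1 / N x) = - (N x / N y * (K * (x \<bullet> (y - x)) / N x ^ 3))"
    using n by (simp add: power2_eq_square power3_eq_cube)
  have "H y - (K * form K (H x) (H y)) *\<^sub>R H x =
      (1 / N y - (1 + K * (x \<bullet> y)) / (N x * N y) * (1 / N x)) *\<^sub>R p x + (1 / N y) *\<^sub>R \<psi> (y - x)"
    unfolding form_H[OF x y]
    unfolding H_def py by (simp add: scaleR_add_right scaleR_diff_left)
  also have "\<dots> = (N x / N y) *\<^sub>R dH x (y - x)"
    unfolding coef dH_def using n by (simp add: scaleR_diff_right)
  finally show ?thesis .
qed

lemma cosK_rdist_H:
  assumes x: "x \<in> X" and y: "y \<in> X"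
  shows "cosK K (rdist K (H x) (H y)) = (1 + K * (x \<bullet> y)) / (N x * N y)"
  using cosK_rdist[OF H_mem[OF x] H_mem[OF y]] form_H[OF x y] by simp

lemma inner_bounds:
  assumes x: "x \<in> X" and y: "y \<in> X"
  shows "\<bar>x \<bullet> y\<bar> \<le> norm x * norm y" "norm x * norm y \<le> \<rho>\<^sup>2"
proof -
  show "\<bar>x \<bullet> y\<bar> \<le> norm x * norm y" by (rule Cauchy_Schwarz_ineq2)
  show "norm x * norm y \<le> \<rho>\<^sup>2"
    unfolding power2_eq_square using x y rho_pos by (intro mult_mono) (auto simp: X_def)
qed

text \<open>This is the triangle inequality through \<open>x0\<close>, as \<open>2 * C^2 - 1\<close>
  is \<open>cos (2 * R)\<close>. The sign of that number decides whether \<open>N x * N y\<close>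
  has to be bounded from above or from below.\<close>

lemma cosK_rdist_pos:
  assumes K: "K = 1" and x: "x \<in> X" and y: "y \<in> X"
  shows "2 * C\<^sup>2 - 1 \<le> cosK K (rdist K (H x) (H y))"
proof -
  let ?a = "norm x * norm y"
  have n: "0 < N x" "0 < N y" using N_pos x y by auto
  have rho: "1 + \<rho>\<^sup>2 = 1 / C\<^sup>2" using rho_sq(1) K by simp
  have ab: "- ?a \<le> x \<bullet> y" "?a \<le> \<rho>\<^sup>2" using inner_bounds[OF x y] by auto
  have Nsq: "(N x)\<^sup>2 = 1 + (norm x)\<^sup>2" "(N y)\<^sup>2 = 1 + (norm y)\<^sup>2"
    using N_sq[OF x] N_sq[OF y] K by (simp_all add: power2_norm_eq_inner)
  have "(2 * C\<^sup>2 - 1) * (N x * N y) \<le> 1 + x \<bullet> y"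
  proof (cases "0 \<le> 2 * C\<^sup>2 - 1")
    case True
    have "N x * N y \<le> 1 / C * (1 / C)"
      using N_bounds_pos[OF K x] N_bounds_pos[OF K y] n C_pos by (intro mult_mono) auto
    then have "(2 * C\<^sup>2 - 1) * (N x * N y) \<le> (2 * C\<^sup>2 - 1) * (1 / C\<^sup>2)"
      using True by (intro mult_left_mono) (auto simp: power2_eq_square)
    also have "\<dots> = 1 - \<rho>\<^sup>2" using rho C_pos by (simp add: field_simps)
    also have "\<dots> \<le> 1 + x \<bullet> y" using ab by linarith
    finally show ?thesis .
  next
    case False
    have "(1 + ?a)\<^sup>2 \<le> (N x * N y)\<^sup>2"
      unfolding power_mult_distrib Nsq using zero_le_power2[of "norm x - norm y"]
      by (simp add: power2_eq_square algebra_simps)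
    then have "1 + ?a \<le> N x * N y" by (rule power2_le_imp_le) (use n in simp)
    then have "(2 * C\<^sup>2 - 1) * (N x * N y) \<le> (2 * C\<^sup>2 - 1) * (1 + ?a)"
      using False by (intro mult_left_mono_neg) auto
    moreover have "C\<^sup>2 * (1 + ?a) \<le> C\<^sup>2 * (1 / C\<^sup>2)"
      using ab rho by (intro mult_left_mono) auto
    then have "C\<^sup>2 * (1 + ?a) \<le> 1" using C_pos by simp
    then have "(2 * C\<^sup>2 - 1) * (1 + ?a) \<le> 1 - ?a" by (simp add: algebra_simps)
    ultimately show ?thesis using ab by linarith
  qed
  then show ?thesis unfolding cosK_rdist_H[OF x y] using n K by (simp add: field_simps)
qed

lemma cosK_rdist_neg:
  assumes K: "K = - 1" and x: "x \<in> X" and y: "y \<in> X"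
  shows "cosK K (rdist K (H x) (H y)) \<le> 2 * C\<^sup>2 - 1"
proof -
  have n: "0 < N x" "0 < N y" using N_pos x y by auto
  have rho: "C\<^sup>2 * \<rho>\<^sup>2 = C\<^sup>2 - 1" using rho_sq(2) K by simp
  have "1 / C * (1 / C) \<le> N x * N y"
    using N_bounds_neg[OF K x] N_bounds_neg[OF K y] n C_pos by (intro mult_mono) auto
  then have "1 \<le> C\<^sup>2 * (N x * N y)" using C_pos by (simp add: field_simps power2_eq_square)
  moreover have "- (x \<bullet> y) \<le> \<rho>\<^sup>2" using inner_bounds[OF x y] by auto
  ultimately have "(1 - x \<bullet> y) * 1 \<le> (1 + \<rho>\<^sup>2) * (C\<^sup>2 * (N x * N y))"
    by (intro mult_mono) auto
  also have "\<dots> = (2 * C\<^sup>2 - 1) * (N x * N y)"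
  proof -
    have "(1 + \<rho>\<^sup>2) * (C\<^sup>2 * (N x * N y)) = (C\<^sup>2 + C\<^sup>2 * \<rho>\<^sup>2) * (N x * N y)" by (simp add: algebra_simps)
    then show ?thesis unfolding rho by simp
  qed
  finally show ?thesis unfolding cosK_rdist_H[OF x y] using n K by (simp add: field_simps)
qed

text \<open>\<open>sinK K r\<close> is the length of the component of \<open>H y\<close> tangential
  at \<open>H x\<close>, which \<open>tangential_part_H\<close> identifies with a multiple of
  \<open>dH x (y - x)\<close>. So the chart metric at one point suffices, without lengths of
  curves.\<close>

lemma sinK_rdist_le:
  assumes x: "x \<in> X" and y: "y \<in> X" and nn: "0 \<le> sinK K (rdist K (H x) (H y))"
  shows "sinK K (rdist K (H x) (H y)) \<le> (if K = 1 then 1 else C\<^sup>2) * norm (y - x)"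
proof -
  let ?r = "rdist K (H x) (H y)" and ?u = "y - x"
  have n: "0 < N x" "0 < N y" using N_pos x y by auto
  have u: "?u \<in> V" using x y X_V subspace_V by (simp add: subspace_diff)
  have "form K (H y - (K * form K (H x) (H y)) *\<^sub>R H x) (H y - (K * form K (H x) (H y)) *\<^sub>R H x) = (sinK K ?r)\<^sup>2"
    unfolding sinK_power2 cosK_rdist[OF H_mem[OF x] H_mem[OF y]]
    using form_self_model[OF H_mem[OF x]] form_self_model[OF H_mem[OF y]]
    by (simp add: form_commute[of K "H y" "H x"] power2_eq_square algebra_simps)
  then have "(sinK K ?r)\<^sup>2 = (N x / N y)\<^sup>2 * form K (dH x ?u) (dH x ?u)"
    unfolding tangential_part_H[OF x y] form_scaleR by (simp add: power2_eq_square)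
  also have "\<dots> = 1 / (N y)\<^sup>2 * ((norm ?u)\<^sup>2 - K * (x \<bullet> ?u)\<^sup>2 / (N x)\<^sup>2)"
    unfolding form_dH[OF x u] using n by (simp add: field_simps power2_eq_square eval_nat_numeral)
  finally have sq: "(sinK K ?r)\<^sup>2 = 1 / (N y)\<^sup>2 * ((norm ?u)\<^sup>2 - K * (x \<bullet> ?u)\<^sup>2 / (N x)\<^sup>2)" .
  have "(sinK K ?r)\<^sup>2 \<le> ((if K = 1 then 1 else C\<^sup>2) * norm ?u)\<^sup>2"
  proof (cases "K = 1")
    case True
    have "1\<^sup>2 \<le> (N y)\<^sup>2" using N_bounds_pos[OF True y] by (intro power_mono) auto
    then have N1: "1 / (N y)\<^sup>2 \<le> 1" using n by (simp add: divide_le_eq)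
    have "(norm ?u)\<^sup>2 - K * (x \<bullet> ?u)\<^sup>2 / (N x)\<^sup>2 \<le> (norm ?u)\<^sup>2" using True by simp
    then have "(sinK K ?r)\<^sup>2 \<le> 1 / (N y)\<^sup>2 * (norm ?u)\<^sup>2"
      unfolding sq by (rule mult_left_mono) simp
    also have "\<dots> \<le> 1 * (norm ?u)\<^sup>2" using N1 by (rule mult_right_mono) simp
    finally have "(sinK K ?r)\<^sup>2 \<le> 1 * (norm ?u)\<^sup>2" .
    then show ?thesis using True by simp
  next
    case False
    then have K: "K = - 1" using K_cases by simp
    have N1: "1 / (N z)\<^sup>2 \<le> C\<^sup>2" if "z \<in> X" for z
    proof -
      have "(1 / C)\<^sup>2 \<le> (N z)\<^sup>2" using N_bounds_neg[OF K that] C_pos by (intro power_mono) auto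
      then show ?thesis using C_pos N_pos[OF that] by (simp add: field_simps power_divide)
    qed
    have "(x \<bullet> ?u)\<^sup>2 \<le> (norm x)\<^sup>2 * (norm ?u)\<^sup>2"
      using Cauchy_Schwarz_ineq[of x ?u] by (simp add: power2_norm_eq_inner)
    also have "\<dots> \<le> \<rho>\<^sup>2 * (norm ?u)\<^sup>2"
      using x by (intro mult_right_mono power_mono) (auto simp: X_def)
    finally have "(x \<bullet> ?u)\<^sup>2 * (1 / (N x)\<^sup>2) \<le> \<rho>\<^sup>2 * (norm ?u)\<^sup>2 * C\<^sup>2"
      using N1[OF x] by (intro mult_mono) auto
    also have "\<dots> = (C\<^sup>2 * \<rho>\<^sup>2) * (norm ?u)\<^sup>2" by simp
    also have "C\<^sup>2 * \<rho>\<^sup>2 = C\<^sup>2 - 1" using rho_sq(2) K by simp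
    finally have "(norm ?u)\<^sup>2 - K * (x \<bullet> ?u)\<^sup>2 / (N x)\<^sup>2 \<le> C\<^sup>2 * (norm ?u)\<^sup>2"
      using K by (simp add: algebra_simps)
    moreover have "0 \<le> (norm ?u)\<^sup>2 - K * (x \<bullet> ?u)\<^sup>2 / (N x)\<^sup>2" using K by simp
    ultimately have "(sinK K ?r)\<^sup>2 \<le> C\<^sup>2 * (C\<^sup>2 * (norm ?u)\<^sup>2)"
      unfolding sq using N1[OF y] by (intro mult_mono) auto
    then show ?thesis using False by (simp add: power_mult_distrib power2_eq_square mult_ac)
  qed
  then show ?thesis by (rule power2_le_imp_le) (use C_pos in auto)
qed

lemma omega_powers: "C\<^sup>2 \<le> \<omega>\<^sup>2" "1 / C\<^sup>2 \<le> \<omega>\<^sup>2"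
  using power_mono[OF omega(1), of 2] power_mono[OF omega(2), of 2] C_pos
  by (simp_all add: power_divide)

text \<open>Factor the difference of the squares, whose dependence on \<open>x\<close> and
  \<open>y\<close> is polynomial, and divide by \<open>N x + N y \<ge> 2 / \<omega>\<close>.\<close>

lemma N_ratio_dist:
  assumes x: "x \<in> X" and y: "y \<in> X"
  shows "\<bar>N x / N y - 1\<bar> \<le> \<omega> ^ 3 * norm (y - x)"
proof -
  have n: "0 < N x" "0 < N y" using N_pos x y by auto
  have w: "0 < \<omega>" using omega_ge_1 by simp
  have "\<bar>(N x)\<^sup>2 - (N y)\<^sup>2\<bar> = \<bar>(x + y) \<bullet> (x - y)\<bar>"
    unfolding N_sq[OF x] N_sq[OF y] using K_cases
    by (auto simp: algebra_simps inner_commute abs_if)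
  also have "\<dots> \<le> norm (x + y) * norm (x - y)" by (rule Cauchy_Schwarz_ineq2)
  also have "\<dots> \<le> (2 * \<rho>) * norm (x - y)"
    using x y norm_triangle_ineq[of x y] by (intro mult_right_mono) (auto simp: X_def)
  finally have "\<bar>(N x)\<^sup>2 - (N y)\<^sup>2\<bar> \<le> 2 * \<rho> * norm (x - y)" .
  moreover have "(N x)\<^sup>2 - (N y)\<^sup>2 = (N x + N y) * (N x - N y)" by (simp add: power2_eq_square algebra_simps)
  then have "\<bar>(N x)\<^sup>2 - (N y)\<^sup>2\<bar> = (N x + N y) * \<bar>N x - N y\<bar>" using n by (simp add: abs_mult)
  moreover have "2 / \<omega> * \<bar>N x - N y\<bar> \<le> (N x + N y) * \<bar>N x - N y\<bar>"
    using N_bounds(1)[OF x] N_bounds(1)[OF y] by (intro mult_right_mono) auto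
  ultimately have "2 / \<omega> * \<bar>N x - N y\<bar> \<le> 2 * \<rho> * norm (x - y)" by linarith
  then have "\<bar>N x - N y\<bar> \<le> \<omega> * \<rho> * norm (x - y)" using w by (simp add: field_simps)
  also have "\<dots> \<le> \<omega> * \<omega> * norm (x - y)"
    using rho_le w by (intro mult_right_mono mult_left_mono) auto
  finally have "\<bar>N x - N y\<bar> * (1 / N y) \<le> (\<omega> * \<omega> * norm (x - y)) * \<omega>"
    using N_bounds(1)[OF y] n w by (intro mult_mono) (auto simp: field_simps)
  moreover have "N x / N y - 1 = (N x - N y) * (1 / N y)" using n by (simp add: field_simps)
  ultimately show ?thesis
    using n by (simp add: abs_mult power3_eq_cube norm_minus_commute mult_ac)
qed

lemma ratio_bounds:
  assumes x: "x \<in> X" and y: "y \<in> X"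
  defines "r \<equiv> rdist K (H x) (H y)"
  assumes r: "0 < r" "K = 1 \<Longrightarrow> r < pi"
  shows "K = 1 \<Longrightarrow> 1 \<le> r / sinK K r \<and> r / sinK K r \<le> 1 / C\<^sup>2"
    "K = - 1 \<Longrightarrow> 1 / C\<^sup>2 \<le> r / sinK K r \<and> r / sinK K r \<le> 1"
    "\<bar>r / sinK K r - 1\<bar> \<le> \<omega>\<^sup>2 * r"
proof -
  have pos: "1 \<le> r / sinK K r \<and> r / sinK K r \<le> 1 / C\<^sup>2 \<and> \<bar>r / sinK K r - 1\<bar> \<le> 1 / C\<^sup>2 * r" if K: "K = 1"
    using sin_over_bounds[of r C] r cosK_rdist_pos[OF K x y] C_pos K by (simp add: sinK_def cosK_def r_def)
  have neg: "1 / C\<^sup>2 \<le> r / sinK K r \<and> r / sinK K r \<le> 1 \<and> \<bar>r / sinK K r - 1\<bar> \<le> r" if K: "K = - 1"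
    using sinh_over_bounds[of r C] r cosK_rdist_neg[OF K x y] C_pos K by (simp add: sinK_def cosK_def r_def)
  show "K = 1 \<Longrightarrow> 1 \<le> r / sinK K r \<and> r / sinK K r \<le> 1 / C\<^sup>2" using pos by simp
  show "K = - 1 \<Longrightarrow> 1 / C\<^sup>2 \<le> r / sinK K r \<and> r / sinK K r \<le> 1" using neg by simp
  have "1 / C\<^sup>2 * r \<le> \<omega>\<^sup>2 * r" by (intro mult_right_mono omega_powers) (use r in simp)
  moreover have "1 * r \<le> \<omega>\<^sup>2 * r"
    using omega_ge_1 r by (intro mult_right_mono one_le_power) auto
  ultimately show "\<bar>r / sinK K r - 1\<bar> \<le> \<omega>\<^sup>2 * r" using pos neg K_cases by linarith
qed

text \<open>The origin of the two \<gamma>: the factors of \<kappa> lie in \<open>[1, 1/C^2]\<close>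
  and \<open>[C, 1/C]\<close> for \<open>K = 1\<close>, and in \<open>[1/C^2, 1]\<close> and
  \<open>[1/C, C]\<close> for \<open>K = - 1\<close>. In \<open>\<kappa> - 1\<close> the first
  factor deviates from 1 by at most \<open>\<omega>^2 * r\<close>, hence
  \<open>\<omega>^4 * norm (y - x)\<close>; the other factor contributes a further \<omega>.\<close>

lemma chart_log:
  assumes x: "x \<in> X" and y: "y \<in> X"
  shows "\<exists>\<kappa>. H y \<in> rexp K (H x) ` inj_dom K V (H x) \<and>
    rlog K V (H x) (H y) = \<kappa> *\<^sub>R dH x (y - x) \<and>
    gamma_p K R \<le> \<kappa> \<and> \<kappa> \<le> 1 / gamma_n K R \<and>
    \<bar>\<kappa> - 1\<bar> \<le> 2 * \<omega> ^ 5 * norm (y - x) \<and> rdist K (H x) (H y) \<le> \<omega>\<^sup>2 * norm (y - x)"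
proof -
  let ?r = "rdist K (H x) (H y)" and ?u = "y - x"
  let ?m = "N x / N y" and ?q = "?r / sinK K ?r"
  have hx: "H x \<in> model K V" and hy: "H y \<in> model K V" using H_mem x y by auto
  have r0: "0 \<le> ?r" by (rule rdist_nonneg[OF hx hy])
  have anti: "form K (H x) (H y) \<noteq> - 1" if "K = 1"
  proof -
    have "- 1 < 2 * C\<^sup>2 - 1" using C_pos by simp
    then show ?thesis using cosK_rdist_pos[OF that x y] cosK_rdist[OF hx hy] that by auto
  qed
  have rpi: "?r < pi" if "K = 1" using rdist_less_pi[OF hx hy that anti[OF that]] .
  let ?v = "?q *\<^sub>R (H y - (K * form K (H x) (H y)) *\<^sub>R H x)"
  have log: "?v \<in> inj_dom K V (H x)" "rexp K (H x) ?v = H y"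
    using rexp_log[OF hx hy] anti by blast+
  have rl: "rlog K V (H x) (H y) = (?q * ?m) *\<^sub>R dH x ?u"
    using rlog_eqI[OF hx log(1)] log(2) unfolding tangential_part_H[OF x y] by simp
  have img: "H y \<in> rexp K (H x) ` inj_dom K V (H x)"
    using log by (metis image_eqI)
  have w1: "1 \<le> \<omega>" by (rule omega_ge_1)
  show ?thesis
  proof (cases "?r = 0")
    \<comment> \<open>Here \<open>?q\<close> is \<open>0 / 0 = 0\<close>, not the limit 1. As
      \<open>x = y\<close> and the logarithm vanishes, any multiple fits, and 1 meets all
      bounds.\<close>
    case True
    then have "form K (H x) (H y) = K" using cosK_rdist[OF hx hy] K_cases by auto
    then have "H x = H y" using log(2) True by simp
    then have "x = y" by (rule H_inj[OF x y])
    moreover have "gamma_p K R \<le> 1" "1 \<le> 1 / gamma_n K R"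
      using K_cases C_pos C_le_1 C_ge_1
      by (auto simp: gamma_p_def gamma_n_def cosK_def power_le_one one_le_power)
    ultimately show ?thesis
      using img rl True by (intro exI[of _ 1]) (simp add: dH_def linear_0[OF bounded_linear.linear[OF bounded_linear_psi]])
  next
    case False
    then have rp: "0 < ?r" using r0 by simp
    have s: "0 < sinK K ?r" by (rule sinK_pos[OF rp]) (rule rpi)
    have ratio: "K = 1 \<Longrightarrow> 1 \<le> ?q \<and> ?q \<le> 1 / C\<^sup>2" "K = - 1 \<Longrightarrow> 1 / C\<^sup>2 \<le> ?q \<and> ?q \<le> 1"
      "\<bar>?q - 1\<bar> \<le> \<omega>\<^sup>2 * ?r"
      using ratio_bounds[OF x y rp] rpi by blast+
    note m = N_ratio_le[OF x y]
    have m0: "0 < ?m" using N_pos x y by simp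
    have q0: "0 < ?q" using rp s by simp
    have k1: "gamma_p K R \<le> ?q * ?m \<and> ?q * ?m \<le> 1 / gamma_n K R"
    proof (cases "K = 1")
      case True
      then have g: "gamma_p K R = C\<^sup>2" "gamma_n K R = C ^ 3" by (simp_all add: gamma_p_def gamma_n_def cosK_def)
      have "C\<^sup>2 \<le> 1 * C" using C_le_1[OF True] C_pos by (simp add: power2_eq_square)
      also have "\<dots> \<le> ?q * ?m" using ratio(1)[OF True] m True C_pos by (intro mult_mono) auto
      finally have 1: "gamma_p K R \<le> ?q * ?m" using g by simp
      have "?q * ?m \<le> 1 / C\<^sup>2 * (1 / C)"
        using ratio(1)[OF True] m True C_pos m0 by (intro mult_mono) auto
      also have "\<dots> = 1 / gamma_n K R" using g by (simp add: power2_eq_square power3_eq_cube)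
      finally show ?thesis using 1 by simp
    next
      case False
      then have K: "K = - 1" using K_cases by simp
      then have g: "gamma_p K R = 1 / C ^ 3" "gamma_n K R = 1 / C\<^sup>2" by (simp_all add: gamma_p_def gamma_n_def cosK_def)
      have "gamma_p K R = 1 / C\<^sup>2 * (1 / C)" using g by (simp add: power2_eq_square power3_eq_cube)
      also have "\<dots> \<le> ?q * ?m" using ratio(2)[OF K] m False C_pos q0 by (intro mult_mono) auto
      finally have 1: "gamma_p K R \<le> ?q * ?m" .
      have "?q * ?m \<le> 1 * C" using ratio(2)[OF K] m False m0 by (intro mult_mono) auto
      also have "\<dots> \<le> C\<^sup>2" using C_ge_1[OF K] by (simp add: power2_eq_square)
      also have "\<dots> = 1 / gamma_n K R" using g by simp
      finally show ?thesis using 1 by simp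
    qed
    have rle: "?r \<le> \<omega>\<^sup>2 * norm ?u"
    proof (cases "K = 1")
      case True
      have "?r = ?q * sinK K ?r" using s by simp
      also have "\<dots> \<le> \<omega>\<^sup>2 * norm ?u"
        using ratio(1)[OF True] sinK_rdist_le[OF x y] s True omega_powers(2)
        by (intro mult_mono) auto
      finally show ?thesis .
    next
      case False
      then have "?r \<le> sinK K ?r" using le_sinh[OF r0] by (simp add: sinK_def)
      also have "\<dots> \<le> C\<^sup>2 * norm ?u" using sinK_rdist_le[OF x y] s False by simp
      also have "\<dots> \<le> \<omega>\<^sup>2 * norm ?u" using omega_powers(1) by (intro mult_right_mono) auto
      finally show ?thesis .
    qed
    have "?q * ?m - 1 = (?q - 1) * ?m + (?m - 1)" by (simp add: algebra_simps)
    then have "\<bar>?q * ?m - 1\<bar> \<le> \<bar>(?q - 1) * ?m\<bar> + \<bar>?m - 1\<bar>"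
      using abs_triangle_ineq by metis
    also have "\<bar>(?q - 1) * ?m\<bar> = \<bar>?q - 1\<bar> * ?m"
      using m0 by (simp only: abs_mult abs_of_pos)
    also have "\<bar>?q - 1\<bar> * ?m + \<bar>?m - 1\<bar> \<le> (\<omega>\<^sup>2 * (\<omega>\<^sup>2 * norm ?u)) * \<omega> + \<omega> ^ 3 * norm ?u"
    proof (intro add_mono mult_mono)
      have "\<omega>\<^sup>2 * ?r \<le> \<omega>\<^sup>2 * (\<omega>\<^sup>2 * norm ?u)" using rle by (intro mult_left_mono) auto
      then show "\<bar>?q - 1\<bar> \<le> \<omega>\<^sup>2 * (\<omega>\<^sup>2 * norm ?u)" using ratio(3) by linarith
      show "?m \<le> \<omega>" using m(1) omega by (auto split: if_splits)
      show "\<bar>?m - 1\<bar> \<le> \<omega> ^ 3 * norm ?u" by (rule N_ratio_dist[OF x y])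
    qed (use m0 w1 in auto)
    also have "\<dots> = \<omega> ^ 5 * norm ?u + \<omega> ^ 3 * norm ?u" by (simp add: eval_nat_numeral)
    also have "\<dots> \<le> \<omega> ^ 5 * norm ?u + \<omega> ^ 5 * norm ?u"
      using w1 by (intro add_left_mono mult_right_mono power_increasing) auto
    finally have "\<bar>?q * ?m - 1\<bar> \<le> 2 * \<omega> ^ 5 * norm ?u" by (simp add: mult_ac)
    with img rl k1 rle show ?thesis by blast
  qed
qed

end

section \<open>The pulled back objective\<close>

text \<open>\<open>T\<close> is at most \<open>b * max 1 (sqrt Q)\<close> and \<open>Y\<close> at
  most \<open>d * (2 + Q)^2\<close>, so \<open>N\<close> can be the rounded binary logarithm of the
  latter. Since \<open>ln (2 + Q) \<ge> ln 2\<close>, additive constants are absorbed into the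
  logarithm; this yields the three summands of \<open>c\<close>.\<close>

lemma query_count_bound:
  fixes e1 e2 :: real
  assumes "0 \<le> e1" "0 \<le> e2"
  shows "\<exists>c>0. \<forall>Q T Y. 0 \<le> Q \<longrightarrow> real T \<le> 1 + sqrt (e1 * Q) \<longrightarrow> Y \<le> e2 * Q * (real T * (1 + real T)) \<longrightarrow>
    (\<exists>N. Y \<le> 2 ^ N \<and> T * (2 * real N + 8) \<le> c * max 1 (sqrt Q) * ln (2 + Q))"
proof -
  define b where "b = 1 + sqrt e1"
  define d where "d = 2 * e2 * b\<^sup>2 + 1"
  have b: "1 \<le> b" using assms by (simp add: b_def)
  have d: "1 \<le> d" using assms by (simp add: d_def)
  define c where "c = b * (10 / ln 2 + 2 * ln d / (ln 2)\<^sup>2 + 4 / ln 2)"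
  have l2: "0 < ln (2::real)" by simp
  have "0 < 10 / ln (2::real) + 2 * ln d / (ln 2)\<^sup>2 + 4 / ln 2"
    using d by (intro add_pos_nonneg add_pos_nonneg) auto
  then have "0 < c" using b by (simp add: c_def)
  moreover have "\<exists>N. Y \<le> 2 ^ N \<and> T * (2 * real N + 8) \<le> c * max 1 (sqrt Q) * ln (2 + Q)"
    if Q: "0 \<le> Q" and T: "real T \<le> 1 + sqrt (e1 * Q)" and Y: "Y \<le> e2 * Q * (real T * (1 + real T))" for Q Y :: real and T :: nat
  proof -
    define m where "m = max 1 (sqrt Q)"
    define l where "l = ln (2 + Q)"
    have m1: "1 \<le> m" "sqrt Q \<le> m" by (simp_all add: m_def)
    have mQ: "m\<^sup>2 \<le> 2 + Q" using Q by (auto simp: m_def max_def)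
    have "sqrt (e1 * Q) \<le> sqrt e1 * m" using m1 assms by (simp add: real_sqrt_mult mult_left_mono)
    then have Tm: "real T \<le> b * m" using T m1 by (simp add: b_def algebra_simps)
    have "real T * (1 + real T) \<le> 2 * (b * m)\<^sup>2"
    proof -
      have "real T \<le> (real T)\<^sup>2" by (cases T) (auto simp: power2_eq_square)
      then have "real T * (1 + real T) \<le> 2 * (real T)\<^sup>2" by (simp add: power2_eq_square algebra_simps)
      also have "\<dots> \<le> 2 * (b * m)\<^sup>2" using Tm by (intro mult_left_mono power_mono) auto
      finally show ?thesis .
    qed
    also have "\<dots> \<le> 2 * (b\<^sup>2 * (2 + Q))" using mQ by (simp add: power_mult_distrib mult_left_mono)
    finally have T2: "real T * (1 + real T) \<le> 2 * (b\<^sup>2 * (2 + Q))" .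
    have "e2 * Q * (real T * (1 + real T)) \<le> e2 * (2 + Q) * (2 * (b\<^sup>2 * (2 + Q)))"
      by (rule mult_mono[OF _ T2]) (use assms Q in \<open>auto intro: mult_left_mono\<close>)
    also have "\<dots> = (2 * e2 * b\<^sup>2) * (2 + Q)\<^sup>2" by (simp only: power2_eq_square mult_ac)
    also have "\<dots> \<le> d * (2 + Q)\<^sup>2" by (rule mult_right_mono) (simp_all add: d_def)
    finally have Yd: "Y \<le> d * (2 + Q)\<^sup>2" using Y by linarith
    define N where "N = nat \<lceil>log 2 (d * (2 + Q)\<^sup>2)\<rceil>"
    have "1 \<le> (2 + Q)\<^sup>2" using Q by (intro one_le_power) simp
    then have "1 * 1 \<le> d * (2 + Q)\<^sup>2" using d by (intro mult_mono) simp_all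
    then have pos: "1 \<le> d * (2 + Q)\<^sup>2" by simp
    have log0: "0 \<le> log 2 (d * (2 + Q)\<^sup>2)"
      unfolding log_def by (intro divide_nonneg_pos ln_ge_zero pos) simp
    have "d * (2 + Q)\<^sup>2 = 2 powr log 2 (d * (2 + Q)\<^sup>2)"
      by (rule powr_log_cancel[symmetric]) (use pos in linarith)+
    also have "\<dots> \<le> 2 powr real N" unfolding N_def by (intro powr_mono of_nat_ceiling) simp
    also have "2 powr real N = 2 ^ N" by (rule powr_realpow) simp
    finally have "Y \<le> 2 ^ N" using Yd by linarith
    moreover have "T * (2 * real N + 8) \<le> c * m * l"
    proof -
      have "real N \<le> log 2 (d * (2 + Q)\<^sup>2) + 1"
        using log0 unfolding N_def by linarith
      also have "log 2 (d * (2 + Q)\<^sup>2) = (ln d + 2 * l) / ln 2"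
      proof -
        have "ln (d * (2 + Q)\<^sup>2) = ln d + ln ((2 + Q)\<^sup>2)" by (rule ln_mult_pos) (use d Q in auto)
        also have "ln ((2 + Q)\<^sup>2) = 2 * l" unfolding l_def by (rule trans[OF ln_realpow]) (use Q in simp_all)
        finally show ?thesis by (simp only: log_def)
      qed
      finally have N: "real N \<le> (ln d + 2 * l) / ln 2 + 1" .
      define r where "r = l / ln 2"
      define e where "e = ln d / ln 2"
      have "ln 2 \<le> l" unfolding l_def using Q by (subst ln_le_cancel_iff) simp_all
      then have r: "1 \<le> r" unfolding r_def using l2 by (subst le_divide_eq_1_pos)
      have e: "0 \<le> e" unfolding e_def using d by (intro divide_nonneg_pos ln_ge_zero l2)
      have "real N \<le> e + 2 * r + 1"
        using N unfolding e_def r_def add_divide_distrib by simp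
      then have "2 * real N + 8 \<le> 10 * r + 2 * (e * 1) + 4 * r" using r by linarith
      also have "\<dots> \<le> 10 * r + 2 * (e * r) + 4 * r"
        using mult_left_mono[OF r e] by linarith
      also have "\<dots> = (10 / ln 2 + 2 * ln d / (ln 2)\<^sup>2 + 4 / ln 2) * l"
        unfolding e_def r_def distrib_right power2_eq_square by simp
      finally have "2 * real N + 8 \<le> (10 / ln 2 + 2 * ln d / (ln 2)\<^sup>2 + 4 / ln 2) * l" .
      then have "real T * (2 * real N + 8) \<le> (b * m) * ((10 / ln 2 + 2 * ln d / (ln 2)\<^sup>2 + 4 / ln 2) * l)"
        by (rule mult_mono[OF Tm]) (use b m1 in simp_all)
      also have "\<dots> = c * m * l" unfolding c_def by (simp only: mult_ac)
      finally show ?thesis .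
    qed
    ultimately show ?thesis unfolding m_def l_def by (intro exI[of _ N] conjI)
  qed
  ultimately show ?thesis by (intro exI[of _ c] conjI allI impI)
qed

text \<open>\<open>f\<close> is tied to \<open>F\<close> only on \<open>X\<close>, because an
  inverse formed by \<open>inv_into\<close> is arbitrary elsewhere.\<close>

locale chart_function = model_function K V B M F + model_chart K V x0 \<psi> R \<omega>
  for K :: real and V :: "'a::real_inner set" and B M F x0 \<psi> R \<omega> +
  fixes f :: "'a \<Rightarrow> real" and xg :: "real \<times> 'a" and L Rg :: real
  assumes H_in_M: "x \<in> X \<Longrightarrow> H x \<in> M" and f_eq: "x \<in> X \<Longrightarrow> f x = F (H x)"
    and smooth: "L_smooth K V M L F" and gconvex: "g_convex K V M F" and L_pos: "0 < L"
    and xg: "xg \<in> M" and xg_min: "\<forall>y\<in>M. F xg \<le> F y"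
    and Rg: "rdist K x0 xg \<le> Rg" "K = 1 \<Longrightarrow> Rg < pi / 2" and Rg_ball: "exp_ball K V x0 Rg \<subseteq> M"
begin

abbreviation gf :: "'a \<Rightarrow> 'a" where "gf \<equiv> grad_on V X f"

lemma gradient_chart:
  assumes x: "x \<in> X"
  shows "gf x \<in> V" and "u \<in> V \<Longrightarrow> gf x \<bullet> u = form K (grad (H x)) (dH x u)"
proof -
  have dH: "(H has_derivative dH x) (at x within X)" by (rule dH_has_derivative[OF x])
  have F: "(F has_derivative form K (grad (H x))) (at (H x) within M)"
    by (rule rgrad(2)[OF H_in_M[OF x]])
  have img: "H ` X \<subseteq> M" using H_in_M by blast
  from has_derivative_in_compose[OF dH has_derivative_subset[OF F img]]
  have D: "((\<lambda>w. F (H w)) has_derivative (\<lambda>u. form K (grad (H x)) (dH x u))) (at x within X)" .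
  have f: "(f has_derivative (\<lambda>u. form K (grad (H x)) (dH x u))) (at x within X)"
    by (rule has_derivative_transform[OF x _ D]) (simp add: f_eq)
  have "linear (\<lambda>u. form K (grad (H x)) (dH x u))"
    using D has_derivative_bounded_linear bounded_linear.linear by blast
  then obtain g where g: "g \<in> V" "\<And>u. u \<in> V \<Longrightarrow> form K (grad (H x)) (dH x u) = g \<bullet> u"
    using riesz_finite_span[OF finite_B] V_span by metis
  have "(f has_derivative (\<lambda>u. g \<bullet> u)) (at x within X)"
  \<comment> \<open>Both functionals agree on \<open>V\<close>, which contains all displacements
    within \<open>X\<close>; hence the constant 0.\<close>
  proof (rule has_derivative_quadratic_change[OF f bounded_linear_inner_right])
    fix y assume "y \<in> X"
    then have "y - x \<in> V" using x X_V subspace_V by (simp add: subspace_diff)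
    then show "\<bar>form K (grad (H x)) (dH x (y - x)) - g \<bullet> (y - x)\<bar> \<le> 0 * (norm (y - x))\<^sup>2"
      using g by simp
  qed
  from ball.grad_on_eqI[OF x g(1) this]
  show "gf x \<in> V" "u \<in> V \<Longrightarrow> gf x \<bullet> u = form K (grad (H x)) (dH x u)" using g by simp_all
qed

text \<open>Convexity and smoothness refer to the same logarithm and therefore share one \<kappa>;
  this squeezes \<open>f y\<close> around a single tilted linearisation.\<close>

lemma chart_bounds:
  assumes x: "x \<in> X" and y: "y \<in> X"
  shows "\<exists>\<kappa>. gamma_p K R \<le> \<kappa> \<and> \<kappa> \<le> 1 / gamma_n K R \<and> \<bar>\<kappa> - 1\<bar> \<le> 2 * \<omega> ^ 5 * norm (y - x) \<and>
    f x + \<kappa> * (gf x \<bullet> (y - x)) \<le> f y \<and>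
    f y \<le> f x + \<kappa> * (gf x \<bullet> (y - x)) + L / 2 * (\<omega> ^ 4 * (norm (y - x))\<^sup>2)"
proof -
  obtain \<kappa> where \<kappa>: "H y \<in> rexp K (H x) ` inj_dom K V (H x)"
    "rlog K V (H x) (H y) = \<kappa> *\<^sub>R dH x (y - x)"
    "gamma_p K R \<le> \<kappa>" "\<kappa> \<le> 1 / gamma_n K R" "\<bar>\<kappa> - 1\<bar> \<le> 2 * \<omega> ^ 5 * norm (y - x)"
    "rdist K (H x) (H y) \<le> \<omega>\<^sup>2 * norm (y - x)"
    using chart_log[OF x y] by blast
  have "y - x \<in> V" using x y X_V subspace_V by (simp add: subspace_diff)
  then have inner: "form K (grad (H x)) (rlog K V (H x) (H y)) = \<kappa> * (gf x \<bullet> (y - x))"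
    using gradient_chart(2)[OF x] \<kappa>(2) by simp
  have "F (H x) + form K (grad (H x)) (rlog K V (H x) (H y)) \<le> F (H y)"
    using gconvex H_in_M[OF x] H_in_M[OF y] \<kappa>(1) unfolding g_convex_def by blast
  then have lower: "f x + \<kappa> * (gf x \<bullet> (y - x)) \<le> f y" unfolding inner using f_eq x y by simp
  have "F (H y) \<le> F (H x) + form K (grad (H x)) (rlog K V (H x) (H y)) + L / 2 * (rdist K (H x) (H y))\<^sup>2"
    using smooth H_in_M[OF x] H_in_M[OF y] \<kappa>(1) unfolding L_smooth_def by blast
  then have upper: "f y \<le> f x + \<kappa> * (gf x \<bullet> (y - x)) + L / 2 * (rdist K (H x) (H y))\<^sup>2"
    unfolding inner using f_eq x y by simp
  have "(rdist K (H x) (H y))\<^sup>2 \<le> (\<omega>\<^sup>2 * norm (y - x))\<^sup>2"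
    using \<kappa>(6) rdist_nonneg[OF H_mem[OF x] H_mem[OF y]] by (intro power_mono)
  also have "\<dots> = \<omega> ^ 4 * (norm (y - x))\<^sup>2" by (simp add: power_mult_distrib flip: power_mult)
  finally have "L / 2 * (rdist K (H x) (H y))\<^sup>2 \<le> L / 2 * (\<omega> ^ 4 * (norm (y - x))\<^sup>2)"
    using L_pos by (intro mult_left_mono) auto
  with upper have "f y \<le> f x + \<kappa> * (gf x \<bullet> (y - x)) + L / 2 * (\<omega> ^ 4 * (norm (y - x))\<^sup>2)" by linarith
  with \<kappa> lower show ?thesis by blast
qed

lemma H_0: "H 0 = x0"
  using linear_0[OF bounded_linear.linear[OF bounded_linear_psi]] by (simp add: H_def N_def p_def)

lemma dH_0: "dH 0 u = \<psi> u"
  by (simp add: dH_def N_def)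

lemma Rg_nonneg: "0 \<le> Rg"
  using rdist_nonneg[OF x0_model, of xg] xg M_subset Rg(1) by auto

text \<open>At the centre the derivative of the chart is the isometry \<psi>, so the Euclidean
  gradient has the length of the Riemannian one at \<open>x0\<close>.\<close>

lemma gradient_0: "norm (gf 0) \<le> L * Rg"
proof -
  have x0: "x0 \<in> M" using H_in_M[OF ball.zero_mem] H_0 by simp
  note g = gradient_chart[OF ball.zero_mem, unfolded H_0 dH_0]
  obtain w where w: "w \<in> V" "\<psi> w = grad x0" using psi_surj[OF rgrad(1)[OF x0]] by blast
  have "gf 0 - w \<in> V" using g w subspace_V by (simp add: subspace_diff)
  then have "gf 0 \<bullet> (gf 0 - w) = w \<bullet> (gf 0 - w)"
    using g(2) psi_form w by metis
  then have "(gf 0 - w) \<bullet> (gf 0 - w) = 0" by (simp only: inner_diff_left)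
  then have "gf 0 = w" by simp
  moreover have "norm w = rnorm K (grad x0)"
    unfolding rnorm_def w(2)[symmetric] psi_form[OF w(1) w(1)] by (rule norm_eq_sqrt_inner)
  ultimately show ?thesis
    using rgrad_bound[OF x0 xg xg_min Rg(1) Rg(2) Rg_ball smooth L_pos] by simp
qed

lemma gamma_bounds:
  "0 < gamma_n K R" "gamma_n K R \<le> 1" "0 < gamma_p K R" "gamma_p K R \<le> 1"
  "1 / gamma_n K R \<le> \<omega> ^ 3" "1 / gamma_p K R \<le> \<omega> ^ 3"
proof -
  have eq: "K = 1 \<and> gamma_n K R = C ^ 3 \<and> gamma_p K R = C\<^sup>2 \<or>
      K = - 1 \<and> gamma_n K R = 1 / C\<^sup>2 \<and> gamma_p K R = 1 / C ^ 3"
    using K_cases by (auto simp: gamma_n_def gamma_p_def cosK_def)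
  have w: "1 \<le> \<omega>" by (rule omega_ge_1)
  have pw: "C\<^sup>2 \<le> \<omega>\<^sup>2" "C ^ 3 \<le> \<omega> ^ 3" "(1 / C)\<^sup>2 \<le> \<omega>\<^sup>2" "(1 / C) ^ 3 \<le> \<omega> ^ 3"
    using omega C_pos by (auto intro!: power_mono)
  have "\<omega>\<^sup>2 \<le> \<omega> ^ 3" using w by (intro power_increasing) auto
  then have pw': "C\<^sup>2 \<le> \<omega> ^ 3" "C ^ 3 \<le> \<omega> ^ 3" "1 / C\<^sup>2 \<le> \<omega> ^ 3" "1 / C ^ 3 \<le> \<omega> ^ 3"
    using pw by (auto simp: power_divide)
  show "0 < gamma_n K R" "0 < gamma_p K R" using eq C_pos by auto
  show "gamma_n K R \<le> 1" "gamma_p K R \<le> 1"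
    using eq C_pos C_le_1 C_ge_1 by (auto simp: power_le_one one_le_power)
  show "1 / gamma_n K R \<le> \<omega> ^ 3" "1 / gamma_p K R \<le> \<omega> ^ 3"
    using eq pw' by auto
qed

abbreviation S :: real where "S \<equiv> L * (Rg + 1)"

lemma S_pos: "0 < S" and L_Rg_le: "L * Rg \<le> S" and L_le: "L \<le> S"
  using L_pos Rg_nonneg by (simp, simp_all add: algebra_simps)

text \<open>Starting from \<open>gradient_0\<close>, the oscillation of \<open>f\<close> about the
  centre is at most \<open>3/2 * \<omega>^5 * S\<close> times \<rho>; in the quadratic terms one of
  the two radii is replaced by \<omega>. At \<open>x\<close> two oscillations and a smoothness term
  add up to 5 = 3 + 2, dividing by \<kappa> costs \<open>\<omega>^3\<close>, and \<rho> cancels by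
  \<open>norm_le_of_inner_bound\<close>.\<close>

lemma gradient_bound:
  assumes x: "x \<in> X"
  shows "norm (gf x) \<le> 5 * \<omega> ^ 11 * S"
proof -
  have w: "1 \<le> \<omega>" by (rule omega_ge_1)
  have osc: "\<bar>f y - f 0\<bar> \<le> \<rho> * (3 / 2 * \<omega> ^ 5 * S)" if y: "y \<in> X" for y
  proof -
    obtain \<kappa> where \<kappa>: "gamma_p K R \<le> \<kappa>" "\<kappa> \<le> 1 / gamma_n K R"
      "f 0 + \<kappa> * (gf 0 \<bullet> (y - 0)) \<le> f y"
      "f y \<le> f 0 + \<kappa> * (gf 0 \<bullet> (y - 0)) + L / 2 * (\<omega> ^ 4 * (norm (y - 0))\<^sup>2)"
      using chart_bounds[OF ball.zero_mem y] by blast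
    then have fy: "f 0 + \<kappa> * (gf 0 \<bullet> y) \<le> f y"
      "f y \<le> f 0 + \<kappa> * (gf 0 \<bullet> y) + L / 2 * (\<omega> ^ 4 * (norm y)\<^sup>2)" by simp_all
    have ny: "norm y \<le> \<rho>" using y by (simp add: X_def)
    have "\<bar>gf 0 \<bullet> y\<bar> \<le> norm (gf 0) * norm y" by (rule Cauchy_Schwarz_ineq2)
    also have "\<dots> \<le> S * \<rho>" using gradient_0 ny L_Rg_le S_pos by (intro mult_mono) auto
    finally have "\<kappa> * \<bar>gf 0 \<bullet> y\<bar> \<le> \<omega> ^ 3 * (S * \<rho>)"
      using \<kappa> gamma_bounds w S_pos rho_pos by (intro mult_mono) auto
    also have "\<dots> \<le> \<omega> ^ 5 * (S * \<rho>)"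
      using w S_pos rho_pos by (intro mult_right_mono power_increasing) auto
    finally have 1: "\<bar>\<kappa> * (gf 0 \<bullet> y)\<bar> \<le> \<omega> ^ 5 * (S * \<rho>)"
      using \<kappa> gamma_bounds by (simp add: abs_mult)
    have "(norm y)\<^sup>2 \<le> \<rho> * \<omega>"
      unfolding power2_eq_square using ny rho_le rho_pos by (intro mult_mono) auto
    then have "L / 2 * (\<omega> ^ 4 * (norm y)\<^sup>2) \<le> S / 2 * (\<omega> ^ 4 * (\<rho> * \<omega>))"
      using L_le L_pos w by (intro mult_mono) auto
    also have "\<dots> = \<omega> ^ 5 * (S * \<rho>) / 2" by (simp add: eval_nat_numeral)
    finally have 2: "L / 2 * (\<omega> ^ 4 * (norm y)\<^sup>2) \<le> \<omega> ^ 5 * (S * \<rho>) / 2" .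
    have "\<rho> * (3 / 2 * \<omega> ^ 5 * S) = \<omega> ^ 5 * (S * \<rho>) + \<omega> ^ 5 * (S * \<rho>) / 2" by (simp add: algebra_simps)
    moreover have "0 \<le> L / 2 * (\<omega> ^ 4 * (norm y)\<^sup>2)" using L_pos w by simp
    ultimately show ?thesis using fy 1 2 by linarith
  qed
  have "\<rho> * norm (gf x) \<le> \<rho> * (5 * \<omega> ^ 11 * S)"
  proof (rule ball.norm_le_of_inner_bound[OF gradient_chart(1)[OF x] X_V[OF x]])
    fix y assume y: "y \<in> X"
    obtain \<kappa> where \<kappa>: "gamma_p K R \<le> \<kappa>" "f x + \<kappa> * (gf x \<bullet> (y - x)) \<le> f y"
      "f y \<le> f x + \<kappa> * (gf x \<bullet> (y - x)) + L / 2 * (\<omega> ^ 4 * (norm (y - x))\<^sup>2)"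
      using chart_bounds[OF x y] by blast
    have "(norm (y - x))\<^sup>2 \<le> (2 * \<rho>) * (2 * \<omega>)"
      unfolding power2_eq_square using ball.diam_le[OF y x] rho_le rho_pos by (intro mult_mono) auto
    then have "L / 2 * (\<omega> ^ 4 * (norm (y - x))\<^sup>2) \<le> S / 2 * (\<omega> ^ 4 * ((2 * \<rho>) * (2 * \<omega>)))"
      using L_le L_pos w by (intro mult_mono) auto
    also have "\<dots> = \<rho> * (2 * \<omega> ^ 5 * S)" by (simp add: eval_nat_numeral)
    finally have 2: "L / 2 * (\<omega> ^ 4 * (norm (y - x))\<^sup>2) \<le> \<rho> * (2 * \<omega> ^ 5 * S)" .
    have "0 \<le> L / 2 * (\<omega> ^ 4 * (norm (y - x))\<^sup>2)" using L_pos w by simp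
    then have 3: "\<bar>\<kappa> * (gf x \<bullet> (y - x))\<bar> \<le> \<rho> * (5 * \<omega> ^ 5 * S)"
      using \<kappa>(2,3) osc[OF x] osc[OF y] 2 by linarith
    have k: "1 \<le> \<omega> ^ 3 * \<kappa>"
    proof -
      have "1 \<le> \<omega> ^ 3 * gamma_p K R" using gamma_bounds by (simp add: field_simps)
      also have "\<dots> \<le> \<omega> ^ 3 * \<kappa>" using \<kappa>(1) w by (intro mult_left_mono) auto
      finally show ?thesis .
    qed
    have "\<bar>gf x \<bullet> (y - x)\<bar> \<le> (\<omega> ^ 3 * \<kappa>) * \<bar>gf x \<bullet> (y - x)\<bar>"
      using mult_right_mono[OF k, of "\<bar>gf x \<bullet> (y - x)\<bar>"] by simp
    also have "\<dots> = \<omega> ^ 3 * \<bar>\<kappa> * (gf x \<bullet> (y - x))\<bar>"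
      using \<kappa>(1) gamma_bounds(3) by (simp add: abs_mult)
    also have "\<dots> \<le> \<omega> ^ 3 * (\<rho> * (5 * \<omega> ^ 5 * S))" using 3 w
      by (intro mult_left_mono) auto
    also have "\<dots> = \<rho> * (5 * \<omega> ^ 8 * S)" by (simp add: eval_nat_numeral)
    also have "\<dots> \<le> \<rho> * (5 * \<omega> ^ 11 * S)"
      using w S_pos rho_pos by (intro mult_left_mono mult_right_mono power_increasing) auto
    finally show "\<bar>gf x \<bullet> (y - x)\<bar> \<le> \<rho> * (5 * \<omega> ^ 11 * S)" .
  qed
  then show ?thesis using rho_pos by simp
qed

text \<open>Replacing \<kappa> by 1 costs \<open>\<bar>\<kappa> - 1\<bar>\<close> times the gradient
  term, which is quadratic with constant 2 * 5 and exponent 5 + 11. The remaining 1 covers the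
  smoothness term.\<close>

lemma quadratic_bound:
  assumes x: "x \<in> X" and y: "y \<in> X"
  shows "\<bar>f y - f x - gf x \<bullet> (y - x)\<bar> \<le> 11 * \<omega> ^ 16 * S * (norm (y - x))\<^sup>2"
proof -
  have w: "1 \<le> \<omega>" by (rule omega_ge_1)
  obtain \<kappa> where \<kappa>: "\<bar>\<kappa> - 1\<bar> \<le> 2 * \<omega> ^ 5 * norm (y - x)" "f x + \<kappa> * (gf x \<bullet> (y - x)) \<le> f y"
    "f y \<le> f x + \<kappa> * (gf x \<bullet> (y - x)) + L / 2 * (\<omega> ^ 4 * (norm (y - x))\<^sup>2)"
    using chart_bounds[OF x y] by blast
  have "\<bar>gf x \<bullet> (y - x)\<bar> \<le> norm (gf x) * norm (y - x)" by (rule Cauchy_Schwarz_ineq2)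
  also have "\<dots> \<le> 5 * \<omega> ^ 11 * S * norm (y - x)" using gradient_bound[OF x] by (intro mult_right_mono) auto
  finally have "\<bar>\<kappa> - 1\<bar> * \<bar>gf x \<bullet> (y - x)\<bar> \<le> (2 * \<omega> ^ 5 * norm (y - x)) * (5 * \<omega> ^ 11 * S * norm (y - x))"
    using \<kappa>(1) w by (intro mult_mono) auto
  also have "\<dots> = 10 * (\<omega> ^ 16 * S * (norm (y - x))\<^sup>2)" by (simp add: eval_nat_numeral)
  finally have 1: "\<bar>(\<kappa> - 1) * (gf x \<bullet> (y - x))\<bar> \<le> 10 * (\<omega> ^ 16 * S * (norm (y - x))\<^sup>2)" by (simp add: abs_mult)
  have "L / 2 * (\<omega> ^ 4 * (norm (y - x))\<^sup>2) \<le> S * (\<omega> ^ 16 * (norm (y - x))\<^sup>2)"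
  proof (rule mult_mono)
    show "\<omega> ^ 4 * (norm (y - x))\<^sup>2 \<le> \<omega> ^ 16 * (norm (y - x))\<^sup>2"
      using w by (intro mult_right_mono power_increasing) auto
  qed (use L_le L_pos S_pos w in auto)
  then have 2: "L / 2 * (\<omega> ^ 4 * (norm (y - x))\<^sup>2) \<le> \<omega> ^ 16 * S * (norm (y - x))\<^sup>2" by (simp add: mult_ac)
  have 3: "0 \<le> L / 2 * (\<omega> ^ 4 * (norm (y - x))\<^sup>2)" using L_pos w by simp
  have "f y - f x - gf x \<bullet> (y - x) = (\<kappa> - 1) * (gf x \<bullet> (y - x)) + (f y - f x - \<kappa> * (gf x \<bullet> (y - x)))"
    by (simp add: algebra_simps)
  then have "\<bar>f y - f x - gf x \<bullet> (y - x)\<bar> \<le> 11 * (\<omega> ^ 16 * S * (norm (y - x))\<^sup>2)"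
    using 1 2 3 \<kappa>(2,3) by linarith
  then show ?thesis by (simp add: mult_ac)
qed

text \<open>616 = 56 * 11.\<close>

lemma gradient_lipschitz: "(616 * \<omega> ^ 16 * S)-lipschitz_on X gf"
  using ball.gradient_lipschitz[OF gradient_chart(1) quadratic_bound] S_pos omega_ge_1 by (simp add: mult.assoc)

end

section \<open>The chart as a bijection between the geodesic and the Euclidean ball\<close>

lemma (in model_space) rdist_le_iff:
  assumes "x \<in> model K V" "y \<in> model K V" "0 \<le> r" "K = 1 \<Longrightarrow> r < pi"
  shows "rdist K x y \<le> r \<longleftrightarrow> (if K = 1 then cosK K r \<le> K * form K x y else K * form K x y \<le> cosK K r)"
proof -
  note d = cosK_rdist[OF assms(1,2)] rdist_nonneg[OF assms(1,2)]
  show ?thesis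
  proof (cases "K = 1")
    case True
    have "rdist K x y \<le> pi"
      using model_form_bounds(1)[OF assms(1,2) True] True
      by (auto simp: rdist_def abs_le_iff intro!: arccos_ubound)
    then have "cos r \<le> cos (rdist K x y) \<longleftrightarrow> rdist K x y \<le> r"
      using d assms True by (intro cos_mono_le_eq) auto
    then show ?thesis using d True by (simp add: cosK_def)
  next
    case False
    have "cosh (rdist K x y) \<le> cosh r \<longleftrightarrow> rdist K x y \<le> r"
      using d assms by (intro cosh_real_nonneg_le_iff) auto
    then show ?thesis using d(1) False by (simp add: cosK_def)
  qed
qed

context model_chart
begin

lemma R_less_pi:
  assumes "K = 1"
  shows "R < pi"
  using R_less[OF assms] pi_gt_zero by linarith

lemma rdist_H_le:
  assumes w: "w \<in> X"
  shows "rdist K x0 (H w) \<le> R"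
proof -
  have n: "0 < N w" by (rule N_pos[OF w])
  have "if K = 1 then C \<le> 1 / N w else 1 / N w \<le> C"
  proof (cases "K = 1")
    case True
    then show ?thesis using N_bounds_pos[OF True w] n C_pos by (simp add: field_simps)
  next
    case False
    then have "K = - 1" using K_cases by simp
    then show ?thesis using N_bounds_neg[OF _ w] n C_pos False by (simp add: field_simps)
  qed
  then have "if K = 1 then C \<le> K * form K x0 (H w) else K * form K x0 (H w) \<le> C"
    unfolding form_x0_H[OF X_V[OF w]] .
  then show ?thesis
    by (rule iffD2[OF rdist_le_iff[OF x0_model H_mem[OF w]], rotated 2]) (use R_pos R_less_pi in auto)
qed

lemma geodesic_map_H:
  assumes "w \<in> X" "\<phi> (\<psi> w) = w"
  shows "geodesic_map K x0 \<phi> (H w) = w"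
  using form_x0_H[OF X_V[OF assms(1)]] N_pos[OF assms(1)] assms(2)
  by (simp add: geodesic_map_def) (simp add: H_def p_def)

text \<open>For \<open>c\<close>, the value of \<open>cosK\<close> at the distance to
  \<open>x0\<close>, one gets \<open>N w = 1 / c\<close> and
  \<open>w \<bullet> w = K * (1 / c^2 - 1)\<close>. This turns distance at most \<open>R\<close>
  into norm at most \<rho>.\<close>

lemma H_geodesic_map:
  assumes y: "y \<in> model K V" "rdist K x0 y \<le> R"
    and inv: "\<And>v. v \<in> tangent K V x0 \<Longrightarrow> \<phi> v \<in> V" "\<And>v. v \<in> tangent K V x0 \<Longrightarrow> \<psi> (\<phi> v) = v"
  shows "geodesic_map K x0 \<phi> y \<in> X" "H (geodesic_map K x0 \<phi> y) = y"
proof -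
  define c where "c = K * form K x0 y"
  define v where "v = (1 / c) *\<^sub>R y - x0"
  define w where "w = \<phi> v"
  have cR: "if K = 1 then C \<le> c else c \<le> C"
    unfolding c_def by (rule iffD1[OF rdist_le_iff[OF x0_model y(1)] y(2)]) (use R_pos R_less_pi in auto)
  have c: "0 < c"
  proof (cases "K = 1")
    case False
    then have "K = - 1" using K_cases by simp
    then show ?thesis using model_form_bounds(2)[OF x0_model y(1)] by (simp add: c_def)
  qed (use cR C_pos in simp)
  have fc: "form K x0 y = K * c" "form K y x0 = K * c" by (simp_all add: c_def form_commute[of K y x0])
  have v: "v \<in> tangent K V x0"
    using x0_model y(1) subspace_V c fc
    by (simp add: v_def tangent_def model_def subspace_diff subspace_scale)
  have wV: "w \<in> V" and \<psi>w: "\<psi> w = v" using inv v by (simp_all add: w_def)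
  have "w \<bullet> w = form K v v" using psi_form[OF wV wV] \<psi>w by simp
  also have "\<dots> = K * (1 / c\<^sup>2 - 1)"
    using form_self_model[OF y(1)] fc c by (simp add: v_def power2_eq_square field_simps)
  finally have ww: "w \<bullet> w = K * (1 / c\<^sup>2 - 1)" .
  then have "1 + K * (w \<bullet> w) = (1 / c)\<^sup>2" by (simp add: power_divide)
  then have Nw: "N w = 1 / c" using c by (simp add: N_def)
  have geodesic: "geodesic_map K x0 \<phi> y = w"
    unfolding geodesic_map_def c_def[symmetric] v_def[symmetric] w_def[symmetric] ..
  show "H (geodesic_map K x0 \<phi> y) = y"
    unfolding geodesic H_def Nw p_def \<psi>w using c by (simp add: v_def)
  have "w \<bullet> w \<le> K * (1 / C\<^sup>2 - 1)"
  proof (cases "K = 1")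
    case True
    then have "C\<^sup>2 \<le> c\<^sup>2" using cR C_pos by (intro power_mono) auto
    then show ?thesis using ww True C_pos by (simp add: frac_le)
  next
    case False
    then have "c\<^sup>2 \<le> C\<^sup>2" using cR c by (intro power_mono) auto
    moreover have "K = - 1" using False K_cases by simp
    ultimately show ?thesis using ww c by (simp add: frac_le)
  qed
  also have "\<dots> = \<rho>\<^sup>2" unfolding rho_sq(1)[symmetric] by simp
  finally have "(norm w)\<^sup>2 \<le> \<rho>\<^sup>2" by (simp only: power2_norm_eq_inner)
  then have "norm w \<le> \<rho>" by (rule power2_le_imp_le) (use rho_pos in simp)
  then show "geodesic_map K x0 \<phi> y \<in> X"
    unfolding geodesic using wV by (simp add: X_def)
qed

end

section \<open>Accuracy and number of queries in the chart\<close>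

context chart_function
begin

text \<open>\<open>count\<close> is a hypothesis because \<open>Cq\<close> must be fixed before the
  problem instance. Its first constant bounds the radicand of \<open>num_iterations\<close>, with
  \<omega>-exponents 2 + 6 + 3; its second bounds \<open>G_lip * (2 * T / \<epsilon>)\<close> with
  diameter \<open>2 * \<omega>\<close> and the gradient bound
  \<open>5 * \<omega>^11 * S\<close>.\<close>

lemma accelerated_method_correct:
  fixes c Cq Lt \<epsilon> :: real and xs :: 'a
  defines "T \<equiv> num_iterations (gamma_n K R) (gamma_p K R) Lt \<epsilon> xs" and "Q \<equiv> S / \<epsilon>"
  assumes c: "0 < c"
    and count: "\<forall>Q T Y. 0 \<le> Q \<longrightarrow> real T \<le> 1 + sqrt ((4 * c * \<omega> ^ 11) * Q) \<longrightarrow>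
        Y \<le> ((2 * c * \<omega> + 10 * \<omega> ^ 11) * (4 * \<omega> ^ 4)) * Q * (real T * (1 + real T)) \<longrightarrow>
        (\<exists>N. Y \<le> 2 ^ N \<and> T * (2 * real N + 8) \<le> Cq * max 1 (sqrt Q) * ln (2 + Q))"
    and xs: "xs \<in> X" "\<forall>y\<in>X. f xs \<le> f y"
    and Lt: "0 < Lt" "Lt \<le> c * S" "Lt-lipschitz_on X gf" and \<epsilon>: "0 < \<epsilon>"
  shows "\<exists>x z qs. accelerated_method.run f gf X (gamma_n K R) (gamma_p K R) Lt \<epsilon> T T = Some (x, z, qs) \<and>
    x \<in> X \<and> f x - f xs \<le> \<epsilon> \<and> real (length qs) \<le> Cq * max 1 (sqrt Q) * ln (2 + Q)"
proof -
  have w: "1 \<le> \<omega>" by (rule omega_ge_1)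
  interpret alg: tilted_accelerated_method f gf X "gamma_n K R" "gamma_p K R" Lt \<epsilon> T V "2 * \<rho>" "5 * \<omega> ^ 11 * S"
  proof unfold_locales
    fix x y assume "x \<in> X" "y \<in> X"
    then show "\<exists>\<kappa>. gamma_p K R \<le> \<kappa> \<and> \<kappa> \<le> 1 / gamma_n K R \<and> f x + \<kappa> * (gf x \<bullet> (y - x)) \<le> f y"
      using chart_bounds by blast
  qed (use subspace_V ball.convex ball.zero_mem ball.nearest_point gradient_chart(1) Lt gamma_bounds \<epsilon>
      ball.diam_le gradient_bound X_V in auto)
  have Q: "0 \<le> Q" using S_pos \<epsilon> by (simp add: Q_def)
  note g = gamma_bounds
  have Tle: "real T \<le> 1 + sqrt ((4 * c * \<omega> ^ 11) * Q)"
  proof -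
    have "(norm xs)\<^sup>2 \<le> \<omega>\<^sup>2" using xs(1) rho_le by (intro power_mono) (auto simp: X_def)
    moreover have "(1 / gamma_n K R)\<^sup>2 \<le> (\<omega> ^ 3)\<^sup>2" using g by (intro power_mono) auto
    ultimately have "(4 * Lt) * (norm xs)\<^sup>2 * ((1 / gamma_n K R)\<^sup>2 * (1 / gamma_p K R)) * (1 / \<epsilon>) \<le>
        (4 * (c * S)) * \<omega>\<^sup>2 * ((\<omega> ^ 3)\<^sup>2 * \<omega> ^ 3) * (1 / \<epsilon>)"
      using g Lt w \<epsilon> c S_pos L_pos Rg_nonneg by (intro mult_mono mult_nonneg_nonneg) auto
    also have "\<dots> = (4 * c * \<omega> ^ 11) * Q" by (simp add: Q_def eval_nat_numeral)
    finally have "4 * Lt * (norm xs)\<^sup>2 / ((gamma_n K R)\<^sup>2 * gamma_p K R * \<epsilon>) \<le> (4 * c * \<omega> ^ 11) * Q"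
      by (simp add: power_divide)
    then have le: "sqrt (4 * Lt * (norm xs)\<^sup>2 / ((gamma_n K R)\<^sup>2 * gamma_p K R * \<epsilon>)) \<le> sqrt ((4 * c * \<omega> ^ 11) * Q)"
      by (rule real_sqrt_le_mono)
    have "0 \<le> sqrt (4 * Lt * (norm xs)\<^sup>2 / ((gamma_n K R)\<^sup>2 * gamma_p K R * \<epsilon>))"
      using g Lt \<epsilon> by simp
    then have "real T \<le> sqrt (4 * Lt * (norm xs)\<^sup>2 / ((gamma_n K R)\<^sup>2 * gamma_p K R * \<epsilon>)) + 1"
      unfolding T_def num_iterations_def by linarith
    with le show ?thesis by linarith
  qed
  have "alg.G_lip * (2 * T / \<epsilon>) =
      (Lt * (2 * \<rho>) + 2 * (5 * \<omega> ^ 11 * S)) * (2 * \<rho> * (1 + real T)) * (1 / gamma_n K R) * (2 * T / \<epsilon>)"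
    by (simp add: alg.G_lip_def)
  also have "\<dots> \<le> ((c * S) * (2 * \<omega>) + 2 * (5 * \<omega> ^ 11 * S)) * (2 * \<omega> * (1 + real T)) * \<omega> ^ 3 * (2 * T / \<epsilon>)"
    using Lt c S_pos L_pos Rg_nonneg w rho_le rho_pos g \<epsilon>
    by (intro mult_mono add_mono mult_nonneg_nonneg add_nonneg_nonneg) auto
  also have "\<dots> = ((2 * c * \<omega> + 10 * \<omega> ^ 11) * (4 * \<omega> ^ 4)) * Q * (real T * (1 + real T))"
    by (simp add: Q_def eval_nat_numeral field_simps)
  finally have Y: "alg.G_lip * (2 * T / \<epsilon>) \<le> ((2 * c * \<omega> + 10 * \<omega> ^ 11) * (4 * \<omega> ^ 4)) * Q * (real T * (1 + real T))" .
  obtain N where N: "alg.G_lip * (2 * T / \<epsilon>) \<le> 2 ^ N"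
    "T * (2 * real N + 8) \<le> Cq * max 1 (sqrt Q) * ln (2 + Q)"
    using count Q Tle Y by blast
  obtain x z qs where run: "alg.run T = Some (x, z, qs)" "x \<in> X" "f x - f xs \<le> \<epsilon>" "length qs \<le> T * (2 * N + 8)"
    using alg.accelerated_convergence[OF xs N(1) T_def[THEN meta_eq_to_obj_eq]] by blast
  have "real (length qs) \<le> real (T * (2 * N + 8))" using run(4) of_nat_le_iff by blast
  also have "\<dots> = T * (2 * real N + 8)" by simp
  finally show ?thesis using run N(2) by (intro exI[of _ x] exI[of _ z] exI[of _ qs]) auto
qed

end

theorem theorem6:
  fixes K Rmax :: real
  assumes "K \<in> {1, - 1}" and "Rmax > 0" and "K = 1 \<Longrightarrow> Rmax < pi / 2"
  shows "\<exists>c0>0. \<forall>c\<ge>c0. \<exists>C>0. \<exists>k::nat.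
    \<forall>(V :: 'a::real_inner set) M F L x0 xg xs R Rg \<phi> \<epsilon>.
      subspace V \<and> (\<exists>B. finite B \<and> V = span B) \<and>
      openin (top_of_set (model K V)) M \<and> x0 \<in> M \<and>
      0 < R \<and> R \<le> Rmax \<and> (K = 1 \<longrightarrow> Rg < pi / 2) \<and>
      exp_ball K V x0 Rg \<subseteq> M \<and> exp_ball K V x0 R \<subseteq> M \<and>
      0 < L \<and> twice_differentiable K V M F \<and> L_smooth K V M L F \<and> g_convex K V M F \<and>
      xg \<in> M \<and> (\<forall>x\<in>M. F xg \<le> F x) \<and> rdist K x0 xg \<le> Rg \<and>
      xs \<in> exp_ball K V x0 R \<and> (\<forall>x\<in>exp_ball K V x0 R. F xs \<le> F x) \<and>
      tangent_frame K V x0 \<phi> \<and> 0 < \<epsilon>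
      \<longrightarrow>
      (let B = exp_ball K V x0 R;
           h = geodesic_map K x0 \<phi>;
           hinv = inv_into B h;
           X = h ` B;
           f = F \<circ> hinv;
           gf = grad_on V X f;
           \<gamma>n = gamma_n K R;
           \<gamma>p = gamma_p K R;
           Q = L * (Rg + 1) / \<epsilon>
       in (c * (L * (Rg + 1)))-lipschitz_on X gf \<and>
          (\<forall>Lt. 0 < Lt \<and> Lt \<le> c * (L * (Rg + 1)) \<and> Lt-lipschitz_on X gf \<longrightarrow>
             (let T = num_iterations \<gamma>n \<gamma>p Lt \<epsilon> (h x0 - h xs)
              in \<exists>xT zT qs.
                   accelerated_method.run f gf X \<gamma>n \<gamma>p Lt \<epsilon> T T = Some (xT, zT, qs) \<and>
                   xT \<in> X \<and> hinv xT \<in> B \<and>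
                   F (hinv xT) - F xs \<le> \<epsilon> \<and>
                   real (length qs) \<le> C * max 1 (sqrt Q) * ln (2 + Q) ^ k)))"
proof -
  \<comment> \<open>This depends only on \<open>K\<close> and \<open>Rmax\<close>; by monotonicity
    of cos and cosh the largest radius is the worst.\<close>
  define \<omega> where "\<omega> = (if K = 1 then 1 / cos Rmax else cosh Rmax)"
  have omega: "cosK K R \<le> \<omega> \<and> 1 / cosK K R \<le> \<omega>" if "0 < R" "R \<le> Rmax" for R
  proof (cases "K = 1")
    case True
    have pos: "0 < cos Rmax" using assms True by (intro cos_gt_zero) auto
    have "cos Rmax \<le> cos R" using that assms True by (intro cos_monotone_0_pi_le) auto
    then have "1 / cos R \<le> 1 / cos Rmax" using pos by (intro divide_left_mono mult_pos_pos) auto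
    moreover have "cos R \<le> 1 / cos Rmax"
      using pos order_trans[OF cos_le_one, of "1 / cos Rmax" R] by simp
    ultimately show ?thesis using True by (simp add: \<omega>_def cosK_def)
  next
    case False
    have "1 \<le> cosh R" by (rule cosh_real_ge_1)
    moreover have "cosh R \<le> cosh Rmax" using that by (subst cosh_real_nonneg_le_iff) auto
    moreover have "1 / cosh R \<le> 1" using cosh_real_ge_1[of R] by simp
    then have "1 / cosh R \<le> cosh Rmax" using cosh_real_ge_1[of Rmax] by linarith
    ultimately show ?thesis using False by (simp add: \<omega>_def cosK_def)
  qed
  have "1 \<le> \<omega>"
  proof (cases "K = 1")
    case True
    have "0 < cos Rmax" using assms True by (intro cos_gt_zero) auto
    then show ?thesis using True by (simp add: \<omega>_def)
  qed (simp add: \<omega>_def cosh_real_ge_1)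
  show ?thesis
  \<comment> \<open>The threshold for \<open>c\<close> is the factor of \<open>S\<close> in
    \<open>gradient_lipschitz\<close>.\<close>
  proof (rule exI[of _ "616 * \<omega> ^ 16"], intro conjI allI impI)
    show "0 < 616 * \<omega> ^ 16" using \<open>1 \<le> \<omega>\<close> by simp
    fix c assume c: "616 * \<omega> ^ 16 \<le> c"
    then have c0: "0 < c" using \<open>0 < 616 * \<omega> ^ 16\<close> by linarith
    have "0 \<le> 4 * c * \<omega> ^ 11" "0 \<le> (2 * c * \<omega> + 10 * \<omega> ^ 11) * (4 * \<omega> ^ 4)"
      using c0 \<open>1 \<le> \<omega>\<close> by simp_all
    from query_count_bound[OF this] obtain C where "0 < C" and count:
      "\<forall>Q T Y. 0 \<le> Q \<longrightarrow> real T \<le> 1 + sqrt ((4 * c * \<omega> ^ 11) * Q) \<longrightarrow>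
        Y \<le> ((2 * c * \<omega> + 10 * \<omega> ^ 11) * (4 * \<omega> ^ 4)) * Q * (real T * (1 + real T)) \<longrightarrow>
        (\<exists>N. Y \<le> 2 ^ N \<and> T * (2 * real N + 8) \<le> C * max 1 (sqrt Q) * ln (2 + Q))" by blast
    show "\<exists>C>0. \<exists>k::nat. \<forall>(V :: 'a set) M F L x0 xg xs R Rg \<phi> \<epsilon>.
      subspace V \<and> (\<exists>B. finite B \<and> V = span B) \<and>
      openin (top_of_set (model K V)) M \<and> x0 \<in> M \<and>
      0 < R \<and> R \<le> Rmax \<and> (K = 1 \<longrightarrow> Rg < pi / 2) \<and>
      exp_ball K V x0 Rg \<subseteq> M \<and> exp_ball K V x0 R \<subseteq> M \<and>
      0 < L \<and> twice_differentiable K V M F \<and> L_smooth K V M L F \<and> g_convex K V M F \<and>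
      xg \<in> M \<and> (\<forall>x\<in>M. F xg \<le> F x) \<and> rdist K x0 xg \<le> Rg \<and>
      xs \<in> exp_ball K V x0 R \<and> (\<forall>x\<in>exp_ball K V x0 R. F xs \<le> F x) \<and>
      tangent_frame K V x0 \<phi> \<and> 0 < \<epsilon>
      \<longrightarrow>
      (let B = exp_ball K V x0 R;
           h = geodesic_map K x0 \<phi>;
           hinv = inv_into B h;
           X = h ` B;
           f = F \<circ> hinv;
           gf = grad_on V X f;
           \<gamma>n = gamma_n K R;
           \<gamma>p = gamma_p K R;
           Q = L * (Rg + 1) / \<epsilon>
       in (c * (L * (Rg + 1)))-lipschitz_on X gf \<and>
          (\<forall>Lt. 0 < Lt \<and> Lt \<le> c * (L * (Rg + 1)) \<and> Lt-lipschitz_on X gf \<longrightarrow>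
             (let T = num_iterations \<gamma>n \<gamma>p Lt \<epsilon> (h x0 - h xs)
              in \<exists>xT zT qs.
                   accelerated_method.run f gf X \<gamma>n \<gamma>p Lt \<epsilon> T T = Some (xT, zT, qs) \<and>
                   xT \<in> X \<and> hinv xT \<in> B \<and>
                   F (hinv xT) - F xs \<le> \<epsilon> \<and>
                   real (length qs) \<le> C * max 1 (sqrt Q) * ln (2 + Q) ^ k)))"
    \<comment> \<open>The exponent of the logarithm is 1: only the number of bisections is
      logarithmic.\<close>
    proof (rule exI[of _ C], rule conjI[OF \<open>0 < C\<close>], rule exI[of _ 1], intro allI impI, elim conjE exE)
      fix V B0 :: "'a set" and M :: "(real \<times> 'a) set" and F :: "real \<times> 'a \<Rightarrow> real"
        and L R Rg \<epsilon> :: real and x0 xg xs :: "real \<times> 'a" and \<phi> :: "real \<times> 'a \<Rightarrow> 'a"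
      assume V: "subspace V" "finite B0" "V = span B0" and M: "openin (top_of_set (model K V)) M" "x0 \<in> M"
        and R: "0 < R" "R \<le> Rmax" and Rg: "K = 1 \<longrightarrow> Rg < pi / 2"
        and balls: "exp_ball K V x0 Rg \<subseteq> M" "exp_ball K V x0 R \<subseteq> M"
        and L: "0 < L" and F: "twice_differentiable K V M F" "L_smooth K V M L F" "g_convex K V M F"
        and xg: "xg \<in> M" "\<forall>x\<in>M. F xg \<le> F x" "rdist K x0 xg \<le> Rg"
        and xs: "xs \<in> exp_ball K V x0 R" "\<forall>x\<in>exp_ball K V x0 R. F xs \<le> F x"
        and \<phi>: "tangent_frame K V x0 \<phi>" and \<epsilon>: "0 < \<epsilon>"
      interpret model_space K V by unfold_locales (use assms V in auto)
      have M_sub: "M \<subseteq> model K V" using M(1) by (rule openin_imp_subset)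
      then have x0: "x0 \<in> model K V" using M(2) by blast
      have R_less: "R < pi / 2" if "K = 1" using assms(3)[OF that] R(2) by linarith
      obtain \<psi> where \<psi>: "bounded_linear \<psi>" "\<And>w. w \<in> V \<Longrightarrow> \<psi> w \<in> tangent K V x0"
        "\<And>w. w \<in> V \<Longrightarrow> \<phi> (\<psi> w) = w" "\<And>v. v \<in> tangent K V x0 \<Longrightarrow> \<psi> (\<phi> v) = v"
        "\<And>u v. u \<in> V \<Longrightarrow> v \<in> V \<Longrightarrow> form K (\<psi> u) (\<psi> v) = u \<bullet> v"
        using tangent_frame_inverse[OF V(2,3) x0 \<phi>] by metis
      have \<phi>V: "\<phi> v \<in> V" if "v \<in> tangent K V x0" for v
        using \<phi> that by (auto simp: tangent_frame_def)
      interpret model_chart K V x0 \<psi> R \<omega>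
      proof (intro model_chart.intro model_chart_axioms.intro model_space_axioms)
        show "\<exists>w\<in>V. \<psi> w = t" if "t \<in> tangent K V x0" for t
          using that \<phi>V \<psi>(4) by blast
      qed (use x0 \<psi> R R_less omega[OF R] in auto)
      define h where "h = geodesic_map K x0 \<phi>"
      define Bl where "Bl = exp_ball K V x0 R"
      define hinv where "hinv = inv_into Bl h"
      define f where "f = F \<circ> hinv"
      have Bl: "Bl = {y \<in> model K V. rdist K x0 y \<le> R}"
        unfolding Bl_def using balls(2) M_sub R_less_pi by (intro exp_ball_eq x0) auto
      have h_H: "h (H w) = w" if "w \<in> X" for w
        unfolding h_def using that \<psi>(3) X_V by (intro geodesic_map_H) auto
      have H_Bl: "H w \<in> Bl" if "w \<in> X" for w
        unfolding Bl using that rdist_H_le H_mem by simp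
      have h_X: "h y \<in> X" and H_h: "H (h y) = y" if "y \<in> Bl" for y
        unfolding h_def using that Bl \<phi>V \<psi>(4) H_geodesic_map[of y \<phi>] by auto
      have X: "h ` Bl = X"
        using h_X H_Bl h_H by (force intro: rev_image_eqI)
      have "inj_on h Bl" using H_h by (metis inj_onI)
      then have hinv: "hinv w = H w" if "w \<in> X" for w
        unfolding hinv_def using that H_Bl h_H by (intro inv_into_f_eq) auto
      interpret chart_function K V B0 M F x0 \<psi> R \<omega> f xg L Rg
        by unfold_locales (use V M F L xg Rg balls H_Bl hinv Bl_def in
            \<open>auto simp: twice_differentiable_def f_def\<close>)
      have xsX: "h xs \<in> X" using h_X xs(1) by (simp add: Bl_def)
      have f_xs: "f (h xs) = F xs" using f_eq[OF xsX] H_h xs(1) by (simp add: Bl_def)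
      have f_min: "\<forall>y\<in>X. f (h xs) \<le> f y"
        using f_xs f_eq H_Bl xs(2) by (simp add: Bl_def)
      have h0: "h x0 = 0" using h_H[OF ball.zero_mem] by (simp add: H_0)
      have "(c * S)-lipschitz_on X gf"
        by (rule lipschitz_on_le[OF gradient_lipschitz]) (use c S_pos in \<open>simp add: mult_right_mono\<close>)
      moreover have "\<exists>xT zT qs.
          accelerated_method.run f gf X (gamma_n K R) (gamma_p K R) Lt \<epsilon> T T = Some (xT, zT, qs) \<and>
          xT \<in> X \<and> hinv xT \<in> Bl \<and> F (hinv xT) - F xs \<le> \<epsilon> \<and>
          real (length qs) \<le> C * max 1 (sqrt (S / \<epsilon>)) * ln (2 + S / \<epsilon>) ^ 1"
        if Lt: "0 < Lt" "Lt \<le> c * S" "Lt-lipschitz_on X gf"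
          and T: "T = num_iterations (gamma_n K R) (gamma_p K R) Lt \<epsilon> (h x0 - h xs)" for Lt T
      proof -
        \<comment> \<open>\<open>h x0\<close> is 0 and the norm ignores the sign.\<close>
        have T': "num_iterations (gamma_n K R) (gamma_p K R) Lt \<epsilon> (h xs) = T"
          unfolding T h0 by (simp add: num_iterations_def)
        from accelerated_method_correct[OF c0 count xsX f_min Lt \<epsilon>, unfolded T']
        obtain x z qs where *: "accelerated_method.run f gf X (gamma_n K R) (gamma_p K R) Lt \<epsilon> T T = Some (x, z, qs)"
          "x \<in> X" "f x - f (h xs) \<le> \<epsilon>" "real (length qs) \<le> C * max 1 (sqrt (S / \<epsilon>)) * ln (2 + S / \<epsilon>)"
          by blast
        moreover have "F (hinv x) - F xs \<le> \<epsilon>" using *(3) f_xs by (simp add: f_def)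
        moreover have "hinv x \<in> Bl" using hinv H_Bl *(2) by simp
        ultimately show ?thesis by auto
      qed
      ultimately show "let B = exp_ball K V x0 R;
           h = geodesic_map K x0 \<phi>;
           hinv = inv_into B h;
           X = h ` B;
           f = F \<circ> hinv;
           gf = grad_on V X f;
           \<gamma>n = gamma_n K R;
           \<gamma>p = gamma_p K R;
           Q = L * (Rg + 1) / \<epsilon>
       in (c * (L * (Rg + 1)))-lipschitz_on X gf \<and>
          (\<forall>Lt. 0 < Lt \<and> Lt \<le> c * (L * (Rg + 1)) \<and> Lt-lipschitz_on X gf \<longrightarrow>
             (let T = num_iterations \<gamma>n \<gamma>p Lt \<epsilon> (h x0 - h xs)
              in \<exists>xT zT qs.
                   accelerated_method.run f gf X \<gamma>n \<gamma>p Lt \<epsilon> T T = Some (xT, zT, qs) \<and>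
                   xT \<in> X \<and> hinv xT \<in> B \<and>
                   F (hinv xT) - F xs \<le> \<epsilon> \<and>
                   real (length qs) \<le> C * max 1 (sqrt Q) * ln (2 + Q) ^ 1))"
        unfolding Let_def Bl_def[symmetric] h_def[symmetric] X hinv_def[symmetric] f_def[symmetric]
        by blast
    qed
  qed
qed

end
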